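(* For each $k\in\mathbb{N}$, there is a polynomial-time certifying algorithm for $k$-Coloring of (co-gem, house)-free graphs.
   Context: All graphs are finite, simple and undirected; $\mathbb{N}=\{1,2,3,\ldots\}$. For a fixed $k$, the $k$-Coloring problem asks whether a given graph $G$ is $k$-colorable (i.e. $\chi(G)\le k$). A graph $G$ is $m$-vertex-critical if $\chi(G)=m$ and $\chi(G-v)<m$ for all $v\in V(G)$. An algorithm is certifying if with each output it returns a certificate of correctness that can be verified in polynomial time; for $k$-Coloring, such an algorithm outputs a $k$-coloring of $G$ when $G$ is $k$-colorable, and a $(k+1)$-vertex-critical induced subgraph of $G$ otherwise. A graph is $(H_1,H_2)$-free if it contains neither $H_1$ nor $H_2$ as an induced subgraph. The co-gem is $P_4+P_1$, the disjoint union of a chordless path on four vertices and an isolated vertex. The house is the complement of the chordless path $P_5$ on five vertices. *)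

theory Defs
  imports "Graph_Theory.Graph_Theory" "HOL-Computational_Algebra.Polynomial"
begin

section \<open>Coloring and vertex-critical graphs\<close>

text \<open>As in the Graph-Theory entry, an undirected edge is a pair of opposite arcs; the locales
  \<^locale>\<open>graph\<close> and \<^locale>\<open>pair_graph\<close> describe the finite simple undirected graphs.\<close>

definition proper_coloring :: "('a, 'b) pre_digraph \<Rightarrow> nat \<Rightarrow> ('a \<Rightarrow> nat) \<Rightarrow> bool" where
  "proper_coloring G k f \<longleftrightarrow>
     f ` verts G \<subseteq> {..<k} \<and> (\<forall>u v. u \<rightarrow>\<^bsub>G\<^esub> v \<longrightarrow> f u \<noteq> f v)"

definition colorable :: "('a, 'b) pre_digraph \<Rightarrow> nat \<Rightarrow> bool" where
  "colorable G k \<longleftrightarrow> (\<exists>f. proper_coloring G k f)"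

definition chromatic_number :: "('a, 'b) pre_digraph \<Rightarrow> nat" where
  "chromatic_number G = (LEAST k. colorable G k)"

definition vertex_critical :: "nat \<Rightarrow> ('a, 'b) pre_digraph \<Rightarrow> bool" where
  "vertex_critical m G \<longleftrightarrow>
     chromatic_number G = m \<and>
     (\<forall>v\<in>verts G. chromatic_number (pre_digraph.del_vert G v) < m)"


section \<open>Forbidden induced subgraphs\<close>

definition induced_free :: "('c, 'd) pre_digraph \<Rightarrow> ('a, 'b) pre_digraph \<Rightarrow> bool" where
  "induced_free H G \<longleftrightarrow> \<not> (\<exists>S\<subseteq>verts G. digraph_iso H (G \<restriction> S))"

definition path_graph :: "nat \<Rightarrow> nat pair_pre_digraph" where
  "path_graph n =
     \<lparr> pverts = {..<n}, parcs = {(i, j). i < n \<and> j < n \<and> (j = Suc i \<or> i = Suc j)} \<rparr>"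

definition complement :: "'a pair_pre_digraph \<Rightarrow> 'a pair_pre_digraph" where
  "complement G =
     \<lparr> pverts = pverts G,
       parcs = {(u, v). u \<in> pverts G \<and> v \<in> pverts G \<and> u \<noteq> v \<and> (u, v) \<notin> parcs G} \<rparr>"

definition disjoint_union ::
  "'a pair_pre_digraph \<Rightarrow> 'b pair_pre_digraph \<Rightarrow> ('a + 'b) pair_pre_digraph" where
  "disjoint_union G H =
     \<lparr> pverts = pverts G <+> pverts H,
       parcs = map_prod Inl Inl ` parcs G \<union> map_prod Inr Inr ` parcs H \<rparr>"

definition co_gem :: "(nat + nat) pair_pre_digraph" where
  "co_gem = disjoint_union (path_graph 4) (path_graph 1)"

definition house :: "nat pair_pre_digraph" where
  "house = complement (path_graph 5)"


section \<open>Random access machine programs and polynomial time\<close>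

text \<open>
  The model of computation is a structured unit-cost random access machine. Its memory consists of
  arrays of natural numbers, named by natural numbers (a program mentions only finitely many);
  cell 0 of an array can serve as a scalar variable. Subtraction is truncated. There is
  no multiplication, so a fixed program running for \<open>t\<close> steps produces only numbers
  of bit length linear in \<open>t\<close> and in the bit length of the input; and as the expressions in a fixed
  program have bounded size, unit cost per command is polynomially equivalent to time on a Turing
  machine.
\<close>

type_synonym state = "nat \<Rightarrow> nat \<Rightarrow> nat"

datatype aexp = Num nat | Read nat aexp | Plus aexp aexp | Minus aexp aexp

datatype bexp = Less aexp aexp | Neg bexp | Conj bexp bexp

datatype com =
    Skip
  | Write nat aexp aexp
  | Seq com com
  | Cond bexp com com
  | While bexp com

primrec aval :: "aexp \<Rightarrow> state \<Rightarrow> nat" where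
  "aval (Num m) s = m"
| "aval (Read a e) s = s a (aval e s)"
| "aval (Plus e e') s = aval e s + aval e' s"
| "aval (Minus e e') s = aval e s - aval e' s"

primrec bval :: "bexp \<Rightarrow> state \<Rightarrow> bool" where
  "bval (Less e e') s \<longleftrightarrow> aval e s < aval e' s"
| "bval (Neg b) s \<longleftrightarrow> \<not> bval b s"
| "bval (Conj b b') s \<longleftrightarrow> bval b s \<and> bval b' s"

text \<open>\<open>exec c s t s'\<close>: started in state \<open>s\<close>, program \<open>c\<close> halts in state \<open>s'\<close> after \<open>t\<close> steps.
  The command \<open>Write a i e\<close> stores the value of \<open>e\<close> in the cell of array \<open>a\<close> with the index
  given by \<open>i\<close>.\<close>

inductive exec :: "com \<Rightarrow> state \<Rightarrow> nat \<Rightarrow> state \<Rightarrow> bool" where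
  exec_Skip: "exec Skip s 1 s"
| exec_Write: "exec (Write a i e) s 1 (s(a := (s a)(aval i s := aval e s)))"
| exec_Seq: "exec c s t s' \<Longrightarrow> exec c' s' t' s'' \<Longrightarrow> exec (Seq c c') s (t + t') s''"
| exec_CondTrue: "bval b s \<Longrightarrow> exec c s t s' \<Longrightarrow> exec (Cond b c c') s (1 + t) s'"
| exec_CondFalse: "\<not> bval b s \<Longrightarrow> exec c' s t s' \<Longrightarrow> exec (Cond b c c') s (1 + t) s'"
| exec_WhileFalse: "\<not> bval b s \<Longrightarrow> exec (While b c) s 1 s"
| exec_WhileTrue:
    "bval b s \<Longrightarrow> exec c s t s' \<Longrightarrow> exec (While b c) s' t' s'' \<Longrightarrow>
     exec (While b c) s (1 + t + t') s''"

inductive_cases exec_SkipE: "exec Skip s t s'"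
  and exec_WriteE: "exec (Write a i e) s t s'"
  and exec_SeqE: "exec (Seq c c') s t s'"
  and exec_CondE: "exec (Cond b c c') s t s'"
  and exec_WhileE: "exec (While b c) s t s'"

lemma exec_deterministic:
  assumes "exec c s t s'" and "exec c s u r"
  shows "u = t \<and> r = s'"
  using assms
proof (induction arbitrary: u r rule: exec.induct)
  case (exec_Skip s)
  then show ?case by (rule exec_SkipE) simp
next
  case (exec_Write a i e s)
  then show ?case by (rule exec_WriteE) simp
next
  case (exec_Seq c s t s' c' t' s'')
  from exec_Seq.prems obtain v q v' where "u = v + v'" and 1: "exec c s v q" and 2: "exec c' q v' r"
    by (rule exec_SeqE)
  moreover from exec_Seq.IH(1)[OF 1] have "v = t" "q = s'" by simp_all
  ultimately show ?case using exec_Seq.IH(2)[of v' r] by simp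
next
  case (exec_CondTrue b s c t s' c')
  from exec_CondTrue.prems show ?case
    by (rule exec_CondE) (use exec_CondTrue.hyps in \<open>auto dest: exec_CondTrue.IH\<close>)
next
  case (exec_CondFalse b s c' t s' c)
  from exec_CondFalse.prems show ?case
    by (rule exec_CondE) (use exec_CondFalse.hyps in \<open>auto dest: exec_CondFalse.IH\<close>)
next
  case (exec_WhileFalse b s c)
  from exec_WhileFalse.prems show ?case
    by (rule exec_WhileE) (use exec_WhileFalse.hyps in simp_all)
next
  case (exec_WhileTrue b s c t s' t' s'')
  from exec_WhileTrue.prems show ?case
  proof (rule exec_WhileE)
    fix v q v'
    assume 0: "u = Suc (v + v')" and 1: "exec c s v q" and 2: "exec (While b c) q v' r"
    from exec_WhileTrue.IH(1)[OF 1] have "v = t" "q = s'" by simp_all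
    with 0 2 exec_WhileTrue.IH(2)[of v' r] show ?case by simp
  qed (use exec_WhileTrue.hyps in simp)
qed

text \<open>Both the input and the output word occupy array 0, with their length in cell 0 of array 1;
  all other cells are initially 0.\<close>

definition init_state :: "nat list \<Rightarrow> state" where
  "init_state x = (\<lambda>a i. if a = 0 \<and> i < length x then x ! i
                         else if a = 1 \<and> i = 0 then length x else 0)"

definition output_word :: "state \<Rightarrow> nat list" where
  "output_word s = map (s 0) [0..<s 1 0]"

definition returns :: "com \<Rightarrow> nat list \<Rightarrow> nat list \<Rightarrow> bool" where
  "returns c x y \<longleftrightarrow> (\<exists>t s. exec c (init_state x) t s \<and> output_word s = y)"

definition poly_time_on :: "nat list set \<Rightarrow> com \<Rightarrow> bool" where
  "poly_time_on X c \<longleftrightarrow>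
     (\<exists>p :: nat poly. \<forall>x\<in>X. \<exists>t s. exec c (init_state x) t s \<and> t \<le> poly p (length x))"


section \<open>Certifying algorithms for coloring\<close>

text \<open>An input graph has the vertices \<open>0, \<dots>, n - 1\<close> and is given by \<open>n\<close> followed by the rows of its
  adjacency matrix.\<close>

definition input_graph :: "nat pair_pre_digraph \<Rightarrow> bool" where
  "input_graph G \<longleftrightarrow> pair_graph G \<and> (\<exists>n. pverts G = {..<n})"

definition encode_graph :: "nat pair_pre_digraph \<Rightarrow> nat list" where
  "encode_graph G = (let n = card (pverts G) in
     n # [of_bool ((i, j) \<in> parcs G). i \<leftarrow> [0..<n], j \<leftarrow> [0..<n]])"

datatype certificate = Coloring "nat \<Rightarrow> nat" | Critical_Subgraph "nat set"

primrec valid_certificate :: "nat \<Rightarrow> nat pair_pre_digraph \<Rightarrow> certificate \<Rightarrow> bool" where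
  "valid_certificate k G (Coloring f) \<longleftrightarrow> proper_coloring G k f"
| "valid_certificate k G (Critical_Subgraph S) \<longleftrightarrow>
     S \<subseteq> pverts G \<and> vertex_critical (k + 1) (G \<restriction> S)"

text \<open>The leading number tells the two kinds of certificates apart; it is followed by the list of
  colors, or by the characteristic vector of the vertex set of the induced subgraph.\<close>

primrec encode_certificate :: "nat pair_pre_digraph \<Rightarrow> certificate \<Rightarrow> nat list" where
  "encode_certificate G (Coloring f) = 0 # map f [0..<card (pverts G)]"
| "encode_certificate G (Critical_Subgraph S) =
     1 # map (\<lambda>v. of_bool (v \<in> S)) [0..<card (pverts G)]"

text \<open>\<open>A\<close> is a polynomial-time algorithm for \<open>k\<close>-Coloring on the graph class \<open>\<G>\<close> that returns a
  certificate with every answer. \<open>V\<close> is the polynomial-time verifier: given a graph from \<open>\<G>\<close>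
  followed by an arbitrary word, it answers \<open>[1]\<close> exactly if the word is a valid certificate.\<close>

definition poly_time_certifying_coloring ::
  "nat \<Rightarrow> nat pair_pre_digraph set \<Rightarrow> com \<Rightarrow> com \<Rightarrow> bool" where
  "poly_time_certifying_coloring k \<G> A V \<longleftrightarrow>
     poly_time_on (encode_graph ` \<G>) A \<and>
     (\<forall>G\<in>\<G>.
        (colorable (with_proj G) k \<longrightarrow>
           (\<exists>f. valid_certificate k G (Coloring f) \<and>
                returns A (encode_graph G) (encode_certificate G (Coloring f)))) \<and>
        (\<not> colorable (with_proj G) k \<longrightarrow>
           (\<exists>S. valid_certificate k G (Critical_Subgraph S) \<and>
                returns A (encode_graph G) (encode_certificate G (Critical_Subgraph S))))) \<and>
     poly_time_on {encode_graph G @ w | G w. G \<in> \<G>} V \<and>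
     (\<forall>G\<in>\<G>. \<forall>w. returns V (encode_graph G @ w) [1] \<longleftrightarrow>
        (\<exists>c. valid_certificate k G c \<and> w = encode_certificate G c))"

end

theory Submission
  imports Defs "HOL-Library.FuncSet"
begin

text \<open>Call an endomorphism of a graph that misses some vertex a fold. If \<open>r\<close> folds \<open>G\<close>, then \<open>G\<close> is
\<open>k\<close>-colourable exactly if the subgraph induced by the image of \<open>r\<close> is, and composing a colouring of
the image with \<open>r\<close> colours \<open>G\<close>. Everything rests on one structural fact, \<open>small_or_foldable\<close>: a
\<open>k\<close>-colourable (co-gem, house)-free graph with more than \<open>core_bound k\<close> vertices has a fold that
moves at most \<open>2 * k\<close> vertices. Such a fold can be found by trying all modifications of the identity
in at most \<open>2 * k\<close> places, which takes polynomial time because \<open>k\<close> is fixed. Folding as long as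
possible leads to a core, and then all colourings of at most \<open>core_bound k\<close> vertices are tried. If
none of them colours the core, then the graph is not \<open>k\<close>-colourable: otherwise the core, being
\<open>k\<close>-colourable and without folds, would be small enough for the search to succeed.
The class of graphs is hereditary, so this procedure also decides \<open>k\<close>-colourability of induced
subgraphs. Deleting vertices greedily while the rest stays uncolourable therefore produces a
\<open>(k + 1)\<close>-vertex-critical induced subgraph, and a claimed critical subgraph can be verified by
colouring it as a whole, which must fail, and with each of its vertices removed in turn.

The structural fact is proved as follows. Suppose that the \<open>k\<close>-colourable graph \<open>G\<close> has no such
fold. Then no vertex dominates a nonadjacent one, and a module without an induced four-vertex path
is a clique (\<open>P4_free_module_clique\<close>). Hence if \<open>G\<close> is large, the vertices of some colour class \<open>X\<close>
have many different traces on some colour class \<open>Y\<close>. As \<open>G\<close> contains no co-gem, two different traces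
that meet cover \<open>Y\<close>; so, apart from the two trivial traces, either all traces are pairwise disjoint or
all their complements are (\<open>disjoint_or_codisjoint\<close>). This yields a large induced matching or a
large comatching, that is, a complete bipartite graph minus a perfect matching, between independent
sets.

In the presence of a large comatching every vertex is adjacent to all of it or behaves like a vertex
of one of its two sides. The components of either side are modules, hence cliques, and nonadjacency
pairs them off across the two sides. With more than \<open>k\<close> pairs, two of them can be chosen such that one
clique of the first pair maps injectively into its counterpart in the second pair while the other
clique of the second pair maps injectively back, and this is a fold (\<open>comatching_impossible\<close>).
In the presence of a large induced matching, the sets of matching edges to which the vertices are
completely joined form, up to complementation, a laminar family whose chains have at most \<open>2 * k\<close>
members. So many matching edges can be chosen that no vertex splits in an essential way
(\<open>obtain_unsplit\<close>). The components around these edges cannot all be modules with the same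
neighbours, and the vertices that tell them apart form a large comatching together with the edges
(\<open>unsplit_matching_impossible\<close>), which is impossible.\<close>

section \<open>Sets without an induced path on four vertices\<close>

definition P4_free_on :: "('a \<Rightarrow> 'a \<Rightarrow> bool) \<Rightarrow> 'a set \<Rightarrow> bool" where
  "P4_free_on E W \<longleftrightarrow>
     (\<forall>a\<in>W. \<forall>b\<in>W. \<forall>c\<in>W. \<forall>d\<in>W. distinct [a, b, c, d] \<longrightarrow>
        E a b \<longrightarrow> E b c \<longrightarrow> E c d \<longrightarrow> E a c \<or> E a d \<or> E b d)"

lemma P4_free_onD:
  assumes "P4_free_on E W" "a \<in> W" "b \<in> W" "c \<in> W" "d \<in> W" "distinct [a, b, c, d]"
    "E a b" "E b c" "E c d"
  shows "E a c \<or> E a d \<or> E b d"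
  using assms unfolding P4_free_on_def by blast

lemma P4_free_on_subset: "P4_free_on E W \<Longrightarrow> W' \<subseteq> W \<Longrightarrow> P4_free_on E W'"
  unfolding P4_free_on_def by blast

text \<open>The path on four vertices is self-complementary: the complement of the path \<open>a b c d\<close> is the path
\<open>b d a c\<close>. This halves the case distinctions below.\<close>

lemma P4_free_on_complement:
  assumes sym: "\<And>x y. E x y \<Longrightarrow> E y x" and free: "P4_free_on E W"
  shows "P4_free_on (\<lambda>x y. \<not> E x y) W"
  unfolding P4_free_on_def
proof (intro ballI impI, rule ccontr)
  fix a b c d
  assume *: "a \<in> W" "b \<in> W" "c \<in> W" "d \<in> W" "distinct [a, b, c, d]"
    "\<not> E a b" "\<not> E b c" "\<not> E c d" "\<not> (\<not> E a c \<or> \<not> E a d \<or> \<not> E b d)"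
  then have "distinct [b, d, a, c]" by auto
  from P4_free_onD[OF free *(2,4,1,3) this] * sym show False by blast
qed

text \<open>A set has such a cut exactly if the graph or its complement is disconnected on it.\<close>

definition homogeneous_cut :: "('a \<Rightarrow> 'a \<Rightarrow> bool) \<Rightarrow> 'a set \<Rightarrow> 'a set \<Rightarrow> 'a set \<Rightarrow> bool" where
  "homogeneous_cut E W A B \<longleftrightarrow>
     A \<noteq> {} \<and> B \<noteq> {} \<and> A \<inter> B = {} \<and> A \<union> B = W \<and>
     ((\<forall>a\<in>A. \<forall>b\<in>B. E a b) \<or> (\<forall>a\<in>A. \<forall>b\<in>B. \<not> E a b))"

lemma homogeneous_cut_complement:
  "homogeneous_cut (\<lambda>x y. \<not> E x y) W A B \<longleftrightarrow> homogeneous_cut E W A B"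
  unfolding homogeneous_cut_def by auto

text \<open>If \<open>v\<close> has neighbours in both parts \<open>A\<close> and \<open>B\<close> and a nonneighbour in \<open>A\<close>, then the nonneighbours of
\<open>v\<close> in \<open>A\<close> are separated from everything else: an edge from one of them to a neighbour of \<open>v\<close> in \<open>A\<close>
would extend through \<open>v\<close> to an induced path ending in \<open>B\<close>.\<close>

lemma homogeneous_cut_insert:
  assumes sym: "\<And>x y. E x y \<Longrightarrow> E y x" and free: "P4_free_on E (insert v W)" and v: "v \<notin> W"
    and AB: "A \<noteq> {}" "B \<noteq> {}" "A \<inter> B = {}" "A \<union> B = W" "\<forall>a\<in>A. \<forall>b\<in>B. \<not> E a b"
  shows "\<exists>A B. homogeneous_cut E (insert v W) A B"
proof -
  have aux: "\<exists>A B. homogeneous_cut E (insert v W) A B"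
    if AB: "A \<noteq> {}" "B \<noteq> {}" "A \<inter> B = {}" "A \<union> B = W" "\<forall>a\<in>A. \<forall>b\<in>B. \<not> E a b"
      and w: "w \<in> A" "\<not> E v w" for A B w
  proof (cases "\<exists>b\<in>B. E v b")
    case False
    then have "homogeneous_cut E (insert v W) A (insert v B) \<or> (\<exists>a\<in>A. E a v)"
      using AB v sym unfolding homogeneous_cut_def by auto
    \<comment> \<open>Without a neighbour in \<open>B\<close>, the new vertex can join the side of \<open>A\<close>.\<close>
    moreover have "homogeneous_cut E (insert v W) B (insert v A)"
      using AB v False sym unfolding homogeneous_cut_def by blast
    ultimately show ?thesis by blast
  next
    case True
    then obtain b where b: "b \<in> B" "E v b" by blast
    let ?N = "{a \<in> A. \<not> E v a}"
    have "\<not> E a a'" if "a \<in> ?N" "a' \<in> A - ?N" for a a'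
    proof
      assume "E a a'"
      moreover have "distinct [a, a', v, b]" using that v AB b by auto
      moreover have "\<not> E a v" "\<not> E a b" "\<not> E a' b" "E a' v"
        using that AB b sym by blast+
      ultimately show False
        using P4_free_onD[OF free, of a a' v b] that b AB by auto
    qed
    then have "homogeneous_cut E (insert v W) ?N (insert v (W - ?N))"
      using AB v w sym unfolding homogeneous_cut_def by blast
    then show ?thesis by blast
  qed
  show ?thesis
  proof (cases "\<forall>w\<in>W. E v w")
    case True
    then have "homogeneous_cut E (insert v W) {v} W"
      using v AB unfolding homogeneous_cut_def by auto
    then show ?thesis by blast
  next
    case False
    then obtain w where "w \<in> W" "\<not> E v w" by blast
    then consider "w \<in> A" | "w \<in> B" using AB by blast
    then show ?thesis
      using aux[of A B w] aux[of B A w] AB sym \<open>\<not> E v w\<close> by cases blast+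
  qed
qed

text \<open>Seinsche's theorem on graphs without an induced four-vertex path. The induction adds one vertex at
a time and passes to the complement if the cut is a complete one.\<close>

lemma P4_free_homogeneous_cut:
  assumes "finite W" and sym: "\<And>x y. E x y \<Longrightarrow> E y x"
    and "P4_free_on E W" and "card W \<ge> 2"
  shows "\<exists>A B. homogeneous_cut E W A B"
  using assms(1,3,4)
proof (induction rule: finite_induct)
  case empty
  then show ?case by simp
next
  case (insert v W)
  show ?case
  proof (cases "card W \<ge> 2")
    case True
    then obtain A B where "homogeneous_cut E W A B"
      using insert P4_free_on_subset by blast
    then have AB: "A \<noteq> {}" "B \<noteq> {}" "A \<inter> B = {}" "A \<union> B = W"
      and cut: "(\<forall>a\<in>A. \<forall>b\<in>B. \<not> E a b) \<or> (\<forall>a\<in>A. \<forall>b\<in>B. \<not> \<not> E a b)"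
      unfolding homogeneous_cut_def by auto
    from cut show ?thesis
    proof
      assume "\<forall>a\<in>A. \<forall>b\<in>B. \<not> E a b"
      from homogeneous_cut_insert[OF sym insert.prems(1) insert.hyps(2) AB this] show ?thesis .
    next
      assume "\<forall>a\<in>A. \<forall>b\<in>B. \<not> \<not> E a b"
      from homogeneous_cut_insert[OF _ P4_free_on_complement[OF sym insert.prems(1)]
          insert.hyps(2) AB this] sym
      show ?thesis unfolding homogeneous_cut_complement by blast
    qed
  next
    case False
    with insert have "card W = 1" by simp
    then obtain w where "W = {w}" by (auto simp: card_1_singleton_iff)
    then have "homogeneous_cut E (insert v W) {v} {w}"
      using insert unfolding homogeneous_cut_def by auto
    then show ?thesis by blast
  qed
qed

abbreviation joined_in :: "('a \<Rightarrow> 'a \<Rightarrow> bool) \<Rightarrow> 'a set \<Rightarrow> 'a \<Rightarrow> 'a \<Rightarrow> bool" where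
  "joined_in E W \<equiv> (\<lambda>x y. x \<in> W \<and> y \<in> W \<and> E x y)\<^sup>*\<^sup>*"

text \<open>A shortest path between two vertices at distance three or more would contain an induced path on
four vertices.\<close>

lemma P4_free_diameter:
  assumes free: "P4_free_on E W" and irr: "\<And>x. \<not> E x x" and "x \<in> W" and "joined_in E W x y"
  shows "x = y \<or> E x y \<or> (\<exists>z\<in>W. E x z \<and> E z y)"
  using assms(4)
proof (induction rule: rtranclp_induct)
  case base
  then show ?case by simp
next
  case (step y y')
  then consider "x = y" | "E x y" | z where "z \<in> W" "E x z" "E z y" by blast
  then show ?case
  proof cases
    case 3
    show ?thesis
    proof (cases "distinct [x, z, y, y']")
      case True
      then show ?thesis using P4_free_onD[OF free, of x z y y'] 3 step \<open>x \<in> W\<close> by blast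
    next
      case False
      then show ?thesis using 3 step irr by auto
    qed
  qed (use step in auto)
qed

section \<open>Folds\<close>

text \<open>The parameter \<open>c\<close> bounds the number of vertices that the fold moves; it is what makes folds
searchable. Colourings of the image of a fold pull back along it to colourings of the whole graph.\<close>

definition has_fold :: "'a set \<Rightarrow> ('a \<Rightarrow> 'a \<Rightarrow> bool) \<Rightarrow> nat \<Rightarrow> bool" where
  "has_fold V E c \<longleftrightarrow>
     (\<exists>r. r ` V \<subset> V \<and> (\<forall>x y. E x y \<longrightarrow> E (r x) (r y)) \<and>
          card {x \<in> V. r x \<noteq> x} \<le> c)"

text \<open>Both forbidden subgraphs are an induced path \<open>a b c d\<close> with a fifth vertex \<open>e\<close>: adjacent to none of the
path in the co-gem, adjacent to all but the second vertex of the path in the house. The adjacencies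
already force the five vertices to be distinct.\<close>

locale cogem_house_free =
  fixes V :: "'a set" and E :: "'a \<Rightarrow> 'a \<Rightarrow> bool"
  assumes fin: "finite V"
    and inV: "E x y \<Longrightarrow> x \<in> V"
    and sym: "E x y \<Longrightarrow> E y x"
    and irr: "\<not> E x x"
    and cogem: "E a b \<Longrightarrow> E b c \<Longrightarrow> E c d \<Longrightarrow> \<not> E a c \<Longrightarrow> \<not> E a d \<Longrightarrow> \<not> E b d \<Longrightarrow>
      e \<in> V \<Longrightarrow> \<not> E e a \<Longrightarrow> \<not> E e b \<Longrightarrow> \<not> E e c \<Longrightarrow> \<not> E e d \<Longrightarrow> False"
    and house: "E a b \<Longrightarrow> E b c \<Longrightarrow> E c d \<Longrightarrow> \<not> E a c \<Longrightarrow> \<not> E a d \<Longrightarrow> \<not> E b d \<Longrightarrow>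
      E e a \<Longrightarrow> \<not> E e b \<Longrightarrow> E e c \<Longrightarrow> E e d \<Longrightarrow> False"
begin

lemma comm: "E x y \<longleftrightarrow> E y x"
  using sym by blast

lemma inV2: "E x y \<Longrightarrow> y \<in> V"
  using inV sym by blast

text \<open>A path with a common nonneighbour of its vertices is a co-gem.\<close>

lemma P4_free_onI:
  assumes "W \<subseteq> V"
    and "\<And>a b c d. a \<in> W \<Longrightarrow> b \<in> W \<Longrightarrow> c \<in> W \<Longrightarrow> d \<in> W \<Longrightarrow>
      \<exists>e\<in>V. \<not> E e a \<and> \<not> E e b \<and> \<not> E e c \<and> \<not> E e d"
  shows "P4_free_on E W"
  unfolding P4_free_on_def using assms(2) cogem by meson

text \<open>A module is a set to which every vertex outside is homogeneous.\<close>

definition homogeneous_to :: "'a set \<Rightarrow> 'a \<Rightarrow> bool" where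
  "homogeneous_to M z \<longleftrightarrow> (\<forall>m\<in>M. \<forall>m'\<in>M. E z m \<longrightarrow> E z m')"

lemma homogeneous_toD: "homogeneous_to M z \<Longrightarrow> E z m \<Longrightarrow> m \<in> M \<Longrightarrow> m' \<in> M \<Longrightarrow> E z m'"
  unfolding homogeneous_to_def by blast

end

locale fold_free = cogem_house_free +
  fixes f :: "'a \<Rightarrow> nat" and k :: nat
  assumes colors: "x \<in> V \<Longrightarrow> f x < k"
    and proper: "E x y \<Longrightarrow> f x \<noteq> f y"
    and no_fold: "\<not> has_fold V E (2 * k)"
begin

lemma foldI:
  assumes "\<And>x. x \<in> V \<Longrightarrow> r x \<in> V" and "\<And>x y. E x y \<Longrightarrow> E (r x) (r y)"
    and "w \<in> V" and "\<And>x. x \<in> V \<Longrightarrow> r x \<noteq> w" and "{x \<in> V. r x \<noteq> x} \<subseteq> D" and "finite D"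
    and "card D \<le> 2 * k"
  shows False
proof -
  have "r ` V \<subseteq> V" using assms(1) by auto
  moreover have "w \<notin> r ` V" using assms(4) by auto
  ultimately have "r ` V \<subset> V" using assms(3) by auto
  moreover have "card {x \<in> V. r x \<noteq> x} \<le> 2 * k"
    using card_mono[OF assms(6,5)] assms(7) by simp
  ultimately show False using no_fold assms(2) unfolding has_fold_def by blast
qed

lemma card_clique:
  assumes "K \<subseteq> V" and "\<And>x y. x \<in> K \<Longrightarrow> y \<in> K \<Longrightarrow> x \<noteq> y \<Longrightarrow> E x y"
  shows "card K \<le> k"
proof -
  have "inj_on f K" using assms(2) proper unfolding inj_on_def by blast
  moreover have "f ` K \<subseteq> {..<k}" using assms(1) colors by auto
  ultimately have "card K \<le> card {..<k}" by (intro card_inj_on_le[of f]) auto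
  then show ?thesis by simp
qed

text \<open>The fold maps the smaller clique injectively into the larger one; this respects edges because the
larger clique has at least the same outer neighbours.\<close>

lemma fold_clique_into_clique:
  assumes AV: "A \<subseteq> V" and BV: "B \<subseteq> V" and "A \<inter> B = {}" "a \<in> A"
    and A: "\<And>x y. x \<in> A \<Longrightarrow> y \<in> A \<Longrightarrow> x \<noteq> y \<Longrightarrow> E x y"
    and B: "\<And>x y. x \<in> B \<Longrightarrow> y \<in> B \<Longrightarrow> x \<noteq> y \<Longrightarrow> E x y"
    and AB: "\<And>x y. x \<in> A \<Longrightarrow> y \<in> B \<Longrightarrow> \<not> E x y"
    and out: "\<And>z x y. z \<notin> A \<union> B \<Longrightarrow> x \<in> A \<Longrightarrow> y \<in> B \<Longrightarrow> E z x \<Longrightarrow> E z y"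
    and le: "card A \<le> card B"
  shows False
proof -
  have fA: "finite A" and fB: "finite B" using AV BV fin finite_subset by auto
  obtain g where g: "g ` A \<subseteq> B" "inj_on g A"
    using card_le_inj[OF fA fB le] by blast
  let ?r = "\<lambda>x. if x \<in> A then g x else x"
  have hom: "E (?r x) (?r y)" if "E x y" for x y
  proof -
    have "x \<in> A \<Longrightarrow> y \<in> A \<Longrightarrow> g x \<noteq> g y"
      using g that irr unfolding inj_on_def by metis
    moreover have "x \<in> A \<Longrightarrow> g x \<in> B" "y \<in> A \<Longrightarrow> g y \<in> B" using g by auto
    ultimately show ?thesis
      using that A B AB out[of x y "g y"] out[of y x "g x"] sym by (metis UnE)
  qed
  show False
  proof (rule foldI[of ?r a A])
    show "card A \<le> 2 * k" using card_clique[OF AV A] by simp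
    show "?r x \<noteq> a" if "x \<in> V" for x using g \<open>a \<in> A\<close> \<open>A \<inter> B = {}\<close> by auto
    show "?r x \<in> V" if "x \<in> V" for x using that g BV by auto
    show "E (?r x) (?r y)" if "E x y" for x y using hom[OF that] .
    show "a \<in> V" using AV \<open>a \<in> A\<close> by blast
    show "{x \<in> V. ?r x \<noteq> x} \<subseteq> A" by auto
  qed (rule fA)
qed

text \<open>A minimal counterexample is not complete between the two sides of a homogeneous cut, since
then one side would be a smaller counterexample. So the two sides are anticomplete, both are
modules, hence both are cliques by minimality, and the smaller folds into the larger.\<close>

lemma P4_free_module_clique:
  assumes "M \<subseteq> V" and "P4_free_on E M"
    and "\<And>z. z \<in> V - M \<Longrightarrow> homogeneous_to M z"
    and "x \<in> M" "y \<in> M" "x \<noteq> y"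
  shows "E x y"
  using assms
proof (induction "card M" arbitrary: M x y rule: less_induct)
  case less
  note MV = less.prems(1) and free = less.prems(2) and mod = less.prems(3)
  show ?case
  proof (rule ccontr)
    assume nE: "\<not> E x y"
    have fM: "finite M" using MV fin by (rule finite_subset)
    have "card {x, y} \<le> card M" using less.prems(4,5) fM by (intro card_mono) auto
    then have "card M \<ge> 2" using less.prems(6) by simp
    then obtain A B where "homogeneous_cut E M A B"
      using P4_free_homogeneous_cut[OF fM _ free] sym by blast
    then have AB: "A \<noteq> {}" "B \<noteq> {}" "A \<inter> B = {}" "A \<union> B = M"
      and cut: "(\<forall>a\<in>A. \<forall>b\<in>B. E a b) \<or> (\<forall>a\<in>A. \<forall>b\<in>B. \<not> E a b)"
      unfolding homogeneous_cut_def by auto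
    have cliqueA: "E u v" if "u \<in> A" "v \<in> A" "u \<noteq> v" for u v
    proof (rule less.hyps[of A])
      show "card A < card M" using AB by (intro psubset_card_mono[OF fM]) blast
      show "A \<subseteq> V" using AB(4) MV by blast
      show "P4_free_on E A" by (rule P4_free_on_subset[OF free]) (use AB(4) in blast)
      show "homogeneous_to A z" if "z \<in> V - A" for z
      proof (cases "z \<in> B")
        case True
        then show ?thesis using cut sym unfolding homogeneous_to_def by blast
      next
        case False
        then have "homogeneous_to M z" using that AB(4) by (intro mod) blast
        then show ?thesis using AB(4) unfolding homogeneous_to_def by blast
      qed
    qed (use that in simp_all)
    have cliqueB: "E u v" if "u \<in> B" "v \<in> B" "u \<noteq> v" for u v
    proof (rule less.hyps[of B])
      show "card B < card M" using AB by (intro psubset_card_mono[OF fM]) blast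
      show "B \<subseteq> V" using AB(4) MV by blast
      show "P4_free_on E B" by (rule P4_free_on_subset[OF free]) (use AB(4) in blast)
      show "homogeneous_to B z" if "z \<in> V - B" for z
      proof (cases "z \<in> A")
        case True
        then show ?thesis using cut sym unfolding homogeneous_to_def by blast
      next
        case False
        then have "homogeneous_to M z" using that AB(4) by (intro mod) blast
        then show ?thesis using AB(4) unfolding homogeneous_to_def by blast
      qed
    qed (use that in simp_all)
    have anti: "\<not> E a b" if "a \<in> A" "b \<in> B" for a b
    proof
      assume "E a b"
      then have all: "\<forall>a\<in>A. \<forall>b\<in>B. E a b" using cut that by blast
      have "x \<in> A \<union> B" "y \<in> A \<union> B" using AB less.prems(4,5) by simp_all
      then show False
        using nE all cliqueA[of x y] cliqueB[of x y] less.prems(6) comm[of x y] by blast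
    qed
    have out: "E z v" if "z \<notin> A \<union> B" "u \<in> A \<union> B" "v \<in> A \<union> B" "E z u" for z u v
      using homogeneous_toD[OF mod[of z], of u v] that inV[of z u] AB(4) by simp
    have AV: "A \<subseteq> V" and BV: "B \<subseteq> V" using AB(4) MV by auto
    obtain a b where ab: "a \<in> A" "b \<in> B" using AB by blast
    show False
    proof (cases "card A \<le> card B")
      case True
      show False
      proof (rule fold_clique_into_clique[OF AV BV AB(3) ab(1)])
        show "E u v" if "u \<in> A" "v \<in> A" "u \<noteq> v" for u v using cliqueA[OF that] .
        show "E u v" if "u \<in> B" "v \<in> B" "u \<noteq> v" for u v using cliqueB[OF that] .
        show "\<not> E u v" if "u \<in> A" "v \<in> B" for u v using anti[OF that] .
        show "card A \<le> card B" using True .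
        show "E z v" if "z \<notin> A \<union> B" "u \<in> A" "v \<in> B" "E z u" for z u v
          using out[of z u v] that by simp
      qed
    next
      case False
      show False
      proof (rule fold_clique_into_clique[OF BV AV _ ab(2)])
        show "E u v" if "u \<in> A" "v \<in> A" "u \<noteq> v" for u v using cliqueA[OF that] .
        show "E u v" if "u \<in> B" "v \<in> B" "u \<noteq> v" for u v using cliqueB[OF that] .
        show "B \<inter> A = {}" using AB(3) by blast
        show "\<not> E u v" if "u \<in> B" "v \<in> A" for u v using anti[OF that(2,1)] comm[of u v] by simp
        show "E z v" if "z \<notin> B \<union> A" "u \<in> B" "v \<in> A" "E z u" for z u v
          using out[of z u v] that by simp
        show "card B \<le> card A" using False by simp
      qed
    qed
  qed
qed

lemma not_dominated:
  assumes "x \<in> V" "y \<in> V" "x \<noteq> y" "\<not> E x y"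
  shows "\<exists>z. E x z \<and> \<not> E y z"
proof (rule ccontr)
  assume *: "\<not> (\<exists>z. E x z \<and> \<not> E y z)"
  have out: "E z y" if "E z x" for z using * sym that by blast
  show False
    by (rule fold_clique_into_clique[of "{x}" "{y}" x])
      (use assms in simp_all, use out in blast)
qed

end

section \<open>Large comatchings\<close>

lemma two_outside:
  assumes "finite B" "card B + 2 \<le> card T"
  obtains s r where "s \<in> T - B" "r \<in> T - B" "s \<noteq> r"
proof -
  have "finite T" using assms(2) card.infinite by fastforce
  have "2 \<le> card (T - B)" using diff_card_le_card_Diff[OF assms(1), of T] assms(2) by linarith
  then obtain S where "S \<subseteq> T - B" "card S = 2" by (meson obtain_subset_with_card_n)
  then show ?thesis using that by (auto simp: card_2_iff)
qed

context cogem_house_free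
begin

definition comp :: "'a set \<Rightarrow> 'a \<Rightarrow> 'a set" where
  "comp W v = {u. joined_in E W v u}"

lemma comp_self: "v \<in> comp W v"
  unfolding comp_def by simp

lemma comp_subset: "v \<in> W \<Longrightarrow> comp W v \<subseteq> W"
  unfolding comp_def by (auto elim: rtranclp.cases)

lemma comp_step: "v \<in> W \<Longrightarrow> u \<in> comp W v \<Longrightarrow> E u w \<Longrightarrow> w \<in> W \<Longrightarrow> w \<in> comp W v"
  using comp_subset[of v W] unfolding comp_def
  by (auto intro: rtranclp.rtrancl_into_rtrancl)

lemma comp_edge: "v \<in> W \<Longrightarrow> w \<in> W \<Longrightarrow> E v w \<Longrightarrow> w \<in> comp W v"
  using comp_step comp_self by blast

text \<open>Edges can be walked in both directions, so a property that is preserved along the edges of a component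
is constant on it. This is applied to adjacency to a vertex that distinguishes no edge.\<close>

lemma comp_constant:
  assumes "v \<in> W" and Q: "\<And>u w. u \<in> comp W v \<Longrightarrow> w \<in> comp W v \<Longrightarrow> E u w \<Longrightarrow> Q u \<Longrightarrow> Q w"
    and "u \<in> comp W v" "w \<in> comp W v" "Q u"
  shows "Q w"
proof -
  have "u \<in> comp W v \<and> (Q v \<longleftrightarrow> Q u)" if "joined_in E W v u" for u
    using that
  proof (induction rule: rtranclp_induct)
    case base
    then show ?case by (simp add: comp_self)
  next
    case (step u w)
    then have "w \<in> comp W v" using comp_step[of v W u w] \<open>v \<in> W\<close> by blast
    then show ?case using step Q[of u w] Q[of w u] sym by blast
  qed
  then show ?thesis using assms(3-5) unfolding comp_def by blast
qed

end

text \<open>A complete bipartite graph minus the perfect matching \<open>x t y t\<close>, with independent sides. Ten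
indices are enough to avoid all exceptional indices that occur in one argument.\<close>

locale comatching = fold_free +
  fixes T :: "'i set" and x y :: "'i \<Rightarrow> 'a"
  assumes cardT: "card T \<ge> 10" "card T > k"
    and xV: "t \<in> T \<Longrightarrow> x t \<in> V" and yV: "t \<in> T \<Longrightarrow> y t \<in> V"
    and xx: "s \<in> T \<Longrightarrow> t \<in> T \<Longrightarrow> \<not> E (x s) (x t)"
    and yy: "s \<in> T \<Longrightarrow> t \<in> T \<Longrightarrow> \<not> E (y s) (y t)"
    and xy: "s \<in> T \<Longrightarrow> t \<in> T \<Longrightarrow> E (x s) (y t) \<longleftrightarrow> s \<noteq> t"
begin

lemma swapped: "comatching V E f k T y x"
  by unfold_locales (use cardT xV yV xx yy xy comm in blast)+

lemma yx: "s \<in> T \<Longrightarrow> t \<in> T \<Longrightarrow> E (y s) (x t) \<longleftrightarrow> s \<noteq> t"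
  using xy comm by blast

lemma avoid3:
  obtains s r where "s \<in> T" "r \<in> T" "s \<noteq> r" "s \<notin> {a, b, c}" "r \<notin> {a, b, c}"
proof -
  have "card {a, b, c} \<le> 3" by (simp add: card_insert_if)
  then have "card {a, b, c} + 2 \<le> card T" using cardT by linarith
  from two_outside[OF _ this] show ?thesis using that by auto
qed

text \<open>Vertices that see the comatching as a vertex \<open>x q\<close> does, where their relation to \<open>x q\<close> and \<open>y q\<close> may be
arbitrary; \<open>Ylike\<close> is the same for the other side.\<close>

definition Xlike :: "'a set" where
  "Xlike = {z \<in> V. \<exists>q. \<forall>t\<in>T - {q}. E z (y t) \<and> \<not> E z (x t)}"

definition Ylike :: "'a set" where
  "Ylike = {z \<in> V. \<exists>q. \<forall>t\<in>T - {q}. E z (x t) \<and> \<not> E z (y t)}"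

definition Full :: "'a set" where
  "Full = {z \<in> V. \<forall>t\<in>T. E z (x t) \<and> E z (y t)}"

definition Xclass :: "'i \<Rightarrow> 'a set" where
  "Xclass t = {u \<in> Xlike. u = x t \<or> E (x t) u}"

definition Yclass :: "'i \<Rightarrow> 'a set" where
  "Yclass t = {u \<in> Ylike. u = y t \<or> E (y t) u}"

lemma x_Xlike: "t \<in> T \<Longrightarrow> x t \<in> Xlike"
  unfolding Xlike_def using xV xy xx by blast

lemma y_Ylike: "t \<in> T \<Longrightarrow> y t \<in> Ylike"
  unfolding Ylike_def using yV yx yy by blast

text \<open>The next three facts apply the forbidden subgraphs to the induced paths \<open>y t, x s, y r, x t\<close> of the
comatching. Here, a vertex that misses the whole path would give a co-gem.\<close>

lemma comatching_dominates:
  assumes "z \<in> V" "s \<in> T" "t \<in> T" "r \<in> T" "distinct [s, t, r]"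
  shows "E z (y t) \<or> E z (x s) \<or> E z (y r) \<or> E z (x t)"
  using cogem[of "y t" "x s" "y r" "x t" z] assms xx yy xy yx by auto

lemma full_at_spreads_x:
  assumes "z \<in> V" "s \<in> T" "t \<in> T" "r \<in> T" "distinct [s, t, r]"
    "E z (y t)" "E z (x t)" "E z (y r)"
  shows "E z (x s)"
  using house[of "y t" "x s" "y r" "x t" z] assms xx yy xy yx by auto

lemma full_at_spreads_y:
  assumes "z \<in> V" "s \<in> T" "t \<in> T" "r \<in> T" "distinct [s, t, r]"
    "E z (y t)" "E z (x t)" "E z (x s)"
  shows "E z (y r)"
  using house[of "x t" "y r" "x s" "y t" z] assms xx yy xy yx by auto

text \<open>Now \<open>z\<close> itself ends an induced path \<open>x u, y r, x s, z\<close>, and \<open>y v\<close> completes it to a house.\<close>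

lemma not_split_two_two:
  assumes "z \<in> V" "s \<in> T" "u \<in> T" "r \<in> T" "v \<in> T" "distinct [s, r, u, v]"
    "E z (x s)" "\<not> E z (y r)" "\<not> E z (x u)" "E z (y v)"
  shows False
  using house[of "x u" "y r" "x s" z "y v"] assms xx yy xy yx comm by auto

text \<open>One index at which \<open>z\<close> is adjacent to both ends forces adjacency everywhere, by following houses
through all other indices.\<close>

lemma both_Full:
  assumes z: "z \<in> V" and t: "t \<in> T" "E z (x t)" "E z (y t)"
  shows "z \<in> Full"
proof -
  have ex: "\<exists>s\<in>T - {t}. E z (x s) \<or> E z (y s)"
  proof -
    obtain s r where sr: "s \<in> T" "r \<in> T" "s \<noteq> r" "s \<notin> {t, t, t}" "r \<notin> {t, t, t}"
      by (rule avoid3)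
    obtain q where q: "q \<in> T" "q \<notin> {t, s, r}" by (rule avoid3) 
    show ?thesis using comatching_dominates[OF z sr(1) q(1) sr(2)] sr q by auto
  qed
  have yx': "E z (x s)" if "E z (y r)" "r \<in> T" "s \<in> T" "r \<noteq> t" "s \<noteq> t" "s \<noteq> r" for s r
    using full_at_spreads_x[of z s t r] that z t by auto
  have xy': "E z (y r)" if "E z (x s)" "r \<in> T" "s \<in> T" "r \<noteq> t" "s \<noteq> t" "s \<noteq> r" for s r
    using full_at_spreads_y[of z s t r] that z t by auto
  have all: "E z (x r) \<and> E z (y r)" if "r \<in> T" "r \<noteq> t" for r
  proof -
    obtain s where s: "s \<in> T" "s \<noteq> t" "E z (x s) \<or> E z (y s)" using ex by blast
    obtain p q where pq: "p \<in> T" "q \<in> T" "p \<noteq> q" "p \<notin> {s, r, t}" "q \<notin> {s, r, t}" by (rule avoid3)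
    have "E z (x p) \<or> E z (y p)" using s pq yx'[of s p] xy'[of s p] by auto
    then have "E z (x q) \<or> E z (y q)" "E z (x q) \<and> E z (y p) \<or> E z (y q) \<and> E z (x p)"
      using pq yx'[of p q] xy'[of p q] yx'[of q p] xy'[of q p] by auto
    moreover have "E z (x q) \<and> E z (y q)"
    proof -
      obtain m n where mn: "m \<in> T" "n \<in> T" "m \<noteq> n" "m \<notin> {p, q, t}" by (rule avoid3)
      show ?thesis using calculation mn pq yx'[of p m] xy'[of p m] yx'[of q m] xy'[of q m]
        yx'[of m q] xy'[of m q] by auto
    qed
    ultimately show ?thesis using pq that yx'[of q r] xy'[of q r] by auto
  qed
  show ?thesis unfolding Full_def using z t all by auto
qed

text \<open>If no index has both ends adjacent to \<open>z\<close>, then at most one index has none, and not both sides can have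
two exceptions: otherwise \<open>not_split_two_two\<close> applies.\<close>

lemma trichotomy:
  assumes z: "z \<in> V"
  shows "z \<in> Full \<or> z \<in> Xlike \<or> z \<in> Ylike"
proof (rule ccontr)
  assume not: "\<not> ?thesis"
  have noboth: "\<not> (E z (x t) \<and> E z (y t))" if "t \<in> T" for t
    using both_Full[OF z that] not by blast
  have one_zero: "E z (x t) \<or> E z (y t) \<or> E z (x t') \<or> E z (y t')"
    if "t \<in> T" "t' \<in> T" "t \<noteq> t'" for t t'
  proof (rule ccontr)
    assume neg: "\<not> ?thesis"
    obtain s r where sr: "s \<in> T" "r \<in> T" "s \<noteq> r" "s \<notin> {t, t', t}" "r \<notin> {t, t', t}"
      by (rule avoid3)
    have "E z (y s)" using comatching_dominates[of z t' t s] neg sr that z by auto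
    moreover have "E z (x s)" using comatching_dominates[of z s t t'] neg sr that z by auto
    ultimately show False using noboth sr by blast
  qed
  have ex2: "\<exists>a\<in>T. \<exists>b\<in>T. a \<noteq> b \<and> \<not> Q a \<and> \<not> Q b" if h: "\<And>q. \<not> (\<forall>t\<in>T - {q}. Q t)" for Q
  proof -
    obtain a where a: "a \<in> T" "\<not> Q a" using h by blast
    obtain b where "b \<in> T - {a}" "\<not> Q b" using h[of a] by blast
    then show ?thesis using a by blast
  qed
  have "\<exists>a\<in>T. \<exists>b\<in>T. a \<noteq> b \<and> \<not> (E z (x a) \<and> \<not> E z (y a)) \<and> \<not> (E z (x b) \<and> \<not> E z (y b))"
    by (rule ex2) (use not z in \<open>auto simp: Ylike_def\<close>)
  then obtain v u where vu: "v \<in> T" "u \<in> T" "v \<noteq> u" "E z (y v)" "\<not> E z (x u)"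
    using noboth one_zero by metis
  have "\<exists>a\<in>T. \<exists>b\<in>T. a \<noteq> b \<and> \<not> (E z (y a) \<and> \<not> E z (x a)) \<and> \<not> (E z (y b) \<and> \<not> E z (x b))"
    by (rule ex2) (use not z in \<open>auto simp: Xlike_def\<close>)
  then obtain s r where sr: "s \<in> T" "r \<in> T" "s \<noteq> r" "E z (x s)" "\<not> E z (y r)"
    using noboth one_zero by metis
  have ne: "s \<noteq> u" "s \<noteq> v" "v \<noteq> r" using vu sr noboth by auto
  show False
  proof (cases "r = u")
    case False
    then show False using not_split_two_two[of z s u r v] vu sr ne z by auto
  next
    case True
    obtain w where w: "w \<in> T" "w \<notin> {s, v, u}" by (rule avoid3)
    have "E z (x w) \<or> E z (y w)" using one_zero[of u w] w vu sr True by auto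
    then consider "\<not> E z (y w)" | "\<not> E z (x w)" using noboth w by blast
    then show False
      using not_split_two_two[of z s u w v] not_split_two_two[of z s w r v] vu sr ne z w True by cases auto
  qed
qed


lemma XlikeE:
  assumes "z \<in> Xlike"
  obtains q where "\<forall>t\<in>T - {q}. E z (y t) \<and> \<not> E z (x t)"
  using assms unfolding Xlike_def by auto

lemma YlikeE:
  assumes "z \<in> Ylike"
  obtains q where "\<forall>t\<in>T - {q}. E z (x t) \<and> \<not> E z (y t)"
  using assms unfolding Ylike_def by auto

text \<open>Otherwise \<open>y1\<close>, \<open>v\<close>, \<open>y r\<close> and \<open>x s\<close> form an induced four-cycle for unexceptional indices \<open>s\<close> and \<open>r\<close>, and \<open>y2\<close>,
adjacent to \<open>y1\<close> and \<open>x s\<close> only, completes it to a house.\<close>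

lemma Ylike_edge_homogeneous:
  assumes "y1 \<in> Ylike" "y2 \<in> Ylike" "v \<in> Xlike" "E y1 y2" "E v y1"
  shows "E v y2"
proof (rule ccontr)
  assume neg: "\<not> E v y2"
  obtain q1 where q1: "\<forall>t\<in>T - {q1}. E y1 (x t) \<and> \<not> E y1 (y t)"
    by (rule YlikeE[OF assms(1)])
  obtain q2 where q2: "\<forall>t\<in>T - {q2}. E y2 (x t) \<and> \<not> E y2 (y t)"
    by (rule YlikeE[OF assms(2)])
  obtain q3 where q3: "\<forall>t\<in>T - {q3}. E v (y t) \<and> \<not> E v (x t)"
    by (rule XlikeE[OF assms(3)])
  obtain s r where sr: "s \<in> T" "r \<in> T" "s \<noteq> r" "s \<notin> {q1, q2, q3}" "r \<notin> {q1, q2, q3}"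
    by (rule avoid3)
  show False
  proof (rule house[of "y r" v y1 y2 "x s"])
    show "E (y r) v" "\<not> E (y r) y1" "\<not> E (y r) y2" "E (x s) y1" "E (x s) y2" "\<not> E (x s) v"
      using q1 q2 q3 sr by (auto simp: comm[of "y r"] comm[of "x s"])
    show "E (x s) (y r)" using xy sr by simp
  qed (use assms(4,5) neg in \<open>simp_all add: comm[of y1 y2]\<close>)
qed

lemma Full_Ylike:
  assumes "u \<in> Full" "w \<in> Ylike"
  shows "E u w"
proof (rule ccontr)
  assume neg: "\<not> E u w"
  obtain q where q: "\<forall>t\<in>T - {q}. E w (x t) \<and> \<not> E w (y t)"
    by (rule YlikeE[OF assms(2)])
  obtain s r where sr: "s \<in> T" "r \<in> T" "s \<noteq> r" "s \<notin> {q, q, q}" "r \<notin> {q, q, q}"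
    by (rule avoid3)
  show False
  proof (rule house[of w "x s" u "y s" "x r"])
    show "E w (x s)" "\<not> E w (y s)" "E (x r) w" using q sr by (auto simp: comm[of "x r"])
    show "E (x s) u" "E u (y s)" "E (x r) u"
      using assms(1) sr by (auto simp: Full_def comm[of "x s"] comm[of "x r"])
    show "\<not> E (x s) (y s)" "\<not> E (x r) (x s)" "E (x r) (y s)" using xx xy sr by simp_all
  qed (use neg in \<open>simp add: comm[of w]\<close>)
qed

lemma P4_free_Ylike: "P4_free_on E Ylike"
proof (rule P4_free_onI)
  show "Ylike \<subseteq> V" unfolding Ylike_def by blast
  fix a b c d assume abcd: "a \<in> Ylike" "b \<in> Ylike" "c \<in> Ylike" "d \<in> Ylike"
  have "\<exists>q. \<forall>t\<in>T - {q}. \<not> E (y t) z" if "z \<in> Ylike" for z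
    using that comm unfolding Ylike_def by blast
  then obtain q where q: "\<And>z t. z \<in> Ylike \<Longrightarrow> t \<in> T \<Longrightarrow> t \<noteq> q z \<Longrightarrow> \<not> E (y t) z" by (metis DiffI singletonD)
  have "card {q a, q b, q c, q d} \<le> 4" by (simp add: card_insert_if)
  then have "card {q a, q b, q c, q d} + 2 \<le> card T" using cardT by linarith
  then obtain r where "r \<in> T - {q a, q b, q c, q d}" using two_outside by (metis finite.emptyI finite_insert)
  then show "\<exists>e\<in>V. \<not> E e a \<and> \<not> E e b \<and> \<not> E e c \<and> \<not> E e d"
    using yV[of r] q abcd by auto
qed

text \<open>The components of \<open>Ylike\<close> are modules, and \<open>Ylike\<close> contains no induced four-vertex path because any four
of its vertices have a common nonneighbour \<open>y r\<close>. So the components are cliques.\<close>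

lemma Ylike_trans:
  assumes "y1 \<in> Ylike" "y2 \<in> Ylike" "y3 \<in> Ylike" "E y1 y2" "E y2 y3" "y1 \<noteq> y3"
  shows "E y1 y3"
proof (rule P4_free_module_clique)
  let ?M = "comp Ylike y1"
  have sub: "?M \<subseteq> Ylike" by (rule comp_subset[OF assms(1)])
  show "?M \<subseteq> V" using sub unfolding Ylike_def by blast
  show "P4_free_on E ?M" by (rule P4_free_on_subset[OF P4_free_Ylike sub])
  show "y1 \<in> ?M" by (rule comp_self)
  show "y3 \<in> ?M" by (rule comp_step[OF assms(1) comp_edge[OF assms(1,2,4)] assms(5,3)])
  show "homogeneous_to ?M z" if z: "z \<in> V - ?M" for z
  proof -
    from z consider "z \<in> Full" | "z \<in> Xlike" | "z \<in> Ylike" using trichotomy by blast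
    then show ?thesis
    proof cases
      case 1
      then show ?thesis unfolding homogeneous_to_def using Full_Ylike sub by blast
    next
      case 2
      show ?thesis unfolding homogeneous_to_def
      proof (intro ballI impI)
        fix m m' assume m: "m \<in> ?M" "m' \<in> ?M" "E z m"
        show "E z m'"
          by (rule comp_constant[where Q = "E z", OF assms(1) _ m]) (use Ylike_edge_homogeneous[OF _ _ 2] sub in blast)
      qed
    next
      case 3
      then have "\<not> E z m" if "m \<in> ?M" for m
        using comp_step[OF assms(1) that] z comm by blast
      then show ?thesis unfolding homogeneous_to_def by blast
    qed
  qed
qed (rule assms)

end

text \<open>The two sides play the same role: every fact about one of them holds for the other with the prefix
\<open>swap\<close>.\<close>

sublocale comatching \<subseteq> swap: comatching V E f k T y x
  rewrites "comatching.Ylike V E T y x = comatching.Xlike V E T x y"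
    and "comatching.Xlike V E T y x = comatching.Ylike V E T x y"
    and "comatching.Full V E T y x = comatching.Full V E T x y"
    and "comatching.Xclass V E T y x = comatching.Yclass V E T x y"
    and "comatching.Yclass V E T y x = comatching.Xclass V E T x y"
proof -
  show *: "comatching V E f k T y x" by (rule swapped)
  have **: "comatching V E f k T x y" by unfold_locales
  show eq: "comatching.Ylike V E T y x = comatching.Xlike V E T x y"
    "comatching.Xlike V E T y x = comatching.Ylike V E T x y"
    "comatching.Full V E T y x = comatching.Full V E T x y"
    unfolding comatching.Ylike_def[OF *] comatching.Xlike_def[OF **]
      comatching.Ylike_def[OF **] comatching.Xlike_def[OF *]
      comatching.Full_def[OF *] comatching.Full_def[OF **] by auto
  show "comatching.Xclass V E T y x = comatching.Yclass V E T x y"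
    "comatching.Yclass V E T y x = comatching.Xclass V E T x y"
    unfolding comatching.Xclass_def[OF *] comatching.Yclass_def[OF *]
      comatching.Xclass_def[OF **] comatching.Yclass_def[OF **] eq by auto
qed

context comatching
begin

text \<open>If two nonadjacent vertices of one side have a common nonneighbour on the other, then they have the
same neighbours there: a distinguishing vertex \<open>w\<close> would give the path \<open>b, y r, a, w\<close>, to which the
common nonneighbour is not attached. Then the union of their two cliques is a module that is not a
clique.\<close>

lemma Xlike_common_nonneighbour:
  assumes x1: "x1 \<in> Xlike" and x2: "x2 \<in> Xlike" and ne: "x1 \<noteq> x2" "\<not> E x1 x2"
    and y0: "y0 \<in> Ylike" "\<not> E x1 y0" "\<not> E x2 y0"
  shows False
proof -
  have aux: "E b w"
    if h: "a \<in> Xlike" "b \<in> Xlike" "\<not> E a b" "\<not> E a y0" "\<not> E b y0" "w \<in> Ylike" "E a w" for a b w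
  proof (rule ccontr)
    assume neg: "\<not> E b w"
    have "\<not> E y0 w"
      using Ylike_edge_homogeneous[of w y0 a] h y0 sym by blast
    obtain q1 where q1: "\<forall>t\<in>T - {q1}. E a (y t) \<and> \<not> E a (x t)" by (rule XlikeE[OF h(1)])
    obtain q2 where q2: "\<forall>t\<in>T - {q2}. E b (y t) \<and> \<not> E b (x t)" by (rule XlikeE[OF h(2)])
    obtain q3 where q3: "\<forall>t\<in>T - {q3}. E y0 (x t) \<and> \<not> E y0 (y t)" by (rule YlikeE[OF y0(1)])
    obtain q4 where q4: "\<forall>t\<in>T - {q4}. E w (x t) \<and> \<not> E w (y t)" by (rule YlikeE[OF h(6)])
    have "card {q1, q2, q3, q4} \<le> 4" by (simp add: card_insert_if)
    then have "card {q1, q2, q3, q4} + 2 \<le> card T" using cardT by linarith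
    then obtain r where "r \<in> T - {q1, q2, q3, q4}"
      using two_outside by (metis finite.emptyI finite_insert)
    then have r: "E a (y r)" "E b (y r)" "\<not> E y0 (y r)" "\<not> E w (y r)"
      using q1 q2 q3 q4 by auto
    show False
    proof (rule cogem[of b "y r" a w y0])
      show "y0 \<in> V" using y0(1) unfolding Ylike_def by blast
    qed (use r h neg y0 \<open>\<not> E y0 w\<close> comm in blast)+
  qed
  let ?C = "\<lambda>z. {u \<in> Xlike. u = z \<or> E z u}"
  let ?M = "?C x1 \<union> ?C x2"
  have nonnb: "\<not> E u y0" if "u \<in> ?M" for u
  proof
    assume "E u y0"
    then have "E y0 u" by (rule sym)
    then have "E y0 x1 \<or> E y0 x2"
      using that swap.Ylike_edge_homogeneous[of u _ y0] x1 x2 y0 sym by blast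
    then show False using y0 sym by blast
  qed
  have rep: "E z x1 \<longleftrightarrow> E z u" if "u \<in> ?C x1" "z \<in> Ylike" for u z
    using swap.Ylike_edge_homogeneous[of u x1 z] swap.Ylike_edge_homogeneous[of x1 u z] x1 that comm
    by blast
  have rep2: "E z x2 \<longleftrightarrow> E z u" if "u \<in> ?C x2" "z \<in> Ylike" for u z
    using swap.Ylike_edge_homogeneous[of u x2 z] swap.Ylike_edge_homogeneous[of x2 u z] x2 that comm
    by blast
  have x12: "E z x1 \<longleftrightarrow> E z x2" if "z \<in> Ylike" for z
    using aux[of x1 x2 z] aux[of x2 x1 z] x1 x2 ne y0 that comm by blast
  have "E x1 x2"
  proof (rule P4_free_module_clique)
    have sub: "?M \<subseteq> Xlike" by blast
    show "?M \<subseteq> V" using sub unfolding Xlike_def by blast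
    show "P4_free_on E ?M" by (rule P4_free_on_subset[OF swap.P4_free_Ylike sub])
    show "x1 \<in> ?M" "x2 \<in> ?M" using x1 x2 by blast+
    show "homogeneous_to ?M z" if z: "z \<in> V - ?M" for z
    proof -
      from z consider "z \<in> Full" | "z \<in> Ylike" | "z \<in> Xlike" using trichotomy by blast
      then show ?thesis
      proof cases
        case 1
        then show ?thesis unfolding homogeneous_to_def using swap.Full_Ylike sub by blast
      next
        case 2
        then have "E z u \<longleftrightarrow> E z x1" if "u \<in> ?M" for u
          using rep[of u z] rep2[of u z] x12[of z] that by blast
        then show ?thesis unfolding homogeneous_to_def by blast
      next
        case 3
        have "\<not> E z m" if "m \<in> ?M" for m
        proof
          assume "E z m"
          then have "E m z" by (rule sym)
          then show False
            using that swap.Ylike_trans[of x1 m z] swap.Ylike_trans[of x2 m z] x1 x2 3 z by blast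
        qed
        then show ?thesis unfolding homogeneous_to_def by blast
      qed
    qed
  qed (rule ne)
  with ne show False by blast
qed

lemma Xclass_clique: "t \<in> T \<Longrightarrow> u \<in> Xclass t \<Longrightarrow> v \<in> Xclass t \<Longrightarrow> u \<noteq> v \<Longrightarrow> E u v"
  using swap.Ylike_trans[of u "x t" v] x_Xlike sym unfolding Xclass_def by blast

lemma Xclass_step: "t \<in> T \<Longrightarrow> u \<in> Xclass t \<Longrightarrow> v \<in> Xlike \<Longrightarrow> E u v \<Longrightarrow> v \<in> Xclass t"
  using swap.Ylike_trans[of "x t" u v] x_Xlike unfolding Xclass_def by blast

lemma Xclass_disjoint:
  assumes "s \<in> T" "t \<in> T" "s \<noteq> t" "u \<in> Xclass s" "u \<in> Xclass t"
  shows False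
proof -
  have "x s \<noteq> x t" using xy[of s t] xy[of t t] assms by auto
  moreover have "x s \<in> Xclass t"
    using Xclass_step[OF assms(2,5), of "x s"] assms x_Xlike[of s] sym unfolding Xclass_def by blast
  ultimately show False using xx assms unfolding Xclass_def by blast
qed

end

context comatching
begin

text \<open>Two nonadjacent nonneighbours of \<open>x t\<close> on the other side would contradict
\<open>Xlike_common_nonneighbour\<close> with the sides exchanged, so all nonneighbours of \<open>x t\<close> are in the clique of \<open>y t\<close>.
Thus nonadjacency matches the cliques of the two sides.\<close>

lemma Xclass_nonneighbour:
  assumes t: "t \<in> T" and u: "u \<in> Xclass t" and w: "w \<in> Ylike"
  shows "E u w \<longleftrightarrow> w \<notin> Yclass t"
proof -
  have "E u w \<longleftrightarrow> E (x t) w"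
    using swap.Ylike_edge_homogeneous[of u "x t" w] swap.Ylike_edge_homogeneous[of "x t" u w]
      u w x_Xlike[OF t] comm unfolding Xclass_def by blast
  moreover have "\<not> E (x t) (y t)" using xy t by blast
  then have "\<not> E (x t) w" if "w \<in> Yclass t"
    using that Ylike_edge_homogeneous[of w "y t" "x t"] x_Xlike[OF t] y_Ylike[OF t] comm
    unfolding Yclass_def by blast
  moreover have "w \<in> Yclass t" if "\<not> E (x t) w"
    using that swap.Xlike_common_nonneighbour[of "y t" w "x t"] w \<open>\<not> E (x t) (y t)\<close> comm
      x_Xlike[OF t] y_Ylike[OF t] unfolding Yclass_def by blast
  ultimately show ?thesis by blast
qed

end

context comatching
begin

lemma Xclass_props:
  assumes "t \<in> T"
  shows "Xclass t \<subseteq> Xlike" "x t \<in> Xclass t" "finite (Xclass t)" "card (Xclass t) \<le> k"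
proof -
  show "Xclass t \<subseteq> Xlike" unfolding Xclass_def by blast
  then have "Xclass t \<subseteq> V" unfolding Xlike_def by blast
  then show "finite (Xclass t)" using fin by (rule finite_subset)
  show "x t \<in> Xclass t" unfolding Xclass_def using x_Xlike[OF assms] by blast
  show "card (Xclass t) \<le> k"
    by (rule card_clique[OF \<open>Xclass t \<subseteq> V\<close>]) (rule Xclass_clique[OF assms])
qed

lemma Xlike_Ylike_disjoint: "z \<in> Xlike \<Longrightarrow> z \<in> Ylike \<Longrightarrow> False"
proof -
  assume "z \<in> Xlike" "z \<in> Ylike"
  then obtain q p where q: "\<forall>t\<in>T - {q}. E z (y t) \<and> \<not> E z (x t)"
    and p: "\<forall>t\<in>T - {p}. E z (x t) \<and> \<not> E z (y t)"
    unfolding Xlike_def Ylike_def by blast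
  obtain s where "s \<in> T" "s \<notin> {p, q, q}" by (rule avoid3)
  then show False using p q by blast
qed

lemma Full_Xlike_disjoint: "z \<in> Xlike \<Longrightarrow> z \<in> Full \<Longrightarrow> False"
proof -
  assume "z \<in> Xlike" and F: "z \<in> Full"
  then obtain q where q: "\<forall>t\<in>T - {q}. E z (y t) \<and> \<not> E z (x t)"
    unfolding Xlike_def by blast
  obtain s where "s \<in> T" "s \<notin> {q, q, q}" by (rule avoid3)
  then show False using q F unfolding Full_def by blast
qed

end

context comatching
begin

text \<open>There are more indices than possible sizes of cliques, so two indices \<open>s\<close> and \<open>t\<close> have cliques of the
same size on the first side; name them such that \<open>Yclass t\<close> is not larger than \<open>Yclass s\<close>. Map \<open>Xclass s\<close> into \<open>Xclass t\<close> and, at the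
same time, \<open>Yclass t\<close> into \<open>Yclass s\<close>. The edges between the two moved cliques end up between \<open>Xclass t\<close>
and \<open>Yclass s\<close>, which are completely joined, and no vertex is mapped to \<open>x s\<close>.\<close>

lemma comatching_impossible: False
proof -
  \<comment> \<open>The cliques have between one and \<open>k\<close> vertices.\<close>
  have "\<not> inj_on (\<lambda>t. card (Xclass t)) T"
  proof
    assume "inj_on (\<lambda>t. card (Xclass t)) T"
    moreover have "(\<lambda>t. card (Xclass t)) ` T \<subseteq> {1..k}"
      using Xclass_props card_gt_0_iff by (fastforce simp: Suc_le_eq)
    ultimately have "card T \<le> card {1..k}" by (intro card_inj_on_le) auto
    then show False using cardT by simp
  qed
  then obtain s t where st: "s \<in> T" "t \<in> T" "s \<noteq> t" "card (Xclass s) \<le> card (Xclass t)"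
    "card (Yclass t) \<le> card (Yclass s)"
    unfolding inj_on_def by (metis le_cases order_refl)
  note Xs = Xclass_props[OF st(1)] and Xt = Xclass_props[OF st(2)]
    and Ys = swap.Xclass_props[OF st(1)] and Yt = swap.Xclass_props[OF st(2)]
  obtain g where g: "g ` Xclass s \<subseteq> Xclass t" "inj_on g (Xclass s)"
    using card_le_inj[OF Xs(3) Xt(3) st(4)] by blast
  obtain h where h: "h ` Yclass t \<subseteq> Yclass s" "inj_on h (Yclass t)"
    using card_le_inj[OF Yt(3) Ys(3) st(5)] by blast
  define r where "r = (\<lambda>z. if z \<in> Xclass s then g z else if z \<in> Yclass t then h z else z)"
  have XY: "z \<notin> Yclass t" if "z \<in> Xclass s" for z
    using Xlike_Ylike_disjoint that Xs(1) Yt(1) by blast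
  have rX: "r z = g z" "r z \<in> Xclass t" if "z \<in> Xclass s" for z
    using that g unfolding r_def by auto
  have rY: "r z = h z" "r z \<in> Yclass s" if "z \<in> Yclass t" for z
    using that h XY unfolding r_def by auto
  have r_id: "r z = z" if "z \<notin> Xclass s" "z \<notin> Yclass t" for z
    using that unfolding r_def by auto
  have XV: "Xlike \<subseteq> V" "Ylike \<subseteq> V" unfolding Xlike_def Ylike_def by auto
  have ts: "u \<notin> Xclass s" "u \<notin> Yclass s \<or> u \<notin> Yclass t" if "u \<in> Xclass t" for u
    using that Xclass_disjoint[OF st(1-3)] swap.Xclass_disjoint[OF st(1-3)] by blast+
  have Yts: "u \<notin> Yclass t" if "u \<in> Yclass s" for u
    using that swap.Xclass_disjoint[OF st(1-3)] by blast
  have hom1: "E (r u) (r v)" if uv: "E u v" and u: "u \<in> Xclass s" for u v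
  proof -
    have vV: "v \<in> V" using inV2[OF uv] .
    consider "v \<in> Full" | "v \<in> Xlike" | "v \<in> Yclass t" | "v \<in> Ylike" "v \<notin> Yclass t"
      using trichotomy[OF vV] by blast
    then show ?thesis
    proof cases
      case 1
      then have "v \<notin> Xclass s" "v \<notin> Yclass t"
        using Full_Xlike_disjoint swap.Full_Xlike_disjoint Xs(1) Yt(1) by blast+
      then have "r v = v" by (rule r_id)
      moreover have "E v (r u)" using swap.Full_Ylike[OF 1] rX(2)[OF u] Xt(1) by blast
      ultimately show ?thesis using sym by simp
    next
      case 2
      then have v: "v \<in> Xclass s" using Xclass_step[OF st(1) u _ uv] by blast
      moreover have "u \<noteq> v" using uv irr by blast
      ultimately have "g u \<noteq> g v" using g(2) u unfolding inj_on_def by blast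
      then show ?thesis using Xclass_clique[OF st(2)] rX u v by metis
    next
      case 3
      then have "r v \<in> Yclass s" by (rule rY)
      then have "r v \<in> Ylike" "r v \<notin> Yclass t" using Ys(1) Yts by blast+
      then show ?thesis using Xclass_nonneighbour[OF st(2) rX(2)[OF u]] by blast
    next
      case 4
      then have "v \<notin> Xclass s" using Xlike_Ylike_disjoint Xs(1) by blast
      then have "r v = v" using 4 r_id by blast
      then show ?thesis using Xclass_nonneighbour[OF st(2) rX(2)[OF u] 4(1)] 4 by simp
    qed
  qed
  have hom2: "E (r u) (r v)" if uv: "E u v" and u: "u \<in> Yclass t" for u v
  proof -
    have vV: "v \<in> V" using inV2[OF uv] .
    consider "v \<in> Full" | "v \<in> Ylike" | "v \<in> Xclass s" | "v \<in> Xlike" "v \<notin> Xclass s"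
      using trichotomy[OF vV] by blast
    then show ?thesis
    proof cases
      case 1
      then have "v \<notin> Xclass s" "v \<notin> Yclass t"
        using Full_Xlike_disjoint swap.Full_Xlike_disjoint Xs(1) Yt(1) by blast+
      then have "r v = v" by (rule r_id)
      moreover have "E v (r u)" using Full_Ylike[OF 1] rY(2)[OF u] Ys(1) by blast
      ultimately show ?thesis using sym by simp
    next
      case 2
      then have v: "v \<in> Yclass t" using swap.Xclass_step[OF st(2) u _ uv] by blast
      moreover have "u \<noteq> v" using uv irr by blast
      ultimately have "h u \<noteq> h v" using h(2) u unfolding inj_on_def by blast
      then show ?thesis using swap.Xclass_clique[OF st(1)] rY u v by metis
    next
      case 3
      then show ?thesis using hom1[of v u] uv sym by blast
    next
      case 4
      then have "v \<notin> Yclass t" using Xlike_Ylike_disjoint Yt(1) by blast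
      then have "r v = v" using 4 r_id by blast
      then show ?thesis using swap.Xclass_nonneighbour[OF st(1) rY(2)[OF u] 4(1)] 4 by simp
    qed
  qed
  show False
  proof (rule foldI[of r "x s" "Xclass s \<union> Yclass t"])
    show "r z \<in> V" if "z \<in> V" for z
      using rX(2)[of z] rY(2)[of z] r_id[of z] that Xt(1) Ys(1) XV by (metis subset_iff)
    show "E (r u) (r v)" if uv: "E u v" for u v
    proof -
      consider "u \<in> Xclass s \<union> Yclass t" | "v \<in> Xclass s \<union> Yclass t"
        | "u \<notin> Xclass s \<union> Yclass t" "v \<notin> Xclass s \<union> Yclass t" by blast
      then show ?thesis
      proof cases
        case 1
        then show ?thesis using hom1[OF uv] hom2[OF uv] by blast
      next
        case 2
        then show ?thesis using hom1[OF sym[OF uv]] hom2[OF sym[OF uv]] sym by blast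
      next
        case 3
        then show ?thesis using r_id uv by simp
      qed
    qed
    show "x s \<in> V" using xV st by blast
    show "r z \<noteq> x s" if "z \<in> V" for z
    proof
      assume eq: "r z = x s"
      then have "z \<notin> Xclass s" using rX(2)[of z] Xclass_disjoint[OF st(1-3) Xs(2)] by auto
      moreover have "z \<notin> Yclass t"
        using eq rY(2)[of z] Xlike_Ylike_disjoint[of "x s"] Ys(1) x_Xlike[OF st(1)] by auto
      ultimately show False using r_id eq Xs(2) by metis
    qed
    show "{z \<in> V. r z \<noteq> z} \<subseteq> Xclass s \<union> Yclass t" using r_id by blast
    show "finite (Xclass s \<union> Yclass t)" using Xs Yt by blast
    show "card (Xclass s \<union> Yclass t) \<le> 2 * k"
      using card_Un_le[of "Xclass s" "Yclass t"] Xs(4) Yt(4) by linarith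
  qed
qed

end

section \<open>Laminar families\<close>

text \<open>A laminar family is a forest, whose depth is bounded here by the number of colours, since the sets on
a chain have different colours. So a large ground set contains a node with at least \<open>h\<close> children, and one
point from each child gives \<open>I\<close>. The proof descends. Take a maximal set \<open>I\<close> of points of \<open>S\<close> such that no member
of the family contains two of them, except for members that contain all of \<open>S\<close>. If \<open>I\<close> has fewer than \<open>h\<close>
elements, then the maximal members around its points cover \<open>S\<close>, so one of them is large, and its colour does
not occur below it.\<close>

lemma laminar_branching:
  fixes X :: "'z \<Rightarrow> 'i set" and c :: "'z \<Rightarrow> 'c"
  assumes "finite C" and "finite Z" and h: "h \<ge> 2"
    and laminar: "\<And>z z'. z \<in> Z \<Longrightarrow> z' \<in> Z \<Longrightarrow> X z \<subseteq> X z' \<or> X z' \<subseteq> X z \<or> X z \<inter> X z' = {}"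
    and chain: "\<And>z z'. z \<in> Z \<Longrightarrow> z' \<in> Z \<Longrightarrow> X z \<noteq> {} \<Longrightarrow> X z \<subset> X z' \<Longrightarrow> c z \<noteq> c z'"
    and "finite S" and "card S \<ge> h ^ (card C + 1)"
    and "\<And>z. z \<in> Z \<Longrightarrow> X z \<subseteq> S \<or> S \<subseteq> X z \<or> X z \<inter> S = {}"
    and "\<And>z. z \<in> Z \<Longrightarrow> X z \<noteq> {} \<Longrightarrow> X z \<subset> S \<Longrightarrow> c z \<in> C"
  shows "\<exists>I\<subseteq>S. card I = h \<and> (\<forall>z\<in>Z. card (X z \<inter> I) \<le> 1 \<or> I \<subseteq> X z)"
  using assms(1,6-)
proof (induction "card C" arbitrary: C S)
  case (0 C S)
  then have "C = {}" by simp
  obtain I where I: "I \<subseteq> S" "card I = h"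
    using 0(4) \<open>C = {}\<close> by (metis One_nat_def add_0 card.empty obtain_subset_with_card_n power_one_right)
  have "card (X z \<inter> I) \<le> 1 \<or> I \<subseteq> X z" if "z \<in> Z" for z
  proof -
    have "X z = {} \<or> S \<subseteq> X z \<or> X z \<inter> S = {}"
      using 0(5)[OF that] 0(6)[OF that] \<open>C = {}\<close> by blast
    then have "X z \<inter> I = {} \<or> I \<subseteq> X z" using I by blast
    then show ?thesis by auto
  qed
  then show ?case using I by blast
next
  case (Suc n C S)
  note finC = \<open>finite C\<close> and finS = \<open>finite S\<close>
  define indep where "indep I \<longleftrightarrow> (\<forall>z\<in>Z. card (X z \<inter> I) \<le> 1 \<or> S \<subseteq> X z)" for I
  define \<I> where "\<I> = {I. I \<subseteq> S \<and> indep I}"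
  have "finite \<I>" unfolding \<I>_def using finS by simp
  moreover have "{} \<in> \<I>" unfolding \<I>_def indep_def by simp
  ultimately obtain I where I: "I \<in> \<I>" and max: "\<And>J. J \<in> \<I> \<Longrightarrow> I \<subseteq> J \<Longrightarrow> J = I"
    using finite_has_maximal2[of \<I> "{}"] by (metis subset_antisym)
  have IS: "I \<subseteq> S" and indepI: "indep I" using I unfolding \<I>_def by auto
  have finI: "finite I" using IS finS by (rule finite_subset)
  show ?case
  proof (cases "h \<le> card I")
    case True
    then obtain J where J: "J \<subseteq> I" "card J = h" by (meson obtain_subset_with_card_n)
    have "card (X z \<inter> J) \<le> 1 \<or> J \<subseteq> X z" if "z \<in> Z" for z
    proof -
      have "card (X z \<inter> J) \<le> card (X z \<inter> I)" using finI J by (intro card_mono) auto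
      then show ?thesis using indepI that J IS unfolding indep_def by fastforce
    qed
    then show ?thesis using J IS by (intro exI[of _ J]) blast
  next
    case False
    define B where "B i = {i} \<union> \<Union>{X z |z. z \<in> Z \<and> i \<in> X z \<and> \<not> S \<subseteq> X z}" for i
    have cover: "S \<subseteq> (\<Union>i\<in>I. B i)"
    proof
      fix s assume s: "s \<in> S"
      show "s \<in> (\<Union>i\<in>I. B i)"
      proof (cases "s \<in> I")
        case True
        then show ?thesis unfolding B_def by blast
      next
        case sI: False
        then have "insert s I \<notin> \<I>" using max by blast
        then obtain z where z: "z \<in> Z" "\<not> card (X z \<inter> insert s I) \<le> 1" "\<not> S \<subseteq> X z"
          using s IS unfolding \<I>_def indep_def by blast
        have old: "card (X z \<inter> I) \<le> 1" using indepI z unfolding indep_def by blast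
        have sX: "s \<in> X z" using z old by (cases "s \<in> X z") auto
        moreover have "X z \<inter> I \<noteq> {}" using z sX by auto
        ultimately show ?thesis using z(1,3) unfolding B_def by blast
      qed
    qed
    have "\<exists>i\<in>I. h ^ Suc n \<le> card (B i \<inter> S)"
    proof (rule ccontr)
      assume "\<not> ?thesis"
      then have small: "card (B i \<inter> S) \<le> h ^ Suc n" if "i \<in> I" for i using that by auto
      have "card S \<le> card (\<Union>i\<in>I. B i \<inter> S)" using cover finS by (intro card_mono) auto
      also have "\<dots> \<le> (\<Sum>i\<in>I. card (B i \<inter> S))" by (rule card_UN_le[OF finI])
      also have "\<dots> \<le> card I * h ^ Suc n" using sum_bounded_above[of I, OF small] by simp
      also have "\<dots> < h * h ^ Suc n" using False h by simp
      also have "\<dots> \<le> card S" using Suc.prems(3) Suc.hyps(2) by simp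
      finally show False by simp
    qed
    then obtain i where i: "i \<in> I" "h ^ Suc n \<le> card (B i \<inter> S)" by blast
    define Zi where "Zi = {z \<in> Z. i \<in> X z \<and> \<not> S \<subseteq> X z}"
    have "Zi \<noteq> {}"
    proof
      assume "Zi = {}"
      then have "B i = {i}" unfolding B_def Zi_def by blast
      then have "card (B i \<inter> S) \<le> 1" using i IS by auto
      moreover have "h ^ Suc n > 1" using h by (intro one_less_power) auto
      ultimately show False using i by simp
    qed
    moreover have "finite (X ` Zi)" using \<open>finite Z\<close> unfolding Zi_def by simp
    ultimately obtain z where z: "z \<in> Zi" and zmax: "\<And>z'. z' \<in> Zi \<Longrightarrow> X z \<subseteq> X z' \<Longrightarrow> X z' = X z"
      using finite_has_maximal[of "X ` Zi"] by (smt (verit) image_iff image_is_empty)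
    have zZ: "z \<in> Z" "i \<in> X z" "\<not> S \<subseteq> X z" using z unfolding Zi_def by auto
    have "X z' \<subseteq> X z" if "z' \<in> Zi" for z'
    proof -
      have "z' \<in> Z" "i \<in> X z'" using that unfolding Zi_def by auto
      then show ?thesis using laminar[OF zZ(1), of z'] zZ zmax[OF that] by blast
    qed
    then have Bi: "B i = X z" using zZ unfolding B_def Zi_def by blast
    have XS: "X z \<subset> S" using Suc.prems(4)[OF zZ(1)] zZ i IS by blast
    then have cz: "c z \<in> C" using Suc.prems(5)[OF zZ(1)] zZ by blast
    have card': "card (C - {c z}) = n" using Suc.hyps(2) cz finC by simp
    have "\<exists>I\<subseteq>X z. card I = h \<and> (\<forall>z\<in>Z. card (X z \<inter> I) \<le> 1 \<or> I \<subseteq> X z)"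
    proof (rule Suc.hyps(1)[of "C - {c z}" "X z"])
      show "h ^ (card (C - {c z}) + 1) \<le> card (X z)"
        using i card' XS Bi by (simp add: Int_absorb2 psubset_imp_subset)
      show "X z' \<subseteq> X z \<or> X z \<subseteq> X z' \<or> X z' \<inter> X z = {}" if "z' \<in> Z" for z'
        using laminar[OF zZ(1) that] by blast
      show "c z' \<in> C - {c z}" if "z' \<in> Z" "X z' \<noteq> {}" "X z' \<subset> X z" for z'
        using chain[OF that(1) zZ(1) that(2,3)] Suc.prems(5)[OF that(1,2)] that(3) XS by blast
      show "finite (X z)" using XS finS finite_subset by blast
    qed (use card' finC in auto)
    then obtain J where "J \<subseteq> X z" "card J = h" "\<forall>z\<in>Z. card (X z \<inter> J) \<le> 1 \<or> J \<subseteq> X z"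
      by blast
    then show ?thesis using XS by (intro exI[of _ J]) blast
  qed
qed

section \<open>Large induced matchings\<close>

locale induced_matching = fold_free +
  fixes T :: "'i set" and x y :: "'i \<Rightarrow> 'a"
  assumes finT: "finite T"
    and xV: "t \<in> T \<Longrightarrow> x t \<in> V" and yV: "t \<in> T \<Longrightarrow> y t \<in> V"
    and xx: "s \<in> T \<Longrightarrow> t \<in> T \<Longrightarrow> \<not> E (x s) (x t)"
    and yy: "s \<in> T \<Longrightarrow> t \<in> T \<Longrightarrow> \<not> E (y s) (y t)"
    and xy: "s \<in> T \<Longrightarrow> t \<in> T \<Longrightarrow> E (x s) (y t) \<longleftrightarrow> s = t"
begin

definition zero :: "'a \<Rightarrow> 'i \<Rightarrow> bool" where "zero z t \<longleftrightarrow> \<not> E z (x t) \<and> \<not> E z (y t)"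
definition full :: "'a \<Rightarrow> 'i \<Rightarrow> bool" where "full z t \<longleftrightarrow> E z (x t) \<and> E z (y t)"

text \<open>The path \<open>q p z w\<close> has to be met by every vertex.\<close>

lemma spread:
  assumes "E p q" "E z p" "\<not> E z q" "E z w" "\<not> E w p" "\<not> E w q"
    and "e \<in> V" "\<not> E e p" "\<not> E e q" "\<not> E e w"
  shows "E z e"
proof (rule ccontr)
  assume "\<not> E z e"
  then show False using cogem[of q p z w e] assms comm by blast
qed

text \<open>If \<open>z\<close> is adjacent to exactly one end of the edge \<open>t\<close> and to an end of another edge, then \<open>spread\<close> makes it
adjacent to both ends of every third edge, and then to both ends of the second one, too.\<close>

lemma mixed_at_one_edge:
  assumes "t \<in> T" "\<not> zero z t" "\<not> full z t" and T4: "card T \<ge> 4"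
  shows "(\<forall>s\<in>T - {t}. zero z s) \<or> (\<forall>s\<in>T - {t}. full z s)"
proof -
  obtain p q where pq: "E p q" "E z p" "\<not> E z q" "{p, q} = {x t, y t}"
  proof (cases "E z (x t)")
    case True
    then show ?thesis using that[of "x t" "y t"] assms xy[of t t] unfolding full_def by blast
  next
    case False
    then show ?thesis using that[of "y t" "x t"] assms xy[of t t] sym unfolding zero_def by blast
  qed
  have far: "\<not> E w p" "\<not> E w q" if "w \<in> {x s, y s}" "s \<in> T" "s \<noteq> t" for w s
  proof -
    have "p \<in> {x t, y t}" "q \<in> {x t, y t}" using pq(4) by blast+
    then show "\<not> E w p" "\<not> E w q"
      using that assms(1) xx[of s t] yy[of s t] xy[of s t] xy[of t s] comm by blast+
  qed
  have step: "full z r" if "\<not> zero z s" "s \<in> T" "s \<noteq> t" "r \<in> T" "r \<noteq> s" "r \<noteq> t" for s r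
  proof -
    obtain w where w: "w \<in> {x s, y s}" "E z w" using \<open>\<not> zero z s\<close> unfolding zero_def by blast
    have "E z e" if e: "e \<in> {x r, y r}" for e
    proof (rule spread[OF pq(1-3) w(2) far[OF w(1)]])
      show "\<not> E e w"
        using e w \<open>r \<noteq> s\<close> \<open>s \<in> T\<close> \<open>r \<in> T\<close> xx[of r s] yy[of r s] xy[of s r] xy[of r s] comm by blast
      show "\<not> E e p" "\<not> E e q" using far[OF e] \<open>r \<in> T\<close> \<open>r \<noteq> t\<close> by blast+
      show "e \<in> V" using e xV yV \<open>r \<in> T\<close> by blast
    qed fact+
    then show ?thesis unfolding full_def by blast
  qed
  show ?thesis
  proof (cases "\<forall>s\<in>T - {t}. zero z s")
    case False
    then obtain s where s: "s \<in> T" "s \<noteq> t" "\<not> zero z s" by blast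
    have "card {s, t} + 2 \<le> card T" using T4 s by simp
    then obtain r where r: "r \<in> T" "r \<noteq> s" "r \<noteq> t"
      using two_outside[of "{s, t}" T] by (metis DiffE finite.emptyI finite_insert insertCI)
    have "\<not> zero z r" using step[of s r] s r unfolding zero_def full_def by blast
    then have "full z s" using step[of r s] s r by blast
    then show ?thesis using step[of s] s by blast
  qed blast
qed

text \<open>The path runs \<open>x s\<close>, \<open>z\<close>, \<open>x r\<close>, \<open>z'\<close>; the edge \<open>q\<close> is not attached to it.\<close>

lemma no_split_nonadjacent:
  assumes "\<not> E z z'" "{s, r, q} \<subseteq> T" "full z s" "zero z' s" "full z r" "full z' r" "zero z q" "zero z' q"
  shows False
  using cogem[of "x s" z "x r" z' "x q"] assms xx xV comm unfolding full_def zero_def by auto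

text \<open>Here the path is \<open>x s\<close>, \<open>z\<close>, \<open>z'\<close>, \<open>x t\<close>, and again the edge \<open>q\<close> is not attached to it.\<close>

lemma no_split_adjacent:
  assumes "E z z'" "{s, t, q} \<subseteq> T" "full z s" "zero z' s" "full z' t" "zero z t" "zero z q" "zero z' q"
  shows False
  using cogem[of "x s" z z' "x t" "x q"] assms xx xV comm unfolding full_def zero_def by auto

text \<open>Fix an index \<open>t0\<close> and let \<open>X z\<close> be the set of edges to which \<open>z\<close> is joined or, if \<open>t0\<close> is one of these
edges, the set of all others. As \<open>X z\<close> never contains \<open>t0\<close>, the lemmas \<open>no_split_nonadjacent\<close> and
\<open>no_split_adjacent\<close> show that these sets are laminar, and that \<open>z\<close> and \<open>z'\<close> are adjacent whenever their
sets are nonempty, properly nested and of the same kind. So colouring \<open>z\<close> by \<open>f z\<close> and the kind of \<open>X z\<close> uses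
\<open>2 * k\<close> colours and separates the sets on a chain.\<close>

lemma obtain_unsplit:
  assumes h: "h \<ge> 2" and big: "card T \<ge> h ^ (2 * k + 1) + 1" and T4: "card T \<ge> 4"
  obtains I where "I \<subseteq> T" "card I = h"
    "\<forall>z\<in>V. (\<exists>q. \<forall>t\<in>I - {q}. zero z t) \<or> (\<exists>q. \<forall>t\<in>I - {q}. full z t)"
proof -
  obtain t0 where t0: "t0 \<in> T" using T4 by fastforce
  define Z where "Z = {z \<in> V. \<forall>t\<in>T. zero z t \<or> full z t}"
  \<comment> \<open>Complementing where necessary keeps \<open>t0\<close> out of all these sets.\<close>
  define X where "X z = {t \<in> T. full z t \<noteq> full z t0}" for z
  define c where "c z = (f z, full z t0)" for z
  have zf: "zero z t \<longleftrightarrow> \<not> full z t" if "z \<in> Z" "t \<in> T" for z t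
    using that unfolding Z_def zero_def full_def by auto
  have R1: False
    if "\<not> E z z'" "z \<in> Z" "z' \<in> Z" "s \<in> T" "r \<in> T" "q \<in> T" "full z s" "\<not> full z' s" "full z r" "full z' r"
      "\<not> full z q" "\<not> full z' q" for z z' s r q
    using no_split_nonadjacent[of z z' s r q] that zf by auto
  have R2: False
    if "E z z'" "z \<in> Z" "z' \<in> Z" "s \<in> T" "t \<in> T" "q \<in> T" "full z s" "\<not> full z' s" "full z' t" "\<not> full z t"
      "\<not> full z q" "\<not> full z' q" for z z' s t q
    using no_split_adjacent[of z z' s t q] that zf by auto
  have cross: False
    if z: "z \<in> Z" "z' \<in> Z" and T: "a \<in> T" "b \<in> T" "d \<in> T" "e \<in> T" and full: "full z a" "\<not> full z' a"
      "full z' b" "\<not> full z b" "full z d" "full z' d" "\<not> full z e" "\<not> full z' e" for z z' a b d e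
    using R1[of z z' a d e] R2[of z z' a b e] that by blast
  have laminar: "X z \<subseteq> X z' \<or> X z' \<subseteq> X z \<or> X z \<inter> X z' = {}" if z: "z \<in> Z" "z' \<in> Z" for z z'
  proof (rule ccontr)
    assume "\<not> ?thesis"
    then obtain a b d where abd: "a \<in> X z" "a \<notin> X z'" "b \<in> X z'" "b \<notin> X z" "d \<in> X z" "d \<in> X z'"
      by blast
    then have T: "a \<in> T" "b \<in> T" "d \<in> T" unfolding X_def by auto
    show False
    proof (cases "full z t0"; cases "full z' t0")
      assume "full z t0" "full z' t0"
      then show False using cross[of z z' b a t0 d] z T t0 abd unfolding X_def by auto
    next
      assume "full z t0" "\<not> full z' t0"
      then show False using cross[of z' z d t0 b a] z T t0 abd unfolding X_def by auto
    next
      assume "\<not> full z t0" "full z' t0"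
      then show False using cross[of z z' d t0 a b] z T t0 abd unfolding X_def by auto
    next
      assume "\<not> full z t0" "\<not> full z' t0"
      then show False using cross[of z z' a b d t0] z T t0 abd unfolding X_def by auto
    qed
  qed
  have chain: "c z \<noteq> c z'" if z: "z \<in> Z" "z' \<in> Z" and X: "X z \<noteq> {}" "X z \<subset> X z'" for z z'
  proof
    assume "c z = c z'"
    then have same: "full z t0 = full z' t0" and nE: "\<not> E z z'" "\<not> E z' z"
      using proper[of z z'] proper[of z' z] unfolding c_def by auto
    obtain a b where ab: "a \<in> X z" "a \<in> X z'" "b \<in> X z'" "b \<notin> X z" using X by blast
    then have T: "a \<in> T" "b \<in> T" unfolding X_def by auto
    show False
    proof (cases "full z t0")
      case True
      then show False using R1[OF nE(1) z, of b t0 a] ab T t0 same unfolding X_def by auto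
    next
      case False
      then show False using R1[OF nE(2) z(2,1), of b a t0] ab T t0 same unfolding X_def by auto
    qed
  qed
  have "\<exists>I\<subseteq>T - {t0}. card I = h \<and> (\<forall>z\<in>Z. card (X z \<inter> I) \<le> 1 \<or> I \<subseteq> X z)"
  proof (rule laminar_branching[where c = c and C = "{..<k} \<times> UNIV"])
    show "finite Z" using fin unfolding Z_def by simp
    have "card ({..<k} \<times> (UNIV :: bool set)) = 2 * k" by (simp add: card_cartesian_product)
    moreover have "h ^ (2 * k + 1) \<le> card (T - {t0})"
      using big card_Diff_singleton[OF t0] by linarith
    ultimately show "h ^ (card ({..<k} \<times> (UNIV :: bool set)) + 1) \<le> card (T - {t0})"
      by (simp only:)
    show "X z \<subseteq> T - {t0} \<or> T - {t0} \<subseteq> X z \<or> X z \<inter> (T - {t0}) = {}" for z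
      unfolding X_def by auto
    show "c z \<in> {..<k} \<times> UNIV" if "z \<in> Z" for z
      using that colors unfolding c_def Z_def by auto
  qed (use laminar chain h finT in auto)
  then obtain I where I: "I \<subseteq> T - {t0}" "card I = h"
    and unsplit: "\<And>z. z \<in> Z \<Longrightarrow> card (X z \<inter> I) \<le> 1 \<or> I \<subseteq> X z" by blast
  have finI: "finite I" using I(1) finT finite_subset by blast
  show ?thesis
  proof (rule that[of I])
    show "I \<subseteq> T" using I by blast
    show "card I = h" by fact
    have "(\<exists>q. \<forall>t\<in>I - {q}. zero z t) \<or> (\<exists>q. \<forall>t\<in>I - {q}. full z t)"
      if z: "z \<in> V" for z
    proof (cases "z \<in> Z")
      case False
      then obtain t where "t \<in> T" "\<not> zero z t" "\<not> full z t" using z unfolding Z_def by blast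
      from mixed_at_one_edge[OF this T4] show ?thesis using I(1) by blast
    next
      case True
      have "\<exists>q. X z \<inter> I \<subseteq> {q} \<or> I \<subseteq> X z"
        using unsplit[OF True] finI by (metis One_nat_def card_le_Suc0_iff_eq finite_Int insertI1 singleton_iff subsetI)
      then obtain q where q: "X z \<inter> I \<subseteq> {q} \<or> I \<subseteq> X z" by blast
      have IT: "t \<in> T" if "t \<in> I" for t using I(1) that by blast
      show ?thesis
      proof (cases "I \<subseteq> X z")
        case IX: True
        show ?thesis
        proof (cases "full z t0")
          case ft: True
          then have "\<forall>t\<in>I - {q}. zero z t" using IX zf[OF True] IT unfolding X_def by blast
          then show ?thesis by blast
        next
          case False
          then have "\<forall>t\<in>I - {q}. full z t" using IX unfolding X_def by blast
          then show ?thesis by blast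
        qed
      next
        case False
        then have q': "t \<notin> X z" if "t \<in> I - {q}" for t using q that by blast
        show ?thesis
        proof (cases "full z t0")
          case ft: True
          then have "\<forall>t\<in>I - {q}. full z t" using q' IT unfolding X_def by blast
          then show ?thesis by blast
        next
          case False
          then have "\<forall>t\<in>I - {q}. zero z t" using q' IT zf[OF True] unfolding X_def by blast
          then show ?thesis by blast
        qed
      qed
    qed
    then show "\<forall>z\<in>V. (\<exists>q. \<forall>t\<in>I - {q}. zero z t) \<or> (\<exists>q. \<forall>t\<in>I - {q}. full z t)"
      by blast
  qed
qed

end

context cogem_house_free
begin

lemma comp_sym: "v \<in> W \<Longrightarrow> u \<in> comp W v \<Longrightarrow> v \<in> comp W u"
proof -
  assume v: "v \<in> W" and u: "u \<in> comp W v"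
  then have uW: "u \<in> W" using comp_subset by blast
  show "v \<in> comp W u"
  proof (rule ccontr)
    assume neg: "v \<notin> comp W u"
    have "v \<notin> comp W u \<longrightarrow> u \<notin> comp W u"
      using comp_constant[where Q = "\<lambda>z. z \<notin> comp W u", OF v _ comp_self u]
        comp_step[OF uW] comp_subset[OF v] sym by blast
    then show False using neg comp_self by blast
  qed
qed

lemma comp_trans: "v \<in> W \<Longrightarrow> u \<in> comp W v \<Longrightarrow> w \<in> comp W u \<Longrightarrow> w \<in> comp W v"
  unfolding comp_def by auto

end

text \<open>After the choice of edges, every vertex is attached to at most one edge or completely joined to all but
at most one: it is \<open>Low\<close> or \<open>High\<close>. The bound on the number of edges leaves more than \<open>k + 10\<close> of them
after discarding one whose component may be a module and selecting the most frequent of \<open>k\<close> colours.\<close>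

locale unsplit_matching = induced_matching V E f k T x y
  for V :: "'a set" and E f k and T :: "'i set" and x y +
  assumes cardT: "card T \<ge> k * (k + 10) + 6"
    and unsplit: "z \<in> V \<Longrightarrow> (\<exists>q. \<forall>t\<in>T - {q}. zero z t) \<or> (\<exists>q. \<forall>t\<in>T - {q}. full z t)"
begin

definition Low :: "'a set" where "Low = {z \<in> V. \<exists>q. \<forall>t\<in>T - {q}. zero z t}"
definition High :: "'a set" where "High = {z \<in> V. \<exists>q. \<forall>t\<in>T - {q}. full z t}"

lemma Low_High: "z \<in> V \<Longrightarrow> z \<in> Low \<or> z \<in> High"
  unfolding Low_def High_def using unsplit by blast

lemma xy_Low: "t \<in> T \<Longrightarrow> x t \<in> Low" "t \<in> T \<Longrightarrow> y t \<in> Low"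
  unfolding Low_def zero_def using xV yV xx yy xy comm by blast+

lemma avoid:
  assumes "finite B" "card B \<le> 4" obtains r where "r \<in> T" "r \<notin> B"
proof -
  have "card B + 2 \<le> card T" using assms(2) cardT by linarith
  from two_outside[OF assms(1) this] show thesis using that by blast
qed

lemma P4_free_Low: "P4_free_on E Low"
proof (rule P4_free_onI)
  show "Low \<subseteq> V" unfolding Low_def by blast
  fix a b c d assume abcd: "a \<in> Low" "b \<in> Low" "c \<in> Low" "d \<in> Low"
  have "\<exists>q. \<forall>t\<in>T - {q}. \<not> E (x t) z" if "z \<in> Low" for z
    using that comm unfolding Low_def zero_def by blast
  then obtain q where q: "\<And>z t. z \<in> Low \<Longrightarrow> t \<in> T \<Longrightarrow> t \<noteq> q z \<Longrightarrow> \<not> E (x t) z" by (metis DiffI singletonD)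
  have "card {q a, q b, q c, q d} \<le> 4" by (simp add: card_insert_if)
  then obtain r where "r \<in> T" "r \<notin> {q a, q b, q c, q d}" using avoid by (metis finite.emptyI finite_insert)
  then show "\<exists>e\<in>V. \<not> E e a \<and> \<not> E e b \<and> \<not> E e c \<and> \<not> E e d"
    using xV[of r] q abcd by auto
qed

abbreviation C :: "'i \<Rightarrow> 'a set" where "C t \<equiv> comp Low (x t)"

lemma C_Low: "t \<in> T \<Longrightarrow> C t \<subseteq> Low"
  using comp_subset xy_Low by blast

text \<open>The component would have diameter two, so some vertex of \<open>Low\<close> would be attached to both edges.\<close>

lemma x_notin_C:
  assumes "s \<in> T" "t \<in> T" "s \<noteq> t"
  shows "x s \<notin> C t"
proof
  assume "x s \<in> C t"
  then have "joined_in E Low (x t) (x s)" unfolding comp_def by simp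
  from P4_free_diameter[OF P4_free_Low irr xy_Low(1)[OF assms(2)] this]
  have "x t = x s \<or> E (x t) (x s) \<or> (\<exists>z\<in>Low. E (x t) z \<and> E z (x s))" .
  moreover have "x t \<noteq> x s" using xy[of s s] xy[of t s] assms by auto
  ultimately obtain z where z: "z \<in> Low" "E z (x t)" "E z (x s)" using xx assms comm by blast
  then show False using assms unfolding Low_def zero_def by blast
qed

lemma C_disjoint:
  assumes "s \<in> T" "t \<in> T" "s \<noteq> t" "u \<in> C s" "u \<in> C t"
  shows False
  using x_notin_C[OF assms(1-3)] comp_sym[OF xy_Low(1)[OF assms(1)] assms(4)]
    comp_trans[OF xy_Low(1)[OF assms(2)] assms(5)] by blast

lemma C_anticomplete:
  assumes "s \<in> T" "t \<in> T" "s \<noteq> t" "u \<in> C s" "v \<in> C t"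
  shows "\<not> E u v"
proof
  assume "E u v"
  then have "v \<in> C s"
    using comp_step[OF xy_Low(1)[OF assms(1)] assms(4)] C_Low[OF assms(2)] assms(5) by blast
  then show False using C_disjoint[OF assms(1-3)] assms(5) by blast
qed

lemma mixed_edge:
  assumes "t \<in> T" "u \<in> C t" "v \<in> C t" "E z u" "\<not> E z v"
  obtains (edge) a b where "a \<in> C t" "b \<in> C t" "E a b" "E z a" "\<not> E z b"
proof (rule ccontr)
  assume neg: "\<not> thesis"
  have no: "E z b" if "a \<in> C t" "b \<in> C t" "E a b" "E z a" for a b
  proof (rule ccontr)
    assume "\<not> E z b"
    from edge[OF that this] neg show False by blast
  qed
  have "E z v"
    by (rule comp_constant[where Q = "E z", OF xy_Low(1)[OF assms(1)] _ assms(2,3,4)]) (rule no)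
  then show False using assms by blast
qed

text \<open>A vertex \<open>z\<close> of \<open>High\<close> with nonneighbours in two components distinguishes the ends of an edge \<open>a b\<close> in
one of them. The path \<open>b, a, z, x r\<close> is then missed by the nonneighbour in the other one.\<close>

lemma High_misses_one:
  assumes z: "z \<in> High" and st: "s \<in> T" "t \<in> T" "s \<noteq> t" and v: "v \<in> C t" "\<not> E z v"
    and v': "v' \<in> C s" "\<not> E z v'"
  shows False
proof -
  have aux: False
    if q: "\<forall>t\<in>T - {q}. full z t" and h: "s \<in> T" "t \<in> T" "s \<noteq> t" "v \<in> C t" "\<not> E z v"
     "v' \<in> C s" "\<not> E z v'" "t \<noteq> q" for q s t v v'
  proof -
    \<comment> \<open>The exceptional index of \<open>z\<close> differs from \<open>s\<close> or from \<open>t\<close>; by symmetry, from \<open>t\<close>.\<close>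
    have "E z (x t)" using q h unfolding full_def by blast
    then obtain a b where ab: "a \<in> C t" "b \<in> C t" "E a b" "E z a" "\<not> E z b"
      using mixed_edge[OF h(2) comp_self h(4) _ h(5)] by blast
    have "card {s, t, q} \<le> 4" by (simp add: card_insert_if)
    then obtain r where r: "r \<in> T" "r \<notin> {s, t, q}" using avoid by (metis finite.emptyI finite_insert)
    have "E z (x r)" using q r unfolding full_def by blast
    show False
    proof (rule cogem[of b a z "x r" v'])
      show "v' \<in> V" using C_Low[OF h(1)] h(6) unfolding Low_def by blast
      show "\<not> E b (x r)" "\<not> E a (x r)"
        using C_anticomplete[of t r] h r ab comp_self by blast+
      show "\<not> E v' b" "\<not> E v' a" "\<not> E v' (x r)"
        using C_anticomplete[of s t v'] C_anticomplete[of s r v'] h r ab comp_self by blast+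
    qed (use ab h \<open>E z (x r)\<close> comm in blast)+
  qed
  obtain q where q: "\<forall>t\<in>T - {q}. full z t" using z unfolding High_def by blast
  show False using aux[OF q st v v'] aux[OF q st(2,1) _ v' v] st(3) by blast
qed

definition bad :: "'i \<Rightarrow> bool" where
  "bad t \<longleftrightarrow> (\<exists>z\<in>High. \<exists>v\<in>C t. \<not> E z v)"

text \<open>Otherwise the union of the two components is a module without an induced four-vertex path that is not
a clique.\<close>

lemma almost_all_bad:
  assumes st: "s \<in> T" "t \<in> T" "s \<noteq> t"
  shows "bad s \<or> bad t"
proof (rule ccontr)
  assume good: "\<not> ?thesis"
  let ?M = "C s \<union> C t"
  have sub: "?M \<subseteq> Low" using C_Low st by blast
  have "E (x s) (x t)"
  proof (rule P4_free_module_clique)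
    show "?M \<subseteq> V" using sub unfolding Low_def by blast
    show "P4_free_on E ?M" by (rule P4_free_on_subset[OF P4_free_Low sub])
    show "x s \<in> ?M" "x t \<in> ?M" using comp_self by blast+
    show "x s \<noteq> x t" using x_notin_C[OF st] comp_self by metis
    show "homogeneous_to ?M z" if z: "z \<in> V - ?M" for z
    proof (cases "z \<in> High")
      case True
      then show ?thesis using good unfolding homogeneous_to_def bad_def by blast
    next
      case False
      then have zL: "z \<in> Low" using z Low_High by blast
      have "\<not> E z m" if "m \<in> ?M" for m
      proof
        assume "E z m"
        then have "E m z" by (rule sym)
        then have "z \<in> C s \<or> z \<in> C t"
          using that comp_step[OF xy_Low(1)[OF st(1)], of m z] comp_step[OF xy_Low(1)[OF st(2)], of m z] zL
          by blast
        then show False using z by blast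
      qed
      then show ?thesis unfolding homogeneous_to_def by blast
    qed
  qed
  then show False using xx st by blast
qed

text \<open>For each bad \<open>t\<close> choose a vertex \<open>z t\<close> of \<open>High\<close> that is not complete to the component of \<open>t\<close>; it is complete to all other
components. Many of these vertices have the same colour, hence are pairwise nonadjacent. If \<open>z t\<close> had a
neighbour in its component, it would distinguish the ends of an edge there, and this edge together
with \<open>z t\<close>, another \<open>z s\<close> and a third component would contain a house. So the vertices \<open>z t\<close> and \<open>x t\<close> form a comatching.\<close>

lemma unsplit_matching_impossible: False
proof -
  define B where "B = {t \<in> T. bad t}"
  have finB: "finite B" unfolding B_def using finT by simp
  have cardB: "k * (k + 10) < card B"
  proof -
    have "\<forall>a\<in>T - B. \<forall>b\<in>T - B. a = b" using almost_all_bad unfolding B_def by blast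
    then have "card (T - B) \<le> 1" using card_le_Suc0_iff_eq[of "T - B"] finT by simp
    moreover have "card (T - B) = card T - card B"
      using finB by (intro card_Diff_subset) (auto simp: B_def)
    ultimately show ?thesis using cardT by linarith
  qed
  have "\<forall>t\<in>B. \<exists>z. z \<in> High \<and> (\<exists>v\<in>C t. \<not> E z v)" unfolding B_def bad_def by blast
  then obtain z where z: "\<And>t. t \<in> B \<Longrightarrow> z t \<in> High" "\<And>t. t \<in> B \<Longrightarrow> \<exists>v\<in>C t. \<not> E (z t) v" by metis
  have HV: "High \<subseteq> V" unfolding High_def by blast
  have "\<exists>c<k. k + 10 < card {t \<in> B. f (z t) = c}"
  proof (rule ccontr)
    assume neg: "\<not> ?thesis"
    have "f (z t) < k" if "t \<in> B" for t using z(1)[OF that] HV colors by blast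
    then have "B \<subseteq> (\<Union>c<k. {t \<in> B. f (z t) = c})" by auto
    then have "card B \<le> card (\<Union>c<k. {t \<in> B. f (z t) = c})" using finB by (intro card_mono) auto
    also have "\<dots> \<le> (\<Sum>c<k. card {t \<in> B. f (z t) = c})" by (rule card_UN_le) simp
    also have "\<dots> \<le> (\<Sum>c<k. k + 10)" using neg by (intro sum_mono) (meson lessThan_iff not_less)
    finally show False using cardB by simp
  qed
  then obtain c where c: "k + 10 < card {t \<in> B. f (z t) = c}" by blast
  define S where "S = {t \<in> B. f (z t) = c}"
  have ST: "s \<in> T" if "s \<in> S" for s using that unfolding S_def B_def by blast
  have SB: "s \<in> B" if "s \<in> S" for s using that unfolding S_def by blast
  have nonadj: "\<not> E (z s) (z t)" if "s \<in> S" "t \<in> S" for s t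
    using that proper[of "z s" "z t"] unfolding S_def by auto
  have complete: "E (z s) v" if st: "s \<in> S" "t \<in> T" "s \<noteq> t" "v \<in> C t" for s t v
    using High_misses_one[OF z(1)[OF SB[OF st(1)]] ST[OF st(1)] st(2,3,4)] z(2)[OF SB[OF st(1)]]
    by blast
  have anti: "\<not> E (z t) u" if t: "t \<in> S" "u \<in> C t" for t u
  proof
    assume "E (z t) u"
    moreover obtain v where "v \<in> C t" "\<not> E (z t) v" using z(2) SB t by blast
    ultimately obtain a b where ab: "a \<in> C t" "b \<in> C t" "E a b" "E (z t) a" "\<not> E (z t) b"
      using mixed_edge[OF ST[OF t(1)] t(2)] by blast
    have "card {t} + 2 \<le> card S" using c unfolding S_def by simp
    then obtain s r where "s \<in> S - {t}" "r \<in> S - {t}" "s \<noteq> r"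
      using two_outside[of "{t}" S] by (metis finite.emptyI finite_insert)
    then have sr: "s \<in> S" "r \<in> S" "s \<noteq> r" "s \<noteq> t" "r \<noteq> t" by auto
    show False
    proof (rule house[of "x r" "z t" a b "z s"])
      show "E (x r) (z t)" "E (z s) (x r)"
        using complete[of t r "x r"] complete[of s r "x r"] sr t ST comp_self sym by blast+
      show "E (z t) a" "E a b" "\<not> E (z t) b" by fact+
      show "\<not> E (x r) a" "\<not> E (x r) b"
        using C_anticomplete[of r t "x r"] sr t ST ab comp_self by blast+
      show "\<not> E (z s) (z t)" using nonadj sr t by blast
      show "E (z s) a" "E (z s) b" using complete[of s t] sr t ST ab by blast+
    qed
  qed
  interpret comatching V E f k S z x
  proof unfold_locales
    show "card S \<ge> 10" "card S > k" using c unfolding S_def by simp_all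
    show "E (z s) (x t) \<longleftrightarrow> s \<noteq> t" if "s \<in> S" "t \<in> S" for s t
      using complete[of s t "x t"] anti[of t "x t"] that ST comp_self by blast
    show "z t \<in> V" if "t \<in> S" for t using z(1)[OF SB[OF that]] HV by blast
  qed (rule nonadj xV xx; simp add: ST)+
  show False by (rule comatching_impossible)
qed

end

lemma (in induced_matching) induced_matching_impossible:
  assumes "card T \<ge> (k * (k + 10) + 6) ^ (2 * k + 1) + 6"
  shows False
proof -
  define h where "h = k * (k + 10) + 6"
  have "h ^ (2 * k + 1) + 6 \<le> card T" using assms unfolding h_def .
  then have big: "h ^ (2 * k + 1) + 1 \<le> card T" "4 \<le> card T" by linarith+
  have h2: "2 \<le> h" unfolding h_def by simp
  obtain I where I: "I \<subseteq> T" "card I = h"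
    "\<forall>z\<in>V. (\<exists>q. \<forall>t\<in>I - {q}. zero z t) \<or> (\<exists>q. \<forall>t\<in>I - {q}. full z t)"
    by (rule obtain_unsplit[OF h2 big]) 
  have IT: "t \<in> T" if "t \<in> I" for t using I(1) that by blast
  have finI: "finite I" using I(1) finT by (rule finite_subset)
  interpret small: induced_matching V E f k I x y
    by unfold_locales (simp_all add: finI IT xV yV xx yy xy)
  interpret unsplit_matching V E f k I x y
  proof unfold_locales
    show "k * (k + 10) + 6 \<le> card I" using I(2) unfolding h_def by simp
    show "(\<exists>q. \<forall>t\<in>I - {q}. small.zero z t) \<or> (\<exists>q. \<forall>t\<in>I - {q}. small.full z t)" if "z \<in> V" for z
      using I(3) that unfolding small.zero_def small.full_def zero_def full_def by blast
  qed
  show False by (rule unsplit_matching_impossible)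
qed

section \<open>Large colourable graphs have folds\<close>

text \<open>If \<open>A\<close> and \<open>B\<close> meet, then every other member \<open>C\<close> meets \<open>A\<close>: otherwise \<open>C\<close> lies inside \<open>B\<close>, hence \<open>B\<close> is everything.\<close>

lemma disjoint_or_codisjoint:
  assumes proper: "\<And>A. A \<in> \<F> \<Longrightarrow> A \<noteq> {} \<and> A \<subset> Y"
    and meet: "\<And>A B. A \<in> \<F> \<Longrightarrow> B \<in> \<F> \<Longrightarrow> A \<noteq> B \<Longrightarrow> A \<inter> B \<noteq> {} \<Longrightarrow> A \<union> B = Y"
  shows "(\<forall>A\<in>\<F>. \<forall>B\<in>\<F>. A \<noteq> B \<longrightarrow> A \<inter> B = {}) \<or> (\<forall>A\<in>\<F>. \<forall>B\<in>\<F>. A \<noteq> B \<longrightarrow> A \<union> B = Y)"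
proof -
  have touch: "C \<inter> A \<noteq> {}"
    if AB: "A \<in> \<F>" "B \<in> \<F>" "A \<noteq> B" "A \<inter> B \<noteq> {}" and C: "C \<in> \<F>" for A B C
  proof
    assume CA: "C \<inter> A = {}"
    have "C \<subseteq> B" using meet[OF AB] CA proper[OF C] by blast
    then have "C \<inter> B \<noteq> {}" using proper[OF C] by blast
    moreover have "C \<noteq> B" using CA AB(4) by blast
    ultimately have "C \<union> B = Y" using meet[OF C AB(2)] by blast
    then show False using \<open>C \<subseteq> B\<close> proper[OF AB(2)] by blast
  qed
  show ?thesis
  proof (cases "\<forall>A\<in>\<F>. \<forall>B\<in>\<F>. A \<noteq> B \<longrightarrow> A \<inter> B = {}")
    case False
    then obtain A B where AB: "A \<in> \<F>" "B \<in> \<F>" "A \<noteq> B" "A \<inter> B \<noteq> {}" by blast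
    have "D \<inter> C \<noteq> {}" if CD: "C \<in> \<F>" "D \<in> \<F>" "C \<noteq> D" for C D
    proof (cases "C = A")
      case True
      then show ?thesis using touch[OF AB CD(2)] by blast
    next
      case False
      have "C \<inter> A \<noteq> {}" using touch[OF AB CD(1)] by blast
      then show ?thesis using touch[OF CD(1) AB(1) False] CD(2) by blast
    qed
    then show ?thesis using meet by (metis Int_commute)
  qed blast
qed

text \<open>The base of the power is the size of a matching or comatching that suffices for a fold, plus two for
the trivial traces. As no two vertices of a colour class have the same neighbours, a vertex is
determined by its colour and its traces on the \<open>k\<close> colour classes; so this many vertices are possible if
each colour class has at most that many different traces on every other.\<close>

definition core_bound :: "nat \<Rightarrow> nat" where
  "core_bound k = k * ((k * (k + 10) + 6) ^ (2 * k + 1) + 6 + 2) ^ k"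

context fold_free
begin

text \<open>Picking a vertex for each nontrivial trace, and a point inside or outside the trace, turns a family of
disjoint traces into an induced matching and a family of traces with disjoint complements into a
comatching. If two traces met without covering the colour class, then a vertex \<open>w\<close> outside both would
miss the path that runs from a point of only one of them through the two traces' vertices.\<close>

lemma card_le_core_bound: "card V \<le> core_bound k"
proof (rule ccontr)
  define m where "m = (k * (k + 10) + 6) ^ (2 * k + 1) + 6"
  assume "\<not> ?thesis"
  then have big: "k * (m + 2) ^ k < card V" unfolding core_bound_def m_def by (simp only: not_le)
  define F where "F i = {u \<in> V. f u = i}" for i
  have finF: "finite (F i)" for i unfolding F_def using fin by simp
  have FF: "\<not> E u v" if "u \<in> F i" "v \<in> F i" for u v i
    using that proper[of u v] unfolding F_def by auto
  have "\<exists>i<k. (m + 2) ^ k < card (F i)"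
  proof (rule ccontr)
    assume neg: "\<not> ?thesis"
    have "V \<subseteq> (\<Union>i<k. F i)" unfolding F_def using colors by auto
    then have "card V \<le> card (\<Union>i<k. F i)" using finF by (intro card_mono) auto
    also have "\<dots> \<le> (\<Sum>i<k. card (F i))" by (rule card_UN_le) simp
    also have "\<dots> \<le> (\<Sum>i<k. (m + 2) ^ k)" using neg by (intro sum_mono) (meson lessThan_iff not_less)
    finally show False using big by simp
  qed
  then obtain i where i: "(m + 2) ^ k < card (F i)" by blast
  define trace where "trace u j = {w \<in> F j. E u w}" for u j
  have "\<exists>j<k. m + 2 < card ((\<lambda>u. trace u j) ` F i)"
  proof (rule ccontr)
    assume neg: "\<not> ?thesis"
    let ?g = "\<lambda>u. \<lambda>j\<in>{..<k}. trace u j"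
    have "inj_on ?g (F i)"
    proof (rule inj_onI, rule ccontr)
      fix u v assume uv: "u \<in> F i" "v \<in> F i" "?g u = ?g v" "u \<noteq> v"
      then obtain z where z: "E u z" "\<not> E v z"
        using not_dominated[of u v] FF[of u i v] unfolding F_def by blast
      have "z \<in> V" using inV2[OF z(1)] .
      then have "f z < k" "z \<in> F (f z)" using colors unfolding F_def by auto
      then have "trace u (f z) = trace v (f z)" using fun_cong[OF uv(3), of "f z"] by simp
      then show False using z \<open>z \<in> F (f z)\<close> unfolding trace_def by blast
    qed
    moreover have "?g ` F i \<subseteq> (\<Pi>\<^sub>E j\<in>{..<k}. (\<lambda>u. trace u j) ` F i)" by auto
    ultimately have "card (F i) \<le> card (\<Pi>\<^sub>E j\<in>{..<k}. (\<lambda>u. trace u j) ` F i)"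
      using finF by (intro card_inj_on_le[of ?g] finite_PiE) auto
    also have "\<dots> = (\<Prod>j<k. card ((\<lambda>u. trace u j) ` F i))" by (simp add: card_PiE)
    also have "\<dots> \<le> (\<Prod>j<k. m + 2)"
      using neg by (intro prod_mono) (meson lessThan_iff not_less zero_le)
    finally show False using i by simp
  qed
  then obtain j where j: "m + 2 < card ((\<lambda>u. trace u j) ` F i)" by blast
  define \<F> where "\<F> = (\<lambda>u. trace u j) ` F i - {{}, F j}"
  have fin\<F>: "finite \<F>" unfolding \<F>_def using finF by simp
  have card\<F>: "m \<le> card \<F>"
  proof -
    have "card ((\<lambda>u. trace u j) ` F i) - card {{}, F j} \<le> card \<F>"
      unfolding \<F>_def by (rule diff_card_le_card_Diff) simp
    moreover have "card {{}, F j} \<le> 2" by (simp add: card_insert_if)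
    ultimately show ?thesis using j by linarith
  qed
  have "\<forall>A\<in>\<F>. \<exists>u. u \<in> F i \<and> trace u j = A" unfolding \<F>_def by blast
  then obtain x where x: "\<And>A. A \<in> \<F> \<Longrightarrow> x A \<in> F i" "\<And>A. A \<in> \<F> \<Longrightarrow> trace (x A) j = A" by metis
  have xE: "E (x A) w \<longleftrightarrow> w \<in> A" if "A \<in> \<F>" "w \<in> F j" for A w
    using x(2)[OF that(1)] that(2) unfolding trace_def by blast
  have sub: "A \<noteq> {} \<and> A \<subset> F j" if "A \<in> \<F>" for A
    using that unfolding \<F>_def trace_def by blast
  have meet: "A \<union> B = F j" if AB: "A \<in> \<F>" "B \<in> \<F>" "A \<noteq> B" "A \<inter> B \<noteq> {}" for A B
  proof (rule ccontr)
    assume neg: "A \<union> B \<noteq> F j"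
    have aux: False if AB: "A \<in> \<F>" "B \<in> \<F>" and uvw: "u \<in> A" "u \<in> B" "v \<in> A" "v \<notin> B" "w \<in> F j" "w \<notin> A" "w \<notin> B"
      for A B u v w
    proof (rule cogem[of v "x A" u "x B" w])
      have in_F: "u \<in> F j" "v \<in> F j" using sub AB uvw by blast+
      show "E v (x A)" "E (x A) u" "E u (x B)" "\<not> E v (x B)" "\<not> E w (x A)" "\<not> E w (x B)"
        using xE AB uvw in_F comm by blast+
      show "\<not> E v u" "\<not> E w v" "\<not> E w u" using FF in_F uvw(5) by blast+
      show "\<not> E (x A) (x B)" using FF x(1) AB by blast
      show "w \<in> V" using uvw(5) unfolding F_def by blast
    qed
    obtain u where u: "u \<in> A" "u \<in> B" using AB(4) by blast
    obtain w where w: "w \<in> F j" "w \<notin> A" "w \<notin> B" using neg sub AB by blast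
    obtain v where "v \<in> A \<and> v \<notin> B \<or> v \<in> B \<and> v \<notin> A" using AB(3) by blast
    then show False using aux[OF AB(1,2) u _ _ w, of v] aux[OF AB(2,1) u(2,1) _ _ w(1,3,2), of v] by blast
  qed
  have iV: "F a \<subseteq> V" for a unfolding F_def by blast
  consider "\<forall>A\<in>\<F>. \<forall>B\<in>\<F>. A \<noteq> B \<longrightarrow> A \<inter> B = {}" | "\<forall>A\<in>\<F>. \<forall>B\<in>\<F>. A \<noteq> B \<longrightarrow> A \<union> B = F j"
    using disjoint_or_codisjoint[of \<F> "F j"] sub meet by blast
  then show False
  proof cases
    case 1
    have "\<forall>A\<in>\<F>. \<exists>w. w \<in> A" using sub by blast
    then obtain y where y: "\<And>A. A \<in> \<F> \<Longrightarrow> y A \<in> A" by metis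
    have yF: "y A \<in> F j" if "A \<in> \<F>" for A using y[OF that] sub[OF that] by blast
    interpret induced_matching V E f k \<F> x y
    proof unfold_locales
      show "E (x A) (y B) \<longleftrightarrow> A = B" if "A \<in> \<F>" "B \<in> \<F>" for A B
        using xE[OF that(1) yF[OF that(2)]] y[OF that(2)] 1 that by blast
      show "x A \<in> V" "y A \<in> V" if "A \<in> \<F>" for A using x(1)[OF that] yF[OF that] iV by blast+
      show "\<not> E (x A) (x B)" "\<not> E (y A) (y B)" if "A \<in> \<F>" "B \<in> \<F>" for A B
        using FF[OF x(1)[OF that(1)] x(1)[OF that(2)]] FF[OF yF[OF that(1)] yF[OF that(2)]] by blast+
    qed (rule fin\<F>)
    show False using induced_matching_impossible card\<F> unfolding m_def by blast
  next
    case 2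
    have "\<forall>A\<in>\<F>. \<exists>w. w \<in> F j - A" using sub by blast
    then obtain y where y: "\<And>A. A \<in> \<F> \<Longrightarrow> y A \<in> F j - A" by metis
    have yF: "y A \<in> F j" if "A \<in> \<F>" for A using y[OF that] by blast
    have kl: "k + 10 \<le> m"
    proof -
      have "k * 1 \<le> k * (k + 10)" by (rule mult_le_mono2) simp
      then have "k + 4 \<le> k * (k + 10) + 6" by linarith
      also have "\<dots> = (k * (k + 10) + 6) ^ 1" by simp
      also have "\<dots> \<le> (k * (k + 10) + 6) ^ (2 * k + 1)" by (rule power_increasing) simp_all
      finally show ?thesis unfolding m_def by simp
    qed
    interpret comatching V E f k \<F> x y
    proof unfold_locales
      show "10 \<le> card \<F>" "k < card \<F>" using kl card\<F> by linarith+
      show "E (x A) (y B) \<longleftrightarrow> A \<noteq> B" if "A \<in> \<F>" "B \<in> \<F>" for A B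
        using xE[OF that(1) yF[OF that(2)]] y[OF that(2)] 2 that by blast
      show "x A \<in> V" "y A \<in> V" if "A \<in> \<F>" for A using x(1)[OF that] yF[OF that] iV by blast+
      show "\<not> E (x A) (x B)" "\<not> E (y A) (y B)" if "A \<in> \<F>" "B \<in> \<F>" for A B
        using FF[OF x(1)[OF that(1)] x(1)[OF that(2)]] FF[OF yF[OF that(1)] yF[OF that(2)]] by blast+
    qed
    show False by (rule comatching_impossible)
  qed
qed

end

theorem (in cogem_house_free) small_or_foldable:
  assumes "\<And>u. u \<in> V \<Longrightarrow> f u < k" and "\<And>u v. E u v \<Longrightarrow> f u \<noteq> f v"
  shows "card V \<le> core_bound k \<or> has_fold V E (2 * k)"
proof (rule disjCI)
  assume "\<not> has_fold V E (2 * k)"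
  then interpret fold_free V E f k by unfold_locales (use assms in auto)
  show "card V \<le> core_bound k" by (rule card_le_core_bound)
qed

section \<open>Specifications of programs\<close>

text \<open>Programs leave all arrays alone that they do not mention as a target, so the frame conditions of
specifications reduce to computing this set.\<close>

primrec writes :: "com \<Rightarrow> nat set" where
  "writes Skip = {}"
| "writes (Write a i e) = {a}"
| "writes (Seq c d) = writes c \<union> writes d"
| "writes (Cond b c d) = writes c \<union> writes d"
| "writes (While b c) = writes c"

lemma exec_frame: "exec c s t s' \<Longrightarrow> a \<notin> writes c \<Longrightarrow> s' a = s a"
  by (induction rule: exec.induct) auto

abbreviation var :: "nat \<Rightarrow> aexp" where "var a \<equiv> Read a (Num 0)"

abbreviation assign :: "nat \<Rightarrow> aexp \<Rightarrow> com" where "assign a e \<equiv> Write a (Num 0) e"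

abbreviation set_var :: "state \<Rightarrow> nat \<Rightarrow> nat \<Rightarrow> state" where
  "set_var s a v \<equiv> s(a := (s a)(0 := v))"

text \<open>The counter \<open>i\<close> and the bound \<open>b\<close> are scalar variables; the bound is read again in each round, and the
rule for loops requires that the body changes neither.\<close>

definition For :: "nat \<Rightarrow> nat \<Rightarrow> com \<Rightarrow> com" where
  "For i b c = Seq (assign i (Num 0))
     (While (Less (var i) (var b)) (Seq c (assign i (Plus (var i) (Num 1)))))"

lemma writes_For [simp]: "writes (For i b c) = insert i (writes c)"
  unfolding For_def by auto

definition frame :: "nat set \<Rightarrow> state \<Rightarrow> state \<Rightarrow> bool" where
  "frame W s s' \<longleftrightarrow> (\<forall>a. a \<notin> W \<longrightarrow> s' a = s a)"

lemma frameD: "frame W s s' \<Longrightarrow> a \<notin> W \<Longrightarrow> s' a = s a"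
  unfolding frame_def by blast

text \<open>Total correctness in polynomial time. The polynomial must not depend on the input, so the pre- and
postconditions speak of states only, and the time is measured in the number of vertices, which array 2 keeps.\<close>

definition spec :: "(state \<Rightarrow> bool) \<Rightarrow> com \<Rightarrow> (state \<Rightarrow> state \<Rightarrow> bool) \<Rightarrow> bool" where
  "spec P c Q \<longleftrightarrow> (\<exists>p :: nat poly. \<forall>s. P s \<longrightarrow>
     (\<exists>t s'. exec c s t s' \<and> t \<le> poly p (s 2 0) \<and> Q s s'))"

lemma spec_weaken:
  assumes "spec P c Q" and "\<And>s. P' s \<Longrightarrow> P s"
    and "\<And>s s'. P' s \<Longrightarrow> Q s s' \<Longrightarrow> frame (writes c) s s' \<Longrightarrow> Q' s s'"
  shows "spec P' c Q'"
  using assms exec_frame unfolding spec_def frame_def by meson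

lemma spec_Skip: "spec (\<lambda>s. True) Skip (\<lambda>s s'. s' = s)"
  unfolding spec_def by (rule exI[of _ "[:1:]"]) (auto intro: exec.intros)

lemma spec_Write:
  "spec (\<lambda>s. True) (Write a i e) (\<lambda>s s'. s' = s(a := (s a)(aval i s := aval e s)))"
  unfolding spec_def by (rule exI[of _ "[:1:]"]) (auto intro: exec.intros)

lemma spec_Seq:
  assumes c: "spec P c Q" and d: "spec P' d Q'" and 2: "2 \<notin> writes c"
    and P': "\<And>s s'. P s \<Longrightarrow> Q s s' \<Longrightarrow> frame (writes c) s s' \<Longrightarrow> P' s'"
    and R: "\<And>s s' s''. P s \<Longrightarrow> Q s s' \<Longrightarrow> frame (writes c) s s' \<Longrightarrow> Q' s' s'' \<Longrightarrow>
      frame (writes d) s' s'' \<Longrightarrow> R s s''"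
  shows "spec P (Seq c d) R"
proof -
  obtain p where p: "\<And>s. P s \<Longrightarrow> \<exists>t s'. exec c s t s' \<and> t \<le> poly p (s 2 0) \<and> Q s s'"
    using c unfolding spec_def by blast
  obtain q where q: "\<And>s. P' s \<Longrightarrow> \<exists>t s'. exec d s t s' \<and> t \<le> poly q (s 2 0) \<and> Q' s s'"
    using d unfolding spec_def by blast
  have "\<exists>t s'. exec (Seq c d) s t s' \<and> t \<le> poly (p + q) (s 2 0) \<and> R s s'" if s: "P s" for s
  proof -
    obtain t s' where 1: "exec c s t s'" "t \<le> poly p (s 2 0)" "Q s s'" using p[OF s] by blast
    have f1: "frame (writes c) s s'" using exec_frame[OF 1(1)] unfolding frame_def by blast
    obtain t' s'' where 3: "exec d s' t' s''" "t' \<le> poly q (s' 2 0)" "Q' s' s''"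
      using q[OF P'[OF s 1(3) f1]] by blast
    have f2: "frame (writes d) s' s''" using exec_frame[OF 3(1)] unfolding frame_def by blast
    have "s' 2 = s 2" using frameD[OF f1 2] .
    then have "t + t' \<le> poly (p + q) (s 2 0)" using 1(2) 3(2) by simp
    then show ?thesis using exec_Seq[OF 1(1) 3(1)] R[OF s 1(3) f1 3(3) f2] by blast
  qed
  then show ?thesis unfolding spec_def by blast
qed

lemma spec_Cond:
  assumes c: "spec (\<lambda>s. P s \<and> bval b s) c Q" and d: "spec (\<lambda>s. P s \<and> \<not> bval b s) d Q"
  shows "spec P (Cond b c d) Q"
proof -
  obtain p where p: "\<And>s. P s \<and> bval b s \<Longrightarrow> \<exists>t s'. exec c s t s' \<and> t \<le> poly p (s 2 0) \<and> Q s s'"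
    using c unfolding spec_def by blast
  obtain q where q: "\<And>s. P s \<and> \<not> bval b s \<Longrightarrow> \<exists>t s'. exec d s t s' \<and> t \<le> poly q (s 2 0) \<and> Q s s'"
    using d unfolding spec_def by blast
  have "\<exists>t s'. exec (Cond b c d) s t s' \<and> t \<le> poly (1 + p + q) (s 2 0) \<and> Q s s'" if s: "P s" for s
  proof (cases "bval b s")
    case True
    then obtain t s' where "exec c s t s'" "t \<le> poly p (s 2 0)" "Q s s'" using p s by blast
    then show ?thesis using exec_CondTrue[OF True, of c t s' d] by (intro exI[of _ "1 + t"] exI[of _ s']) simp
  next
    case False
    then obtain t s' where "exec d s t s'" "t \<le> poly q (s 2 0)" "Q s s'" using q s by blast
    then show ?thesis using exec_CondFalse[OF False, of d t s' c] by (intro exI[of _ "1 + t"] exI[of _ s']) simp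
  qed
  then show ?thesis unfolding spec_def by blast
qed

text \<open>The invariant \<open>I s j s'\<close> relates the state \<open>s\<close> before the loop, the number \<open>j\<close> of finished rounds and the
current state \<open>s'\<close>. It must not depend on the counter, which is reset after each round.\<close>

lemma spec_For:
  assumes body: "spec P' c Q'" and fresh: "i \<notin> writes c" "b \<notin> writes c" "2 \<notin> writes c" "b \<noteq> i" "i \<noteq> 2"
    and bound: "\<And>s. P s \<Longrightarrow> s b 0 \<le> poly q (s 2 0)"
    and init: "\<And>s. P s \<Longrightarrow> I s 0 (set_var s i 0)"
    and pre: "\<And>s j s'. P s \<Longrightarrow> I s j s' \<Longrightarrow> j < s b 0 \<Longrightarrow> s' i 0 = j \<Longrightarrow>
      frame (insert i (writes c)) s s' \<Longrightarrow> P' s'"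
    and step: "\<And>s j s' s''. P s \<Longrightarrow> I s j s' \<Longrightarrow> j < s b 0 \<Longrightarrow> s' i 0 = j \<Longrightarrow>
      frame (insert i (writes c)) s s' \<Longrightarrow> Q' s' s'' \<Longrightarrow> frame (writes c) s' s'' \<Longrightarrow>
      I s (Suc j) (set_var s'' i (Suc j))"
    and final: "\<And>s s'. P s \<Longrightarrow> I s (s b 0) s' \<Longrightarrow> frame (insert i (writes c)) s s' \<Longrightarrow> R s s'"
  shows "spec P (For i b c) R"
proof -
  obtain p where p: "\<And>s. P' s \<Longrightarrow> \<exists>t s'. exec c s t s' \<and> t \<le> poly p (s 2 0) \<and> Q' s s'"
    using body unfolding spec_def by blast
  let ?W = "insert i (writes c)"
  let ?loop = "While (Less (var i) (var b)) (Seq c (assign i (Plus (var i) (Num 1))))"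
  have loop: "\<exists>t s''. exec ?loop s' t s'' \<and> t \<le> 1 + m * (2 + poly p (s 2 0)) \<and> I s (s b 0) s'' \<and> frame ?W s s''"
    if "P s" "m + j = s b 0" "I s j s'" "s' i 0 = j" "frame ?W s s'" for s s' m j
    using that
  proof (induction m arbitrary: j s')
    case 0
    have "s' b = s b" using frameD[OF 0(5)] fresh by auto
    then have "exec ?loop s' 1 s'" using 0 by (intro exec_WhileFalse) simp
    then show ?case using 0 by (intro exI[of _ 1] exI[of _ s']) auto
  next
    case (Suc m)
    have sb: "s' b = s b" "s' 2 = s 2" using frameD[OF Suc.prems(5)] fresh by auto
    have j: "j < s b 0" using Suc.prems(2) by simp
    obtain t r where r: "exec c s' t r" "t \<le> poly p (s' 2 0)" "Q' s' r"
      using p[OF pre[OF Suc.prems(1,3) j Suc.prems(4,5)]] by blast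
    have fr: "frame (writes c) s' r" using exec_frame[OF r(1)] unfolding frame_def by blast
    have ri: "r i 0 = j" using frameD[OF fr fresh(1)] Suc.prems(4) by simp
    let ?r = "set_var r i (Suc j)"
    have "I s (Suc j) ?r" by (rule step[OF Suc.prems(1,3) j Suc.prems(4,5) r(3) fr])
    moreover have "frame ?W s ?r" using fr Suc.prems(5) unfolding frame_def by auto
    moreover have "m + Suc j = s b 0" using Suc.prems(2) by simp
    moreover have "?r i 0 = Suc j" by simp
    ultimately obtain t' s'' where s'': "exec ?loop ?r t' s''" "t' \<le> 1 + m * (2 + poly p (s 2 0))"
      "I s (s b 0) s''" "frame ?W s s''"
      using Suc.IH[of "Suc j" ?r] Suc.prems(1) by blast
    have "exec (assign i (Plus (var i) (Num 1))) r 1 (r(i := (r i)(aval (Num 0) r := aval (Plus (var i) (Num 1)) r)))"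
      by (rule exec_Write)
    then have "exec (assign i (Plus (var i) (Num 1))) r 1 ?r" using ri by simp
    then have b1: "exec (Seq c (assign i (Plus (var i) (Num 1)))) s' (t + 1) ?r"
      by (rule exec_Seq[OF r(1)])
    have "bval (Less (var i) (var b)) s'" using j Suc.prems(4) sb by simp
    from exec_WhileTrue[OF this b1 s''(1)]
    have "exec ?loop s' (1 + (t + 1) + t') s''" .
    moreover have "1 + (t + 1) + t' \<le> 1 + Suc m * (2 + poly p (s 2 0))"
      using r(2) s''(2) sb by simp
    ultimately show ?case using s''(3,4) by blast
  qed
  have "\<exists>t s'. exec (For i b c) s t s' \<and> t \<le> poly (2 + q * (2 + p)) (s 2 0) \<and> R s s'" if s: "P s" for s
  proof -
    let ?s = "set_var s i 0"
    have "frame ?W s ?s" unfolding frame_def by auto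
    then obtain t s' where s': "exec ?loop ?s t s'" "t \<le> 1 + s b 0 * (2 + poly p (s 2 0))"
      "I s (s b 0) s'" "frame ?W s s'"
      using loop[OF s, of "s b 0" 0 ?s] init[OF s] by auto
    have "exec (assign i (Num 0)) s 1 (s(i := (s i)(aval (Num 0) s := aval (Num 0) s)))" by (rule exec_Write)
    then have "exec (assign i (Num 0)) s 1 ?s" by simp
    from exec_Seq[OF this s'(1)] have "exec (For i b c) s (1 + t) s'" unfolding For_def .
    moreover have "1 + t \<le> poly (2 + q * (2 + p)) (s 2 0)"
    proof -
      have "s b 0 * (2 + poly p (s 2 0)) \<le> poly q (s 2 0) * (2 + poly p (s 2 0))"
        using bound[OF s] by (rule mult_le_mono1)
      moreover have "poly (2 + q * (2 + p)) (s 2 0) = 2 + poly q (s 2 0) * (2 + poly p (s 2 0))"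
        by (simp add: numeral_poly)
      ultimately show ?thesis using s'(2) by linarith
    qed
    ultimately show ?thesis using final[OF s s'(3,4)] by blast
  qed
  then show ?thesis unfolding spec_def by blast
qed

section \<open>Testing first-order properties\<close>

primrec reads_aexp :: "aexp \<Rightarrow> nat set" where
  "reads_aexp (Num m) = {}"
| "reads_aexp (Read a e) = insert a (reads_aexp e)"
| "reads_aexp (Plus e e') = reads_aexp e \<union> reads_aexp e'"
| "reads_aexp (Minus e e') = reads_aexp e \<union> reads_aexp e'"

primrec reads_bexp :: "bexp \<Rightarrow> nat set" where
  "reads_bexp (Less e e') = reads_aexp e \<union> reads_aexp e'"
| "reads_bexp (Neg b) = reads_bexp b"
| "reads_bexp (Conj b b') = reads_bexp b \<union> reads_bexp b'"

lemma aval_cong: "(\<And>a. a \<in> reads_aexp e \<Longrightarrow> s a = s' a) \<Longrightarrow> aval e s = aval e s'"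
  by (induction e) auto

lemma bval_cong: "(\<And>a. a \<in> reads_bexp b \<Longrightarrow> s a = s' a) \<Longrightarrow> bval b s = bval b s'"
  by (induction b) (auto cong: aval_cong)

text \<open>The conditions that the algorithm has to test are first-order properties of arrays, with
quantifiers that range over the vertices. They are compiled to programs once and for all.\<close>

datatype fm = At bexp | Nt fm | Cj fm fm | All nat fm

text \<open>A quantified variable is an array whose cell 0 holds its value.\<close>

primrec sem :: "fm \<Rightarrow> state \<Rightarrow> bool" where
  "sem (At b) s \<longleftrightarrow> bval b s"
| "sem (Nt \<phi>) s \<longleftrightarrow> \<not> sem \<phi> s"
| "sem (Cj \<phi> \<psi>) s \<longleftrightarrow> sem \<phi> s \<and> sem \<psi> s"
| "sem (All i \<phi>) s \<longleftrightarrow> (\<forall>j<s 2 0. sem \<phi> (set_var s i j))"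

primrec fv :: "fm \<Rightarrow> nat set" where
  "fv (At b) = reads_bexp b"
| "fv (Nt \<phi>) = fv \<phi>"
| "fv (Cj \<phi> \<psi>) = fv \<phi> \<union> fv \<psi>"
| "fv (All i \<phi>) = insert 2 (fv \<phi> - {i})"

primrec bnd :: "fm \<Rightarrow> nat set" where
  "bnd (At b) = {}"
| "bnd (Nt \<phi>) = bnd \<phi>"
| "bnd (Cj \<phi> \<psi>) = bnd \<phi> \<union> bnd \<psi>"
| "bnd (All i \<phi>) = insert i (bnd \<phi>)"

text \<open>A test overwrites its bound variables, so none of them may be read by a part of the formula that is
evaluated later, or be bound twice in nested scopes.\<close>

primrec clean :: "fm \<Rightarrow> bool" where
  "clean (At b) \<longleftrightarrow> True"
| "clean (Nt \<phi>) \<longleftrightarrow> clean \<phi>"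
| "clean (Cj \<phi> \<psi>) \<longleftrightarrow> clean \<phi> \<and> clean \<psi> \<and> bnd \<phi> \<inter> fv \<psi> = {}"
| "clean (All i \<phi>) \<longleftrightarrow> clean \<phi> \<and> i \<notin> bnd \<phi> \<and> i \<noteq> 2 \<and> bnd \<phi> \<inter> fv \<phi> = {}"

text \<open>Bound variables may differ in cell 0, which is exactly what running a test changes.\<close>

lemma sem_cong:
  assumes "\<And>a. a \<in> fv \<phi> \<Longrightarrow> s a = s' a" and "\<And>a d. a \<in> bnd \<phi> \<Longrightarrow> d \<noteq> 0 \<Longrightarrow> s a d = s' a d"
  shows "sem \<phi> s = sem \<phi> s'"
  using assms
proof (induction \<phi> arbitrary: s s')
  case (At b)
  then show ?case using bval_cong[of b s s'] by simp
next
  case (All i \<phi>)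
  have "sem \<phi> (set_var s i j) = sem \<phi> (set_var s' i j)" for j
  proof (rule All.IH)
    show "(set_var s i j) a = (set_var s' i j) a" if "a \<in> fv \<phi>" for a
      using that All.prems by (cases "a = i") (auto simp: fun_eq_iff)
    show "(set_var s i j) a d = (set_var s' i j) a d" if "a \<in> bnd \<phi>" "d \<noteq> 0" for a d
      using that All.prems(2)[of a d] All.prems(2)[of i d] by (cases "a = i") auto
  qed
  moreover have "s 2 = s' 2" using All.prems(1)[of 2] by simp
  ultimately show ?case by simp
next
  case (Cj \<phi> \<psi>)
  have "sem \<phi> s = sem \<phi> s'" by (rule Cj.IH) (use Cj.prems in auto)
  moreover have "sem \<psi> s = sem \<psi> s'" by (rule Cj.IH) (use Cj.prems in auto)
  ultimately show ?case by simp
next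
  case (Nt \<phi>)
  have "sem \<phi> s = sem \<phi> s'" by (rule Nt.IH) (use Nt.prems in auto)
  then show ?case by simp
qed

text \<open>The truth value is left in array \<open>r\<close>; the arrays above \<open>r\<close> serve for intermediate results.\<close>

primrec test :: "fm \<Rightarrow> nat \<Rightarrow> com" where
  "test (At b) r = Cond b (assign r (Num 1)) (assign r (Num 0))"
| "test (Nt \<phi>) r = Seq (test \<phi> r) (assign r (Minus (Num 1) (var r)))"
| "test (Cj \<phi> \<psi>) r = Seq (test \<phi> r) (Seq (test \<psi> (Suc r))
     (Cond (Less (var (Suc r)) (Num 1)) (assign r (Num 0)) Skip))"
| "test (All i \<phi>) r = Seq (assign r (Num 1)) (For i 2 (Seq (test \<phi> (Suc r))
     (Cond (Less (var (Suc r)) (Num 1)) (assign r (Num 0)) Skip)))"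

lemma writes_test: "writes (test \<phi> r) \<subseteq> bnd \<phi> \<union> {r..r + size \<phi>}"
proof (induction \<phi> arbitrary: r)
  case (Cj \<phi> \<psi>)
  have "{r..r + size \<phi>} \<subseteq> {r..r + size (Cj \<phi> \<psi>)}" "{Suc r..Suc r + size \<psi>} \<subseteq> {r..r + size (Cj \<phi> \<psi>)}"
    by auto
  then show ?case using Cj.IH(1)[of r] Cj.IH(2)[of "Suc r"] by auto
next
  case (All i \<phi>)
  have "{Suc r..Suc r + size \<phi>} \<subseteq> {r..r + size (All i \<phi>)}" by auto
  then show ?case using All.IH[of "Suc r"] by auto
next
  case (Nt \<phi>)
  then show ?case using Nt.IH[of r] by fastforce
qed auto

text \<open>Tests write only to cell 0 of the arrays in \<open>W\<close>. Remembering this makes the values of quantified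
formulas insensitive to leftover values of bound variables.\<close>

definition frame0 :: "nat set \<Rightarrow> state \<Rightarrow> state \<Rightarrow> bool" where
  "frame0 W s s' \<longleftrightarrow> (\<forall>a d. a \<notin> W \<or> d \<noteq> 0 \<longrightarrow> s' a d = s a d)"

lemma frame0_eq: "frame0 W s s' \<Longrightarrow> a \<notin> W \<Longrightarrow> s' a = s a"
  unfolding frame0_def by (simp add: fun_eq_iff)

lemma frame0_cell: "frame0 W s s' \<Longrightarrow> d \<noteq> 0 \<Longrightarrow> s' a d = s a d"
  unfolding frame0_def by simp

lemma sem_frame0: "frame0 W s s' \<Longrightarrow> W \<inter> fv \<phi> = {} \<Longrightarrow> sem \<phi> s' = sem \<phi> s"
  by (rule sem_cong) (auto intro: frame0_eq frame0_cell)

lemma frame0_trans: "frame0 W s s' \<Longrightarrow> frame0 W' s' s'' \<Longrightarrow> W \<union> W' \<subseteq> W'' \<Longrightarrow> frame0 W'' s s''"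
  unfolding frame0_def by (metis UnI1 UnI2 subsetD)

lemma frame0_set_var: "frame0 W s s' \<Longrightarrow> a \<in> W \<Longrightarrow> frame0 W s (set_var s' a v)"
  unfolding frame0_def by auto

lemma frame0_refl: "frame0 W s s"
  unfolding frame0_def by simp

lemma spec_reset:
  "spec (\<lambda>s. True) (Cond (Less (var (Suc r)) (Num 1)) (assign r (Num 0)) Skip)
     (\<lambda>s s'. s' = (if s (Suc r) 0 = 0 then set_var s r 0 else s))"
  by (rule spec_Cond; rule spec_weaken, rule spec_Write spec_Skip) auto

lemma spec_test:
  assumes "clean \<phi>" and "\<And>a. a \<in> fv \<phi> \<union> bnd \<phi> \<Longrightarrow> a < r" and "2 \<notin> bnd \<phi>" and "2 < r"
  shows "spec (\<lambda>s. True) (test \<phi> r)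
    (\<lambda>s s'. s' r 0 = of_bool (sem \<phi> s) \<and> frame0 (writes (test \<phi> r)) s s')"
  using assms
proof (induction \<phi> arbitrary: r)
  case (At b)
  show ?case unfolding test.simps
    by (rule spec_Cond; rule spec_weaken, rule spec_Write) (auto simp: frame0_def)
next
  case (Nt \<phi>)
  show ?case unfolding test.simps
  proof (rule spec_Seq[OF Nt.IH spec_Write])
    show "2 \<notin> writes (test \<phi> r)" using writes_test[of \<phi> r] Nt.prems by auto
  qed (use Nt.prems in \<open>auto simp: frame0_def\<close>)
next
  case (Cj \<phi> \<psi>)
  have w1: "writes (test \<phi> r) \<subseteq> bnd \<phi> \<union> {r..}" and w2: "writes (test \<psi> (Suc r)) \<subseteq> bnd \<psi> \<union> {Suc r..}"
    using writes_test[of \<phi> r] writes_test[of \<psi> "Suc r"] by auto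
  have small: "a < r" if "a \<in> fv \<phi> \<union> fv \<psi> \<union> bnd \<phi> \<union> bnd \<psi>" for a using Cj.prems(2)[of a] that by auto
  have IH1: "spec (\<lambda>s. True) (test \<phi> r)
    (\<lambda>s s'. s' r 0 = of_bool (sem \<phi> s) \<and> frame0 (writes (test \<phi> r)) s s')"
    by (rule Cj.IH) (use Cj.prems in auto)
  have IH2: "spec (\<lambda>s. True) (test \<psi> (Suc r))
    (\<lambda>s s'. s' (Suc r) 0 = of_bool (sem \<psi> s) \<and> frame0 (writes (test \<psi> (Suc r))) s s')"
  proof (rule Cj.IH)
    show "2 < Suc r" using Cj.prems(4) by simp
  qed (use Cj.prems(1-3) in \<open>auto intro: less_SucI\<close>)
  have two: "2 \<notin> writes (test \<phi> r)" "2 \<notin> writes (test \<psi> (Suc r))"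
    using w1 w2 Cj.prems by auto
  have disj: "writes (test \<phi> r) \<inter> fv \<psi> = {}" using w1 small Cj.prems(1) by fastforce
  have rw: "r \<notin> writes (test \<psi> (Suc r))" using w2 small by fastforce
  have rest: "spec (\<lambda>s. True) (Seq (test \<psi> (Suc r)) (Cond (Less (var (Suc r)) (Num 1)) (assign r (Num 0)) Skip))
    (\<lambda>s s'. s' r 0 = (if sem \<psi> s then s r 0 else 0) \<and> frame0 (insert r (writes (test \<psi> (Suc r)))) s s')"
    by (rule spec_Seq[OF IH2 spec_reset two(2)])
      (use rw in \<open>auto simp: frame0_def fun_eq_iff\<close>)
  show ?case unfolding test.simps
  proof (rule spec_Seq[OF IH1 rest two(1)], goal_cases)
    case (2 s s' s'')
    then have "sem \<psi> s' = sem \<psi> s" using sem_frame0 disj by blast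
    moreover have "frame0 (writes (test (Cj \<phi> \<psi>) r)) s s''"
      by (rule frame0_trans[of "writes (test \<phi> r)" s s']) (use 2 in auto)
    ultimately show ?case using 2 by auto
  qed simp
next
  case (All i \<phi>)
  have w: "writes (test \<phi> (Suc r)) \<subseteq> bnd \<phi> \<union> {Suc r..}" using writes_test[of \<phi> "Suc r"] by auto
  have small: "a < r" if "a \<in> fv \<phi> \<union> bnd \<phi> \<union> {i}" for a using All.prems(2)[of a] that by auto
  have IH: "spec (\<lambda>s. True) (test \<phi> (Suc r))
    (\<lambda>s s'. s' (Suc r) 0 = of_bool (sem \<phi> s) \<and> frame0 (writes (test \<phi> (Suc r))) s s')"
  proof (rule All.IH)
    show "2 < Suc r" using All.prems(4) by simp
  qed (use All.prems(1,3) small in \<open>auto intro: less_SucI\<close>)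
  have two: "2 \<notin> writes (test \<phi> (Suc r))"
  proof
    assume "2 \<in> writes (test \<phi> (Suc r))"
    then have "2 \<in> bnd \<phi> \<or> Suc r \<le> 2" using w by auto
    then show False using All.prems(3,4) by auto
  qed
  have rw: "r \<notin> writes (test \<phi> (Suc r))" using w small by fastforce
  have iw: "i \<notin> writes (test \<phi> (Suc r))" using w small[of i] All.prems(1) by fastforce
  let ?body = "Seq (test \<phi> (Suc r)) (Cond (Less (var (Suc r)) (Num 1)) (assign r (Num 0)) Skip)"
  let ?W = "insert i (insert r (writes (test \<phi> (Suc r))))"
  have body: "spec (\<lambda>s. True) ?body
    (\<lambda>s s'. s' r 0 = (if sem \<phi> s then s r 0 else 0) \<and> frame0 (insert r (writes (test \<phi> (Suc r)))) s s')"
    by (rule spec_Seq[OF IH spec_reset two]) (use rw in \<open>auto simp: frame0_def fun_eq_iff\<close>)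
  have Wfv: "?W \<inter> (fv \<phi> - {i}) = {}" using w small All.prems(1) by fastforce
  have same: "sem \<phi> s' = sem \<phi> (set_var s i (s' i 0))" if "frame0 ?W s s'" for s s'
  proof (rule sem_cong)
    show "s' a = set_var s i (s' i 0) a" if "a \<in> fv \<phi>" for a
      using frame0_eq[OF \<open>frame0 ?W s s'\<close>, of a] frame0_cell[OF \<open>frame0 ?W s s'\<close>, of _ i] Wfv that
      by (cases "a = i") (auto simp: fun_eq_iff)
    show "s' a d = set_var s i (s' i 0) a d" if "a \<in> bnd \<phi>" "d \<noteq> 0" for a d
      using frame0_cell[OF \<open>frame0 ?W s s'\<close> that(2)] that by auto
  qed
  have loop: "spec (\<lambda>s. s r 0 = 1) (For i 2 ?body)
    (\<lambda>s s'. s' r 0 = of_bool (sem (All i \<phi>) s) \<and> frame0 ?W s s')"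
  proof (rule spec_For[OF body, where q = "[:0, 1:]" and
        I = "\<lambda>s j s'. s' r 0 = of_bool (\<forall>j'<j. sem \<phi> (set_var s i j')) \<and> frame0 ?W s s'"], goal_cases)
    case (9 s j s' s'')
    then have "sem \<phi> s' = sem \<phi> (set_var s i j)" using same by blast
    then have "s'' r 0 = of_bool (\<forall>j'<Suc j. sem \<phi> (set_var s i j'))"
      using 9 by (auto simp: less_Suc_eq)
    moreover have "frame0 ?W s s''" by (rule frame0_trans[of ?W s s']) (use 9 in auto)
    ultimately show ?case using small[of i] by (auto intro: frame0_set_var)
  next
    case (7 s)
    then show ?case using small[of i] by (auto intro: frame0_set_var frame0_refl)
  qed (use iw two small[of i] All.prems in auto)
  show ?case unfolding test.simps
  proof (rule spec_Seq[OF spec_Write loop], goal_cases)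
    case (3 s s' s'')
    have "frame0 {r} s s'" using 3 by (auto simp: frame0_def)
    then have "sem (All i \<phi>) s' = sem (All i \<phi>) s"
      by (rule sem_frame0) (use small All.prems in auto)
    moreover have "frame0 (writes (test (All i \<phi>) r)) s s''"
      by (rule frame0_trans[OF \<open>frame0 {r} s s'\<close>]) (use 3 in auto)
    ultimately show ?case using 3 by auto
  qed (use All.prems in auto)
qed

section \<open>Searching for a modification of an array\<close>

primrec mods :: "nat \<Rightarrow> nat \<Rightarrow> nat \<Rightarrow> (nat \<Rightarrow> nat) \<Rightarrow> (nat \<Rightarrow> nat) set" where
  "mods n b 0 f = {f}"
| "mods n b (Suc c) f = insert f (\<Union>i<n. \<Union>v<b. mods n b c (f(i := v)))"

lemma modsI:
  assumes "{i. g i \<noteq> f i} \<subseteq> {..<n}" and "card {i. g i \<noteq> f i} \<le> c"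
    and "\<And>i. g i \<noteq> f i \<Longrightarrow> g i < b"
  shows "g \<in> mods n b c f"
  using assms
proof (induction c arbitrary: f)
  case 0
  have "finite {i. g i \<noteq> f i}" using 0(1) finite_subset by blast
  then have "{i. g i \<noteq> f i} = {}" using 0(2) by simp
  then have "g = f" by auto
  then show ?case by simp
next
  case (Suc c)
  show ?case
  proof (cases "g = f")
    case False
    then obtain i where i: "g i \<noteq> f i" by auto
    have fin: "finite {i. g i \<noteq> f i}" using Suc.prems(1) finite_subset by blast
    have eq: "{j. g j \<noteq> (f(i := g i)) j} = {j. g j \<noteq> f j} - {i}" by auto
    have "g \<in> mods n b c (f(i := g i))"
    proof (rule Suc.IH)
      show "card {j. g j \<noteq> (f(i := g i)) j} \<le> c"
        unfolding eq using Suc.prems(2) fin i by simp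
      show "{j. g j \<noteq> (f(i := g i)) j} \<subseteq> {..<n}" unfolding eq using Suc.prems(1) by blast
      show "g j < b" if "g j \<noteq> (f(i := g i)) j" for j
        using that Suc.prems(3)[of j] by (cases "j = i") auto
    qed
    moreover have "i < n" "g i < b" using Suc.prems(1,3) i by auto
    ultimately show ?thesis by auto
  qed simp
qed

text \<open>Array 7 holds the function that is varied, array 30 tells whether the current one satisfies \<open>\<phi>\<close>. Once
it does, all remaining rounds are skipped and the function is kept; otherwise each update is undone
with the help of the saved value. The recursion on \<open>c\<close> nests loops, so each level has its own three
variables.\<close>

primrec search :: "fm \<Rightarrow> nat \<Rightarrow> nat \<Rightarrow> com" where
  "search \<phi> b 0 = test \<phi> 30"
| "search \<phi> b (Suc c) = Seq (test \<phi> 30)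
     (For (100 + 3 * c) 2 (Cond (Less (var 30) (Num 1))
       (For (101 + 3 * c) b (Cond (Less (var 30) (Num 1))
         (Seq (assign (102 + 3 * c) (Read 7 (var (100 + 3 * c))))
         (Seq (Write 7 (var (100 + 3 * c)) (var (101 + 3 * c)))
         (Seq (search \<phi> b c)
           (Cond (Less (var 30) (Num 1)) (Write 7 (var (100 + 3 * c)) (var (102 + 3 * c))) Skip))))
         Skip))
       Skip))"

text \<open>Frame condition of a search: apart from array 7, whose contents are described separately, only
cells with index 0 change.\<close>

definition frame7 :: "nat set \<Rightarrow> state \<Rightarrow> state \<Rightarrow> bool" where
  "frame7 W s s' \<longleftrightarrow> (\<forall>a d. a \<noteq> 7 \<and> (a \<notin> W \<or> d \<noteq> 0) \<longrightarrow> s' a d = s a d)"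

lemma frame7_eq: "frame7 W s s' \<Longrightarrow> a \<noteq> 7 \<Longrightarrow> a \<notin> W \<Longrightarrow> s' a = s a"
  unfolding frame7_def by (simp add: fun_eq_iff)

lemma frame7_cell: "frame7 W s s' \<Longrightarrow> a \<noteq> 7 \<Longrightarrow> d \<noteq> 0 \<Longrightarrow> s' a d = s a d"
  unfolding frame7_def by simp

lemma frame7_trans: "frame7 W s s' \<Longrightarrow> frame7 W' s' s'' \<Longrightarrow> W \<union> W' \<subseteq> W'' \<Longrightarrow> frame7 W'' s s''"
  unfolding frame7_def by (metis UnI1 UnI2 subsetD)

lemma frame7_mono: "frame7 W s s' \<Longrightarrow> W \<subseteq> W' \<Longrightarrow> frame7 W' s s'"
  unfolding frame7_def by blast

lemma frame7_refl: "frame7 W s s"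
  unfolding frame7_def by simp

lemma frame7_set_var: "frame7 W s s' \<Longrightarrow> a \<in> W \<Longrightarrow> frame7 W s (set_var s' a v)"
  unfolding frame7_def by auto

lemma frame0_frame7: "frame0 W s s' \<Longrightarrow> frame7 W s s'"
  unfolding frame0_def frame7_def by auto

lemma sem_frame7:
  assumes "frame7 W s s'" "W \<inter> (fv \<phi> - {7}) = {}"
  shows "sem \<phi> (s'(7 := g)) = sem \<phi> (s(7 := g))"
proof (rule sem_cong)
  show "(s'(7 := g)) a = (s(7 := g)) a" if "a \<in> fv \<phi>" for a
    using frame7_eq[OF assms(1), of a] assms(2) that by auto
  show "(s'(7 := g)) a d = (s(7 := g)) a d" if "a \<in> bnd \<phi>" "d \<noteq> 0" for a d
    using frame7_cell[OF assms(1), of a d] that by auto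
qed

definition search_result :: "fm \<Rightarrow> (nat \<Rightarrow> nat) set \<Rightarrow> state \<Rightarrow> state \<Rightarrow> bool" where
  "search_result \<phi> G s s' \<longleftrightarrow>
     s' 30 0 = 0 \<and> s' 7 = s 7 \<and> (\<forall>g\<in>G. \<not> sem \<phi> (s(7 := g))) \<or>
     s' 30 0 = 1 \<and> s' 7 \<in> G \<and> sem \<phi> (s(7 := s' 7))"

text \<open>Both loops of one level of the search have this form; they differ in the family \<open>G\<close> of candidates that
the body tries.\<close>

lemma spec_search_loop:
  assumes body: "spec (\<lambda>s. Pre s \<and> s 30 0 = 0) body (\<lambda>s s'. frame7 W s s' \<and> search_result \<phi> (G s (s i 0)) s s')"
    and W: "writes body \<subseteq> W" "i \<notin> W" "b \<notin> W" "2 \<notin> W" "W \<inter> (fv \<phi> - {7}) = {}"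
    and ib: "i \<notin> fv \<phi>" "i \<noteq> 7" "b \<noteq> i" "i \<noteq> 2" "i \<noteq> 30"
    and Pre: "\<And>s s'. Pre s \<Longrightarrow> frame7 (insert i W) s s' \<Longrightarrow> Pre s'"
    and G: "\<And>s s' j. frame7 (insert i W) s s' \<Longrightarrow> s' 7 = s 7 \<Longrightarrow> G s' j = G s j"
    and bound: "\<And>s. Pre s \<Longrightarrow> s b 0 \<le> poly q (s 2 0)"
  shows "spec Pre (For i b (Cond (Less (var 30) (Num 1)) body Skip))
    (\<lambda>s s'. frame7 (insert i W) s s' \<and>
      (if s 30 0 = 0 then search_result \<phi> (\<Union>j<s b 0. G s j) s s' else s' 30 0 = s 30 0 \<and> s' 7 = s 7))"
proof -
  let ?c = "Cond (Less (var 30) (Num 1)) body Skip"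
  have c: "spec Pre ?c (\<lambda>s s'. if s 30 0 = 0 then frame7 W s s' \<and> search_result \<phi> (G s (s i 0)) s s' else s' = s)"
    by (rule spec_Cond; rule spec_weaken, rule body spec_Skip) auto
  have wc: "writes ?c \<subseteq> W" using W by simp
  have disj: "insert i W \<inter> (fv \<phi> - {7}) = {}" using W ib by auto
  show ?thesis
  proof (rule spec_For[OF c, where q = q and
        I = "\<lambda>s j s'. frame7 (insert i W) s s' \<and>
          (if s 30 0 = 0 then search_result \<phi> (\<Union>j'<j. G s j') s s' else s' 30 0 = s 30 0 \<and> s' 7 = s 7)"], goal_cases)
    case (9 s j s' s'')
    have fr: "frame7 (insert i W) s s'"
      and res: "if s 30 0 = 0 then search_result \<phi> (\<Union>j'<j. G s j') s s' else s' 30 0 = s 30 0 \<and> s' 7 = s 7"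
      using 9 by auto
    let ?t = "set_var s'' i (Suc j)"
    have t: "?t 30 = s'' 30" "?t 7 = s'' 7" using ib by auto
    have Un: "(\<Union>j'<Suc j. G s j') = G s j \<union> (\<Union>j'<j. G s j')" by (simp add: lessThan_Suc)
    show ?case
    proof (cases "s' 30 0 = 0")
      case False
      then have "s'' = s'" using 9 by auto
      then have "frame7 (insert i W) s ?t" using fr by (auto intro: frame7_set_var)
      moreover have "if s 30 0 = 0 then search_result \<phi> (\<Union>j'<Suc j. G s j') s ?t else ?t 30 0 = s 30 0 \<and> ?t 7 = s 7"
        using res False t \<open>s'' = s'\<close> unfolding search_result_def Un by auto
      ultimately show ?thesis by blast
    next
      case True
      then have f2: "frame7 W s' s''" and r2: "search_result \<phi> (G s' j) s' s''" using 9 by auto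
      have s0: "s 30 0 = 0" using res True by (auto split: if_splits)
      then have s7: "s' 7 = s 7" and none: "\<forall>g\<in>(\<Union>j'<j. G s j'). \<not> sem \<phi> (s(7 := g))"
        using res True unfolding search_result_def by auto
      have "frame7 (insert i W) s s''" by (rule frame7_trans[OF fr f2]) auto
      then have "frame7 (insert i W) s ?t" by (auto intro: frame7_set_var)
      moreover have "search_result \<phi> (G s j) s s''"
        using r2 unfolding search_result_def sem_frame7[OF fr disj] G[OF fr s7] s7 .
      then have "search_result \<phi> (\<Union>j'<Suc j. G s j') s ?t"
        using none unfolding search_result_def t Un by auto
      ultimately show ?thesis using s0 by simp
    qed
  next
    case (7 s)
    then show ?case using ib by (auto simp: search_result_def intro: frame7_set_var frame7_refl)
  next
    case (8 s j s')
    then show ?case using Pre by blast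
  qed (use W wc ib bound in auto)
qed

lemma spec_Seq_simple:
  assumes "spec P c Q" "spec P' d Q'" "2 \<notin> writes c"
    and "\<And>s s'. P s \<Longrightarrow> Q s s' \<Longrightarrow> frame (writes c) s s' \<Longrightarrow> P' s'"
  shows "spec P (Seq c d) (\<lambda>s s''. \<exists>s'. Q s s' \<and> Q' s' s'')"
  by (rule spec_Seq[OF assms]) auto

lemma writes_search: "writes (search \<phi> b c) \<subseteq> insert 7 (writes (test \<phi> 30) \<union> {30} \<union> {100..<100 + 3 * c})"
  by (induction c) auto

text \<open>The functions that one level reaches are those of the deeper level after one update, and its two loops
run through all updates.\<close>

lemma spec_search:
  assumes \<phi>: "clean \<phi>" "\<And>a. a \<in> fv \<phi> \<union> bnd \<phi> \<Longrightarrow> a < 30" "2 \<notin> bnd \<phi>" "7 \<notin> bnd \<phi>" "size \<phi> < 70"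
    "bnd \<phi> \<inter> fv \<phi> = {}"
    and b: "b < 30" "b \<noteq> 7" "b \<notin> bnd \<phi>"
  shows "spec (\<lambda>s. s b 0 \<le> poly q (s 2 0)) (search \<phi> b c)
    (\<lambda>s s'. frame7 (writes (search \<phi> b c) \<union> {30}) s s' \<and> search_result \<phi> (mods (s 2 0) (s b 0) c (s 7)) s s')"
proof (induction c)
  case 0
  have wt: "writes (test \<phi> 30) \<subseteq> bnd \<phi> \<union> {30..<100}" using writes_test[of \<phi> 30] \<phi>(5) by auto
  have 7: "7 \<notin> writes (test \<phi> 30)" using wt \<phi>(4) by auto
  show ?case unfolding search.simps mods.simps
  proof (rule spec_weaken[OF spec_test[of \<phi> 30]], goal_cases)
    case (6 s s')
    then have "s' 7 = s 7" using frame0_eq[of _ s s' 7] 7 by blast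
    moreover have "frame7 (writes (test \<phi> 30) \<union> {30}) s s'"
      by (rule frame7_mono[OF frame0_frame7]) (use 6 in auto)
    ultimately show ?case using 6 unfolding search_result_def by (auto simp: fun_upd_idem)
  qed (use \<phi> in auto)
next
  case (Suc c)
  have wt: "writes (test \<phi> 30) \<subseteq> bnd \<phi> \<union> {30..<100}" using writes_test[of \<phi> 30] \<phi>(5) by auto
  let ?i = "100 + 3 * c" and ?j = "101 + 3 * c" and ?k = "102 + 3 * c"
  let ?V = "insert 30 (writes (search \<phi> b c))"
  let ?W = "insert ?k ?V"
  have V: "a \<in> insert 7 (bnd \<phi> \<union> {30..<100 + 3 * c})" if "a \<in> ?V" for a
    using that writes_search[of \<phi> b c] wt by fastforce
  have big: "a \<notin> ?V" if "a \<ge> 100 + 3 * c" for a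
    using V[of a] that \<phi>(2)[of a] by auto
  have fvV: "?V \<inter> (fv \<phi> - {7}) = {}"
    using V \<phi>(2,6) by fastforce
  have low: "a \<notin> ?V" if "a < 30" "a \<noteq> 7" "a \<notin> bnd \<phi>" for a
    using V[of a] that by auto
  have k: "?k \<notin> fv \<phi>" using \<phi>(2)[of ?k] by auto
  have fvW: "?W \<inter> (fv \<phi> - {7}) = {}" using fvV k by auto
  let ?restore = "Cond (Less (var 30) (Num 1)) (Write 7 (var ?i) (var ?k)) Skip"
  let ?attempt = "Seq (assign ?k (Read 7 (var ?i))) (Seq (Write 7 (var ?i) (var ?j)) (Seq (search \<phi> b c) ?restore))"
  let ?P = "\<lambda>s. s b 0 \<le> poly q (s 2 0)"
  have restore: "spec (\<lambda>s. True) ?restore (\<lambda>s s'. s' = (if s 30 0 = 0 then s(7 := (s 7)(s ?i 0 := s ?k 0)) else s))"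
    by (rule spec_Cond; rule spec_weaken, rule spec_Write spec_Skip) auto
  have bk: "b \<noteq> ?k" "b \<noteq> ?j" "b \<noteq> ?i" "2 \<noteq> b \<or> 2 = b" using b by auto
  have attempt: "spec ?P ?attempt (\<lambda>s s''. \<exists>r. r = set_var s ?k (s 7 (s ?i 0)) \<and>
     (\<exists>r'. r' = r(7 := (r 7)(r ?i 0 := r ?j 0)) \<and>
     (\<exists>s'. (frame7 (writes (search \<phi> b c) \<union> {30}) r' s' \<and> search_result \<phi> (mods (r' 2 0) (r' b 0) c (r' 7)) r' s') \<and>
       s'' = (if s' 30 0 = 0 then s'(7 := (s' 7)(s' ?i 0 := s' ?k 0)) else s'))))"
  proof -
    have w1: "spec ?P (assign ?k (Read 7 (var ?i))) (\<lambda>s r. r = set_var s ?k (s 7 (s ?i 0)))"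
      by (rule spec_weaken[OF spec_Write]) auto
    have w2: "spec ?P (Write 7 (var ?i) (var ?j)) (\<lambda>r r'. r' = r(7 := (r 7)(r ?i 0 := r ?j 0)))"
      by (rule spec_weaken[OF spec_Write]) auto
    have 2: "2 \<notin> writes (search \<phi> b c)" using low[of 2] \<phi>(3) by auto
    show ?thesis
      by (rule spec_Seq_simple[OF w1 spec_Seq_simple[OF w2 spec_Seq_simple[OF Suc.IH restore 2]]])
        (use b in auto)
  qed
  have attempt_result: "frame7 ?W s s'' \<and> search_result \<phi> (mods (s 2 0) (s b 0) c ((s 7)(s ?i 0 := s ?j 0))) s s''"
    if r: "r = set_var s ?k (s 7 (s ?i 0))" and r': "r' = r(7 := (r 7)(r ?i 0 := r ?j 0))"
    and fr: "frame7 (writes (search \<phi> b c) \<union> {30}) r' s'"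
    and res: "search_result \<phi> (mods (r' 2 0) (r' b 0) c (r' 7)) r' s'"
    and s'': "s'' = (if s' 30 0 = 0 then s'(7 := (s' 7)(s' ?i 0 := s' ?k 0)) else s')" for s r r' s' s''
  proof -
    have f1: "frame7 {?k} s r'" unfolding r r' frame7_def by auto
    have f2: "frame7 ?W s s'" by (rule frame7_trans[OF f1 fr]) auto
    then have f3: "frame7 ?W s s''" unfolding s'' frame7_def by auto
    have r7: "r' 7 = (s 7)(s ?i 0 := s ?j 0)" "r' 2 = s 2" "r' b = s b" unfolding r r' using b by auto
    have semr: "sem \<phi> (r'(7 := g)) = sem \<phi> (s(7 := g))" for g
      by (rule sem_frame7[OF f1]) (use k in auto)
    have ik: "s' ?i = r' ?i" "s' ?k = r' ?k"
      using frame7_eq[OF fr, of ?i] frame7_eq[OF fr, of ?k] big[of ?i] big[of ?k] by auto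
    have "s'' 7 = s 7" if "s' 30 0 = 0"
    proof -
      have "s' 7 = r' 7" using res that unfolding search_result_def by auto
      then show ?thesis unfolding s'' using that ik by (simp add: r r')
    qed
    then have "search_result \<phi> (mods (s 2 0) (s b 0) c ((s 7)(s ?i 0 := s ?j 0))) s s''"
      using res unfolding search_result_def semr r7 s'' by auto
    then show ?thesis using f3 by blast
  qed
  have body: "spec (\<lambda>s. ?P s \<and> s 30 0 = 0) ?attempt
    (\<lambda>s s'. frame7 ?W s s' \<and> search_result \<phi> (mods (s 2 0) (s b 0) c ((s 7)(s ?i 0 := s ?j 0))) s s')"
    by (rule spec_weaken[OF attempt]) (use attempt_result in blast)+
  have wattempt: "writes ?attempt \<subseteq> insert 7 ?W" by auto
  let ?inner = "For ?j b (Cond (Less (var 30) (Num 1)) ?attempt Skip)"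
  have inner: "spec ?P ?inner (\<lambda>s s'. frame7 (insert ?j (insert 7 ?W)) s s' \<and>
      (if s 30 0 = 0 then search_result \<phi> (\<Union>v<s b 0. mods (s 2 0) (s b 0) c ((s 7)(s ?i 0 := v))) s s'
       else s' 30 0 = s 30 0 \<and> s' 7 = s 7))"
  proof (rule spec_search_loop[where W = "insert 7 ?W" and q = q], goal_cases)
    case 1
    show ?case by (rule spec_weaken[OF body]) (auto intro: frame7_mono)
  next
    case (12 s s')
    then show ?case
      using frame7_eq[of "insert ?j (insert 7 ?W)" s s' b] frame7_eq[of "insert ?j (insert 7 ?W)" s s' 2]
        low[of b] low[of 2] b \<phi>(3) by auto
  next
    case (13 s s' v)
    then show ?case
      using frame7_eq[of "insert ?j (insert 7 ?W)" s s' b] frame7_eq[of "insert ?j (insert 7 ?W)" s s' 2]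
        frame7_eq[of "insert ?j (insert 7 ?W)" s s' ?i] big[of ?i]
        low[of b] low[of 2] b \<phi>(3) by auto
  qed (use wattempt big[of ?j] low[of 2] low[of b] b \<phi>(2)[of ?j] \<phi>(3) fvW in auto)
  let ?W' = "insert ?j (insert 7 ?W)"
  let ?outer = "For ?i 2 (Cond (Less (var 30) (Num 1)) ?inner Skip)"
  have outer: "spec ?P ?outer (\<lambda>s s'. frame7 (insert ?i ?W') s s' \<and>
      (if s 30 0 = 0 then search_result \<phi> (\<Union>i<s 2 0. \<Union>v<s b 0. mods (s 2 0) (s b 0) c ((s 7)(i := v))) s s'
       else s' 30 0 = s 30 0 \<and> s' 7 = s 7))"
  proof (rule spec_search_loop[where W = "?W'" and q = "[:0, 1:]"], goal_cases)
    case 1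
    show ?case by (rule spec_weaken[OF inner]) auto
  next
    case (12 s s')
    then show ?case
      using frame7_eq[of "insert ?i ?W'" s s' b] frame7_eq[of "insert ?i ?W'" s s' 2]
        low[of b] low[of 2] b \<phi>(3) by auto
  next
    case (13 s s' v)
    then show ?case
      using frame7_eq[of "insert ?i ?W'" s s' b] frame7_eq[of "insert ?i ?W'" s s' 2]
        low[of b] low[of 2] b \<phi>(3) by auto
  qed (use wattempt big[of ?i] low[of 2] b \<phi>(2)[of ?i] \<phi>(2)[of ?j] \<phi>(3) fvW in auto)
  have 7: "7 \<notin> writes (test \<phi> 30)" "2 \<notin> writes (test \<phi> 30)" "b \<notin> writes (test \<phi> 30)"
    using wt \<phi>(3,4) b by auto
  have fvt: "writes (test \<phi> 30) \<inter> (fv \<phi> - {7}) = {}" using wt \<phi>(2,6) by fastforce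
  have t0: "spec ?P (test \<phi> 30)
    (\<lambda>s s'. s' 30 0 = of_bool (sem \<phi> s) \<and> frame0 (writes (test \<phi> 30)) s s')"
    by (rule spec_weaken[OF spec_test]) (use \<phi> in auto)
  show ?case unfolding search.simps
  proof (rule spec_Seq[OF t0 outer 7(2)], goal_cases)
    case (1 s s')
    then show ?case using 7 by (metis frameD)
  next
    case (2 s s' s'')
    let ?M = "\<Union>i<s 2 0. \<Union>v<s b 0. mods (s 2 0) (s b 0) c ((s 7)(i := v))"
    have f1: "frame7 (writes (test \<phi> 30)) s s'" and F: "s' 30 0 = of_bool (sem \<phi> s)"
      using 2 frame0_frame7 by blast+
    have eq: "s' 7 = s 7" "s' 2 = s 2" "s' b = s b" using 2 7 by (metis frameD)+
    have f2: "frame7 (insert ?i ?W') s' s''" using 2 by blast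
    have "frame7 (writes (search \<phi> b (Suc c)) \<union> {30}) s s''"
      by (rule frame7_trans[OF f1 f2]) auto
    moreover have "search_result \<phi> (insert (s 7) ?M) s s''"
    proof (cases "sem \<phi> s")
      case True
      then have "s'' 30 0 = 1" "s'' 7 = s 7" using 2 F eq by auto
      then show ?thesis using True unfolding search_result_def by (simp add: fun_upd_idem)
    next
      case False
      then have "search_result \<phi> ?M s' s''" using 2 F eq by auto
      then have "search_result \<phi> ?M s s''"
        unfolding search_result_def sem_frame7[OF f1 fvt] eq .
      then show ?thesis using False unfolding search_result_def by (auto simp: fun_upd_idem)
    qed
    ultimately show ?case by simp
  qed
qed

section \<open>The colouring program\<close>

text \<open>The algorithm uses the memory as follows. Array 0 holds the word with the adjacency matrix, array 1
its length, array 2 the number \<open>n\<close> of vertices and array 3 the number \<open>k\<close> of colours. Array 4 holds the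
offsets of the matrix rows and array 8 the position after the matrix; with them, no multiplication
is necessary. Array 5 is the characteristic vector of the vertices of the current induced
subgraph, array 6 the composition of all folds found so far, and array 7 the candidate for a fold or a
colouring. Arrays 9, 10 and 11 are loop counters, 15 holds the verdict of the verifier, 16 and 17 are the
bound variables of formulas, and 30 and above belong to tests and searches.\<close>

definition Im :: "fm \<Rightarrow> fm \<Rightarrow> fm" where "Im \<phi> \<psi> = Nt (Cj \<phi> (Nt \<psi>))"
definition Ex :: "nat \<Rightarrow> fm \<Rightarrow> fm" where "Ex i \<phi> = Nt (All i (Nt \<phi>))"
definition Equal :: "aexp \<Rightarrow> aexp \<Rightarrow> fm" where
  "Equal e e' = Cj (Nt (At (Less e e'))) (Nt (At (Less e' e)))"

lemma sem_derived [simp]: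
  "sem (Im \<phi> \<psi>) s \<longleftrightarrow> (sem \<phi> s \<longrightarrow> sem \<psi> s)"
  "sem (Ex i \<phi>) s \<longleftrightarrow> (\<exists>j<s 2 0. sem \<phi> (set_var s i j))"
  "sem (Equal e e') s \<longleftrightarrow> aval e s = aval e' s"
  unfolding Im_def Ex_def Equal_def by auto

abbreviation Selected :: "aexp \<Rightarrow> fm" where "Selected e \<equiv> At (Less (Num 0) (Read 5 e))"
abbreviation Adjacent :: "aexp \<Rightarrow> aexp \<Rightarrow> fm" where
  "Adjacent e e' \<equiv> At (Less (Num 0) (Read 0 (Plus (Read 4 e) e')))"
abbreviation Rep :: "nat \<Rightarrow> aexp" where "Rep i \<equiv> Read 6 (var i)"
abbreviation Img :: "nat \<Rightarrow> aexp" where "Img i \<equiv> Read 7 (Rep i)"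

text \<open>The core is the image of the selected vertices under array 6. The three parts say that array 7 is a
homomorphism on the core, that it maps the core to itself, and that it misses a vertex of the core.\<close>

definition fold_fm :: fm where
  "fold_fm =
     Cj (All 16 (All 17 (Im (Cj (Selected (var 16)) (Cj (Selected (var 17)) (Adjacent (Rep 16) (Rep 17))))
          (Adjacent (Img 16) (Img 17)))))
    (Cj (All 16 (Im (Selected (var 16)) (Ex 17 (Cj (Selected (var 17)) (Equal (Img 16) (Rep 17))))))
        (Ex 17 (Cj (Selected (var 17)) (All 16 (Im (Selected (var 16)) (Nt (Equal (Img 16) (Rep 17))))))))"

definition colouring_fm :: fm where
  "colouring_fm =
     Cj (All 16 (Im (Selected (var 16)) (At (Less (Img 16) (var 3)))))
        (All 16 (All 17 (Im (Cj (Selected (var 16)) (Cj (Selected (var 17)) (Adjacent (Rep 16) (Rep 17))))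
          (Nt (Equal (Img 16) (Img 17))))))"

definition copy_loop :: "nat \<Rightarrow> aexp \<Rightarrow> com" where
  "copy_loop a e = For 9 2 (Write a (var 9) e)"

definition collapse :: "nat \<Rightarrow> com" where
  "collapse c = Seq (copy_loop 7 (var 9)) (Seq (search fold_fm 2 c)
     (Cond (Less (var 30) (Num 1)) Skip (copy_loop 6 (Read 7 (Rep 9)))))"

text \<open>Each successful round makes the core smaller, so as many rounds as there are vertices suffice. After
that, the colourings that differ from the constant one on at most \<open>m\<close> vertices are tried.\<close>

definition colour :: "nat \<Rightarrow> nat \<Rightarrow> com" where
  "colour c m = Seq (copy_loop 6 (var 9)) (Seq (For 10 2 (collapse c))
     (Seq (copy_loop 7 (Num 0)) (search colouring_fm 3 m)))"

definition vset :: "state \<Rightarrow> nat set" where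
  "vset s = {u. u < s 2 0 \<and> 0 < s 5 u}"

definition edge :: "state \<Rightarrow> nat \<Rightarrow> nat \<Rightarrow> bool" where
  "edge s u v \<longleftrightarrow> u \<in> vset s \<and> v \<in> vset s \<and> 0 < s 0 (s 4 u + v)"

definition same_graph :: "state \<Rightarrow> state \<Rightarrow> bool" where
  "same_graph s s' \<longleftrightarrow> (\<forall>a\<in>{0, 2, 3, 4, 5}. s' a = s a)"

lemma same_graph_eq: "same_graph s s' \<Longrightarrow> vset s' = vset s \<and> edge s' = edge s \<and> s' 2 = s 2 \<and> s' 3 = s 3"
  unfolding same_graph_def vset_def edge_def by (auto simp: fun_eq_iff)

lemma same_graph_trans: "same_graph s s' \<Longrightarrow> same_graph s' s'' \<Longrightarrow> same_graph s s''"
  unfolding same_graph_def by simp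

lemma same_graph_frame: "frame W s s' \<Longrightarrow> W \<inter> {0, 2, 3, 4, 5} = {} \<Longrightarrow> same_graph s s'"
  unfolding same_graph_def frame_def by blast

lemma ball_vset: "(\<forall>u\<in>vset s. Q u) \<longleftrightarrow> (\<forall>u<s 2 0. 0 < s 5 u \<longrightarrow> Q u)"
  and bex_vset: "(\<exists>u\<in>vset s. Q u) \<longleftrightarrow> (\<exists>u<s 2 0. 0 < s 5 u \<and> Q u)"
  unfolding vset_def by auto

lemma sem_fold_fm:
  "sem fold_fm s \<longleftrightarrow>
     (\<forall>u\<in>vset s. \<forall>v\<in>vset s. 0 < s 0 (s 4 (s 6 u) + s 6 v) \<longrightarrow>
        0 < s 0 (s 4 (s 7 (s 6 u)) + s 7 (s 6 v))) \<and>
     (\<forall>u\<in>vset s. \<exists>z\<in>vset s. s 7 (s 6 u) = s 6 z) \<and>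
     (\<exists>z\<in>vset s. \<forall>u\<in>vset s. s 7 (s 6 u) \<noteq> s 6 z)"
  unfolding fold_fm_def ball_vset bex_vset by simp blast

lemma sem_colouring_fm:
  "sem colouring_fm s \<longleftrightarrow>
     (\<forall>u\<in>vset s. s 7 (s 6 u) < s 3 0) \<and>
     (\<forall>u\<in>vset s. \<forall>v\<in>vset s. 0 < s 0 (s 4 (s 6 u) + s 6 v) \<longrightarrow> s 7 (s 6 u) \<noteq> s 7 (s 6 v))"
  unfolding colouring_fm_def ball_vset by simp blast

text \<open>The expression may read the counter and the cell of the target that is about to be overwritten.\<close>

lemma spec_copy_loop:
  assumes "a \<noteq> 2" "a \<noteq> 9" and e: "\<And>s s'. (\<And>b. b \<noteq> a \<Longrightarrow> s' b = s b) \<Longrightarrow> s' a (s 9 0) = s a (s 9 0) \<Longrightarrow> aval e s' = aval e s"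
  shows "spec (\<lambda>s. True) (copy_loop a e)
    (\<lambda>s s'. s' a = (\<lambda>i. if i < s 2 0 then aval e (set_var s 9 i) else s a i))"
  unfolding copy_loop_def
proof (rule spec_For[OF spec_Write, where q = "[:0, 1:]" and
    I = "\<lambda>s j s'. s' a = (\<lambda>i. if i < j then aval e (set_var s 9 i) else s a i) \<and> (\<forall>i\<noteq>0. s' 9 i = s 9 i)"], goal_cases)
  case (9 s j s' s'')
  have I: "s' a = (\<lambda>i. if i < j then aval e (set_var s 9 i) else s a i)" "\<forall>i\<noteq>0. s' 9 i = s 9 i"
    using 9(2) by blast+
  have s'': "s'' = s'(a := (s' a)(j := aval e s'))" using 9(4,6) by simp
  have "s' b = (set_var s 9 j) b" if "b \<noteq> a" for b
  proof (cases "b = 9")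
    case True
    have "s' 9 = (s 9)(0 := j)" using I(2) 9(4) by (intro ext) simp
    then show ?thesis using True by simp
  next
    case False
    then show ?thesis using frameD[OF 9(5), of b] that by simp
  qed
  moreover have "s' a j = s a j" using I(1) by simp
  ultimately have "aval e s' = aval e (set_var s 9 j)"
    using e[of s' "set_var s 9 j"] assms(2) by simp
  then have "(s' a)(j := aval e s') = (\<lambda>i. if i < Suc j then aval e (set_var s 9 i) else s a i)"
    unfolding I(1) by (intro ext) (simp add: less_Suc_eq)
  then show ?case unfolding s'' using assms(2) I(2) by simp
next
  case (7 s)
  then show ?case using assms(1,2) by simp
qed (use assms(1,2) in simp_all)

lemma algorithm_fm_ok:
  "clean fold_fm" "bnd fold_fm = {16, 17}" "fv fold_fm = {0, 2, 4, 5, 6, 7}" "size fold_fm < 70"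
  "clean colouring_fm" "bnd colouring_fm = {16, 17}" "fv colouring_fm = {0, 2, 3, 4, 5, 6, 7}" "size colouring_fm < 70"
  unfolding fold_fm_def colouring_fm_def Im_def Ex_def Equal_def by auto

lemma writes_search_bounds:
  "a \<in> writes (search fold_fm b c) \<Longrightarrow> a = 7 \<or> a = 16 \<or> a = 17 \<or> 30 \<le> a"
  "a \<in> writes (search colouring_fm b c) \<Longrightarrow> a = 7 \<or> a = 16 \<or> a = 17 \<or> 30 \<le> a"
  using writes_search[of fold_fm b c] writes_search[of colouring_fm b c] writes_test[of fold_fm 30]
    writes_test[of colouring_fm 30] algorithm_fm_ok by fastforce+

lemma spec_search_fold:
  "spec (\<lambda>s. True) (search fold_fm 2 c)
     (\<lambda>s s'. search_result fold_fm (mods (s 2 0) (s 2 0) c (s 7)) s s')"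
  by (rule spec_weaken[OF spec_search[of fold_fm 2 "[:0, 1:]" c]]) (use algorithm_fm_ok in auto)

lemma spec_search_colouring:
  "spec (\<lambda>s. s 3 0 = k) (search colouring_fm 3 c)
     (\<lambda>s s'. search_result colouring_fm (mods (s 2 0) k c (s 7)) s s')"
  by (rule spec_weaken[OF spec_search[of colouring_fm 3 "[:k:]" c]]) (use algorithm_fm_ok in auto)

text \<open>Array 6 is an endomorphism of the selected subgraph.\<close>

definition rep_ok :: "state \<Rightarrow> bool" where
  "rep_ok s \<longleftrightarrow> (\<forall>u\<in>vset s. s 6 u \<in> vset s) \<and> (\<forall>u v. edge s u v \<longrightarrow> edge s (s 6 u) (s 6 v))"

definition core :: "state \<Rightarrow> nat set" where
  "core s = s 6 ` vset s"

definition stuck :: "nat \<Rightarrow> state \<Rightarrow> bool" where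
  "stuck c s \<longleftrightarrow> \<not> has_fold (core s) (\<lambda>u v. u \<in> core s \<and> v \<in> core s \<and> edge s u v) c"

lemma modsD: "g \<in> mods n b c f \<Longrightarrow> finite {i. g i \<noteq> f i} \<and> card {i. g i \<noteq> f i} \<le> c"
proof (induction c arbitrary: f)
  case (Suc c)
  show ?case
  proof (cases "g = f")
    case False
    then obtain i v where "g \<in> mods n b c (f(i := v))" using Suc.prems by auto
    then have IH: "finite {j. g j \<noteq> (f(i := v)) j}" "card {j. g j \<noteq> (f(i := v)) j} \<le> c"
      using Suc.IH by blast+
    have sub: "{j. g j \<noteq> f j} \<subseteq> insert i {j. g j \<noteq> (f(i := v)) j}" by auto
    have "finite (insert i {j. g j \<noteq> (f(i := v)) j})" using IH(1) by simp
    moreover have "card (insert i {j. g j \<noteq> (f(i := v)) j}) \<le> Suc c"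
      by (rule card_insert_le_m1) (use IH(2) in simp_all)
    ultimately show ?thesis using sub by (meson card_mono finite_subset order_trans)
  qed simp
qed simp

lemma finite_vset: "finite (vset s)"
  unfolding vset_def by simp

abbreviation core_edge :: "state \<Rightarrow> nat \<Rightarrow> nat \<Rightarrow> bool" where
  "core_edge s \<equiv> \<lambda>u v. u \<in> core s \<and> v \<in> core s \<and> edge s u v"

text \<open>A fold of the core differs from the identity on at most \<open>c\<close> core vertices, so the search encounters it.\<close>

lemma has_fold_sem:
  assumes rep: "rep_ok s" and F: "\<And>i. i < s 2 0 \<Longrightarrow> s 7 i = i" and fold: "has_fold (core s) (core_edge s) c"
  shows "\<exists>g\<in>mods (s 2 0) (s 2 0) c (s 7). sem fold_fm (s(7 := g))"
proof -
  obtain r where r: "r ` core s \<subset> core s" "\<And>u v. core_edge s u v \<Longrightarrow> core_edge s (r u) (r v)"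
    "card {u \<in> core s. r u \<noteq> u} \<le> c"
    using fold unfolding has_fold_def by blast
  have sub: "core s \<subseteq> vset s" using rep unfolding core_def rep_ok_def by blast
  have lt: "u < s 2 0" if "u \<in> core s" for u using sub that unfolding vset_def by blast
  define g where "g = (\<lambda>u. if u \<in> core s then r u else s 7 u)"
  have diff: "{u. g u \<noteq> s 7 u} = {u \<in> core s. r u \<noteq> u}" unfolding g_def using F lt by auto
  have "g \<in> mods (s 2 0) (s 2 0) c (s 7)"
  proof (rule modsI)
    show "g u < s 2 0" if "g u \<noteq> s 7 u" for u
    proof -
      have "u \<in> core s" using that unfolding g_def by (auto split: if_splits)
      then have "g u \<in> core s" using r(1) unfolding g_def by auto
      then show ?thesis by (rule lt)
    qed
    show "{u. g u \<noteq> s 7 u} \<subseteq> {..<s 2 0}" unfolding diff using lt by auto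
    show "card {u. g u \<noteq> s 7 u} \<le> c" unfolding diff by (rule r(3))
  qed
  moreover have "sem fold_fm (s(7 := g))"
  proof -
    have in_core: "s 6 u \<in> core s" if "u \<in> vset s" for u using that unfolding core_def by blast
    have g: "g (s 6 u) = r (s 6 u)" "g (s 6 u) \<in> core s" if "u \<in> vset s" for u
      using in_core[OF that] r(1) unfolding g_def by auto
    have v7: "vset (s(7 := g)) = vset s" unfolding vset_def by simp
    have "0 < s 0 (s 4 (g (s 6 u)) + g (s 6 v))"
      if "u \<in> vset s" "v \<in> vset s" "0 < s 0 (s 4 (s 6 u) + s 6 v)" for u v
    proof -
      have "core_edge s (s 6 u) (s 6 v)" using that in_core sub unfolding edge_def by blast
      from r(2)[OF this] show ?thesis using g that unfolding edge_def by simp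
    qed
    moreover have "\<exists>z\<in>vset s. g (s 6 u) = s 6 z" if "u \<in> vset s" for u
      using g(2)[OF that] unfolding core_def by blast
    moreover have "\<exists>z\<in>vset s. \<forall>u\<in>vset s. g (s 6 u) \<noteq> s 6 z"
    proof -
      obtain w where w: "w \<in> core s" "w \<notin> r ` core s" using r(1) by blast
      then obtain z where "z \<in> vset s" "w = s 6 z" unfolding core_def by blast
      then show ?thesis using w g(1) in_core by (metis imageI)
    qed
    ultimately show ?thesis unfolding sem_fold_fm v7 by simp
  qed
  ultimately show ?thesis by blast
qed

text \<open>Conversely, whatever the search finds is a fold of the core that moves at most \<open>c\<close> vertices.\<close>

lemma sem_has_fold:
  assumes rep: "rep_ok s" and F: "\<And>i. i < s 2 0 \<Longrightarrow> s 7 i = i"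
    and g: "g \<in> mods (s 2 0) (s 2 0) c (s 7)" "sem fold_fm (s(7 := g))"
  shows "g ` core s \<subset> core s" and "\<And>u v. core_edge s u v \<Longrightarrow> core_edge s (g u) (g v)"
    and "has_fold (core s) (core_edge s) c"
proof -
  have sub: "core s \<subseteq> vset s" using rep unfolding core_def rep_ok_def by blast
  have v7: "vset (s(7 := g)) = vset s" unfolding vset_def by simp
  have hom: "0 < s 0 (s 4 (g (s 6 u)) + g (s 6 v))"
    if "u \<in> vset s" "v \<in> vset s" "0 < s 0 (s 4 (s 6 u) + s 6 v)" for u v
    using g(2) that unfolding sem_fold_fm v7 by simp
  have closed: "g (s 6 u) \<in> core s" if "u \<in> vset s" for u
    using g(2) that unfolding sem_fold_fm v7 core_def by auto
  obtain z where z: "z \<in> vset s" "\<forall>u\<in>vset s. g (s 6 u) \<noteq> s 6 z"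
    using g(2) unfolding sem_fold_fm v7 by auto
  show proper: "g ` core s \<subset> core s"
  proof -
    have "g ` core s \<subseteq> core s" using closed unfolding core_def by auto
    moreover have "s 6 z \<in> core s" using z(1) unfolding core_def by blast
    moreover have "s 6 z \<notin> g ` core s" using z(2) unfolding core_def by auto
    ultimately show ?thesis by blast
  qed
  show E: "core_edge s (g u) (g v)" if uv: "core_edge s u v" for u v
  proof -
    obtain a b where ab: "a \<in> vset s" "b \<in> vset s" "u = s 6 a" "v = s 6 b"
      using uv unfolding core_def by blast
    then show ?thesis using hom[OF ab(1,2)] closed[OF ab(1)] closed[OF ab(2)] uv sub
      unfolding edge_def by blast
  qed
  have "{u \<in> core s. g u \<noteq> u} \<subseteq> {u. g u \<noteq> s 7 u}"
    using F sub unfolding vset_def by auto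
  then have "card {u \<in> core s. g u \<noteq> u} \<le> c" using modsD[OF g(1)] by (meson card_mono order_trans)
  then show "has_fold (core s) (core_edge s) c"
    unfolding has_fold_def using proper E by blast
qed

lemma rep_cong:
  assumes "same_graph s s'" "\<And>u. u \<in> vset s \<Longrightarrow> s' 6 u = s 6 u"
  shows "core s' = core s" "rep_ok s' = rep_ok s" "stuck c s' = stuck c s"
proof -
  have e: "vset s' = vset s" "edge s' = edge s" using same_graph_eq[OF assms(1)] by auto
  show c: "core s' = core s" unfolding core_def e using assms(2) by (intro image_cong) simp_all
  have E: "edge s (s' 6 u) (s' 6 v) \<longleftrightarrow> edge s (s 6 u) (s 6 v)" if "edge s u v" for u v
  proof -
    have uv: "u \<in> vset s" "v \<in> vset s" using that unfolding edge_def by blast+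
    show ?thesis unfolding assms(2)[OF uv(1)] assms(2)[OF uv(2)] ..
  qed
  have "(\<forall>u\<in>vset s. s' 6 u \<in> vset s) \<longleftrightarrow> (\<forall>u\<in>vset s. s 6 u \<in> vset s)"
    by (rule ball_cong) (simp_all only: assms(2))
  moreover have "(\<forall>u v. edge s u v \<longrightarrow> edge s (s' 6 u) (s' 6 v)) \<longleftrightarrow>
      (\<forall>u v. edge s u v \<longrightarrow> edge s (s 6 u) (s 6 v))"
    using E by blast
  ultimately show "rep_ok s' = rep_ok s" unfolding rep_ok_def e by blast
  show "stuck c s' = stuck c s" unfolding stuck_def c e ..
qed

lemma spec_copy7:
  assumes "\<And>s s'. (\<And>b. b \<noteq> 7 \<Longrightarrow> s' b = s b) \<Longrightarrow> s' 7 (s 9 0) = s 7 (s 9 0) \<Longrightarrow> aval e s' = aval e s"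
  shows "spec (\<lambda>s. True) (copy_loop 7 e)
    (\<lambda>s s'. same_graph s s' \<and> s' 6 = s 6 \<and> (\<forall>i<s 2 0. s' 7 i = aval e (set_var s 9 i)))"
proof -
  have "spec (\<lambda>s. True) (copy_loop 7 e)
    (\<lambda>s s'. s' 7 = (\<lambda>i. if i < s 2 0 then aval e (set_var s 9 i) else s 7 i))"
    by (rule spec_copy_loop) (simp, simp, rule assms)
  then show ?thesis
  proof (rule spec_weaken)
    fix s s' assume *: "s' 7 = (\<lambda>i. if i < s 2 0 then aval e (set_var s 9 i) else s 7 i)"
      and fr: "frame (writes (copy_loop 7 e)) s s'"
    have "writes (copy_loop 7 e) = {7, 9}" unfolding copy_loop_def by auto
    then have "same_graph s s'" "s' 6 = s 6" using fr by (auto simp: frame_def same_graph_def)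
    then show "same_graph s s' \<and> s' 6 = s 6 \<and> (\<forall>i<s 2 0. s' 7 i = aval e (set_var s 9 i))"
      using * by simp
  qed simp
qed

lemma spec_copy6:
  assumes "\<And>s s'. (\<And>b. b \<noteq> 6 \<Longrightarrow> s' b = s b) \<Longrightarrow> s' 6 (s 9 0) = s 6 (s 9 0) \<Longrightarrow> aval e s' = aval e s"
  shows "spec (\<lambda>s. True) (copy_loop 6 e)
    (\<lambda>s s'. same_graph s s' \<and> (\<forall>i<s 2 0. s' 6 i = aval e (set_var s 9 i)))"
proof -
  have "spec (\<lambda>s. True) (copy_loop 6 e)
    (\<lambda>s s'. s' 6 = (\<lambda>i. if i < s 2 0 then aval e (set_var s 9 i) else s 6 i))"
    by (rule spec_copy_loop) (simp, simp, rule assms)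
  then show ?thesis
  proof (rule spec_weaken)
    fix s s' assume *: "s' 6 = (\<lambda>i. if i < s 2 0 then aval e (set_var s 9 i) else s 6 i)"
      and fr: "frame (writes (copy_loop 6 e)) s s'"
    have "writes (copy_loop 6 e) = {6, 9}" unfolding copy_loop_def by auto
    then have "same_graph s s'" using fr by (auto simp: frame_def same_graph_def)
    then show "same_graph s s' \<and> (\<forall>i<s 2 0. s' 6 i = aval e (set_var s 9 i))"
      using * by simp
  qed simp
qed

lemma writes_collapse: "a \<in> writes (collapse c) \<Longrightarrow> a \<in> {6, 7, 9, 16, 17} \<or> 30 \<le> a"
  unfolding collapse_def copy_loop_def using writes_search_bounds(1)[of a 2 c] by auto

text \<open>A round that does not make the core smaller shows that the core has no fold, and a core without a fold
is never changed again, so it remains one.\<close>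

lemma spec_collapse:
  "spec rep_ok (collapse c)
    (\<lambda>s s'. rep_ok s' \<and> (stuck c s \<longrightarrow> stuck c s') \<and> (stuck c s' \<or> card (core s') < card (core s)))"
proof -
  have l1: "spec (\<lambda>s. True) (copy_loop 7 (var 9))
    (\<lambda>s s'. same_graph s s' \<and> s' 6 = s 6 \<and> (\<forall>i<s 2 0. s' 7 i = i))"
    by (rule spec_weaken[OF spec_copy7]) auto
  have l2: "spec (\<lambda>s. True) (search fold_fm 2 c)
    (\<lambda>s s'. same_graph s s' \<and> s' 6 = s 6 \<and> search_result fold_fm (mods (s 2 0) (s 2 0) c (s 7)) s s')"
  proof (rule spec_weaken[OF spec_search_fold], goal_cases)
    case (2 s s')
    have "same_graph s s'" using 2 writes_search_bounds(1)[of _ 2 c]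
      by (intro same_graph_frame) (auto, fastforce+)
    moreover have "s' 6 = s 6" using frameD[OF 2(3), of 6] writes_search_bounds(1)[of 6 2 c] by auto
    ultimately show ?case using 2 by blast
  qed simp
  have l3: "spec (\<lambda>s. True) (Cond (Less (var 30) (Num 1)) Skip (copy_loop 6 (Read 7 (Rep 9))))
    (\<lambda>s s'. same_graph s s' \<and> (\<forall>i<s 2 0. s' 6 i = (if s 30 0 = 0 then s 6 i else s 7 (s 6 i))))"
    by (rule spec_Cond; rule spec_weaken, rule spec_Skip spec_copy6) (auto simp: same_graph_def)
  have w: "2 \<notin> writes (copy_loop 7 (var 9))" "2 \<notin> writes (search fold_fm 2 c)"
    using writes_search_bounds(1)[of 2 2 c] unfolding copy_loop_def by auto
  show ?thesis unfolding collapse_def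
  proof (rule spec_weaken[OF spec_Seq_simple[OF l1 spec_Seq_simple[OF l2 l3 w(2)] w(1)]])
    fix s s'' assume rep: "rep_ok s"
    assume "\<exists>s1. (same_graph s s1 \<and> s1 6 = s 6 \<and> (\<forall>i<s 2 0. s1 7 i = i)) \<and>
      (\<exists>s2. (same_graph s1 s2 \<and> s2 6 = s1 6 \<and> search_result fold_fm (mods (s1 2 0) (s1 2 0) c (s1 7)) s1 s2) \<and>
        same_graph s2 s'' \<and> (\<forall>i<s2 2 0. s'' 6 i = (if s2 30 0 = 0 then s2 6 i else s2 7 (s2 6 i))))"
    then obtain s1 s2 where s1: "same_graph s s1" "s1 6 = s 6" "\<forall>i<s 2 0. s1 7 i = i"
      and s2: "same_graph s1 s2" "s2 6 = s1 6" "search_result fold_fm (mods (s1 2 0) (s1 2 0) c (s1 7)) s1 s2"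
      and s'': "same_graph s2 s''" "\<forall>i<s2 2 0. s'' 6 i = (if s2 30 0 = 0 then s2 6 i else s2 7 (s2 6 i))"
      by blast
    have g: "same_graph s s''" using s1 s2 s'' same_graph_trans by blast
    note eq1 = same_graph_eq[OF s1(1)] and eq2 = same_graph_eq[OF s2(1)] and eq = same_graph_eq[OF g]
    have rep1: "rep_ok s1" "core s1 = core s" "stuck c s1 = stuck c s"
      using rep_cong[OF s1(1)] s1(2) rep by auto
    have F: "\<And>i. i < s1 2 0 \<Longrightarrow> s1 7 i = i" using s1(3) eq1 by simp
    have lt: "u < s2 2 0" if "u \<in> vset s" for u using that eq1 eq2 unfolding vset_def by simp
    show "rep_ok s'' \<and> (stuck c s \<longrightarrow> stuck c s'') \<and> (stuck c s'' \<or> card (core s'') < card (core s))"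
    proof (cases "s2 30 0 = 0")
      case True
      then have "\<forall>g\<in>mods (s1 2 0) (s1 2 0) c (s1 7). \<not> sem fold_fm (s1(7 := g))"
        using s2(3) unfolding search_result_def by auto
      then have "stuck c s1" using has_fold_sem[OF rep1(1) F] unfolding stuck_def by blast
      moreover have "s'' 6 u = s 6 u" if "u \<in> vset s" for u using s''(2) lt[OF that] True s2(2) s1(2) by simp
      ultimately show ?thesis using rep_cong[OF g] rep rep1(3) by auto
    next
      case False
      then have found: "s2 7 \<in> mods (s1 2 0) (s1 2 0) c (s1 7)" "sem fold_fm (s1(7 := s2 7))"
        using s2(3) unfolding search_result_def by auto
      note fold = sem_has_fold[OF rep1(1) F found]
      have s''6: "s'' 6 u = s2 7 (s 6 u)" if "u \<in> vset s" for u
        using s''(2) lt[OF that] False s2(2) s1(2) by simp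
      have core'': "core s'' = s2 7 ` core s" unfolding core_def using s''6 eq by auto
      have sub: "core s \<subseteq> vset s" using rep unfolding core_def rep_ok_def by blast
      have "card (core s'') < card (core s)"
        unfolding core'' using fold(1) rep1(2) sub finite_vset by (metis finite_subset psubset_card_mono)
      moreover have "rep_ok s''" unfolding rep_ok_def
      proof (intro conjI ballI allI impI)
        fix u assume "u \<in> vset s''"
        then have "u \<in> vset s" using eq by simp
        moreover have "s2 7 ` core s \<subseteq> core s" using fold(1) rep1(2) by auto
        moreover have "s 6 u \<in> core s" using \<open>u \<in> vset s\<close> unfolding core_def by (rule imageI)
        ultimately have "s'' 6 u \<in> core s" using s''6[of u] by auto
        then show "s'' 6 u \<in> vset s''" using sub eq by auto
      next
        fix u v assume "edge s'' u v"
        then have e: "edge s u v" using eq by simp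
        then have uv: "u \<in> vset s" "v \<in> vset s" unfolding edge_def by auto
        then have "core_edge s1 (s 6 u) (s 6 v)"
          using e rep eq1 rep1(2) unfolding rep_ok_def core_def by auto
        then have "edge s1 (s2 7 (s 6 u)) (s2 7 (s 6 v))" using fold(2) by blast
        then show "edge s'' (s'' 6 u) (s'' 6 v)" using s''6 uv eq eq1 by simp
      qed
      moreover have "\<not> stuck c s" using fold(3) rep1(3) unfolding stuck_def by blast
      ultimately show ?thesis by blast
    qed
  qed auto
qed

lemma cogem_house_free_subset:
  assumes "cogem_house_free V E" and "W \<subseteq> V"
  shows "cogem_house_free W (\<lambda>u v. u \<in> W \<and> v \<in> W \<and> E u v)"
proof -
  interpret cogem_house_free V E by fact
  show ?thesis
  proof
    show "finite W" using assms(2) fin by (rule finite_subset)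
  next
    fix a b c d e
    assume "a \<in> W \<and> b \<in> W \<and> E a b" "b \<in> W \<and> c \<in> W \<and> E b c" "c \<in> W \<and> d \<in> W \<and> E c d"
      "\<not> (a \<in> W \<and> c \<in> W \<and> E a c)" "\<not> (a \<in> W \<and> d \<in> W \<and> E a d)" "\<not> (b \<in> W \<and> d \<in> W \<and> E b d)"
      "e \<in> W" "\<not> (e \<in> W \<and> a \<in> W \<and> E e a)" "\<not> (e \<in> W \<and> b \<in> W \<and> E e b)"
      "\<not> (e \<in> W \<and> c \<in> W \<and> E e c)" "\<not> (e \<in> W \<and> d \<in> W \<and> E e d)"
    then show False using cogem[of a b c d e] assms(2) by blast
  next
    fix a b c d e
    assume "a \<in> W \<and> b \<in> W \<and> E a b" "b \<in> W \<and> c \<in> W \<and> E b c" "c \<in> W \<and> d \<in> W \<and> E c d"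
      "\<not> (a \<in> W \<and> c \<in> W \<and> E a c)" "\<not> (a \<in> W \<and> d \<in> W \<and> E a d)" "\<not> (b \<in> W \<and> d \<in> W \<and> E b d)"
      "e \<in> W \<and> a \<in> W \<and> E e a" "\<not> (e \<in> W \<and> b \<in> W \<and> E e b)"
      "e \<in> W \<and> c \<in> W \<and> E e c" "e \<in> W \<and> d \<in> W \<and> E e d"
    then show False using house[of a b c d e] by blast
  qed (use sym irr in blast)+
qed

definition good :: "nat \<Rightarrow> state \<Rightarrow> bool" where
  "good k s \<longleftrightarrow> s 3 0 = k \<and> cogem_house_free (vset s) (edge s)"

definition colours :: "nat \<Rightarrow> state \<Rightarrow> (nat \<Rightarrow> nat) \<Rightarrow> bool" where
  "colours k s f \<longleftrightarrow> (\<forall>u\<in>vset s. f u < k) \<and> (\<forall>u v. edge s u v \<longrightarrow> f u \<noteq> f v)"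

definition colour_result :: "nat \<Rightarrow> state \<Rightarrow> state \<Rightarrow> bool" where
  "colour_result k s s' \<longleftrightarrow>
     s' 30 0 = 1 \<and> colours k s (\<lambda>u. s' 7 (s' 6 u)) \<or> s' 30 0 = 0 \<and> (\<nexists>f. colours k s f)"

text \<open>If the selected subgraph is \<open>k\<close>-colourable, then so is its core, which consequently has at most
\<open>core_bound k\<close> vertices; so the search for a colouring of the core succeeds. Composing what it finds
with the folds colours the whole subgraph.\<close>

lemma spec_colour: "spec (good k) (colour (2 * k) (core_bound k)) (colour_result k)"
proof -
  let ?c = "2 * k"
  have good_cong: "good k s' = good k s" if "same_graph s s'" for s s'
    using same_graph_eq[OF that] unfolding good_def by simp
  have l1: "spec (good k) (copy_loop 6 (var 9)) (\<lambda>s s'. same_graph s s' \<and> (\<forall>i<s 2 0. s' 6 i = i))"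
    by (rule spec_weaken[OF spec_copy6]) auto
  have l2: "spec (\<lambda>s. good k s \<and> rep_ok s) (For 10 2 (collapse ?c))
    (\<lambda>s s'. same_graph s s' \<and> rep_ok s' \<and> (stuck ?c s' \<or> card (core s') = 0))"
  proof (rule spec_For[OF spec_collapse, where q = "[:0, 1:]" and
        I = "\<lambda>s j s'. same_graph s s' \<and> rep_ok s' \<and> (stuck ?c s' \<or> card (core s') + j \<le> s 2 0)"], goal_cases)
    case (7 s)
    have g: "same_graph s (set_var s 10 0)" unfolding same_graph_def by simp
    have "core s \<subseteq> {..<s 2 0}" using 7 unfolding rep_ok_def core_def vset_def by blast
    then have "card (core s) \<le> s 2 0" using card_mono[of "{..<s 2 0}" "core s"] by simp
    then show ?case using 7 g rep_cong[OF g] by simp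
  next
    case (9 s j s' s'')
    let ?t = "set_var s'' 10 (Suc j)"
    have g': "same_graph s' s''"
      by (rule same_graph_frame[OF 9(7)]) (use writes_collapse[of _ ?c] in fastforce)
    moreover have "same_graph s'' ?t" unfolding same_graph_def by simp
    moreover have "same_graph s s'" using 9 by blast
    ultimately have "same_graph s ?t" using same_graph_trans by blast
    moreover note rep_cong[OF \<open>same_graph s'' ?t\<close>]
    ultimately show ?case using 9 by auto
  next
    case (10 s s')
    then show ?case by auto
  qed (use writes_collapse[of _ ?c] in fastforce)+
  have l3: "spec (good k) (copy_loop 7 (Num 0)) (\<lambda>s s'. same_graph s s' \<and> s' 6 = s 6 \<and> (\<forall>i<s 2 0. s' 7 i = 0))"
    by (rule spec_weaken[OF spec_copy7]) auto
  have l4: "spec (good k) (search colouring_fm 3 (core_bound k))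
    (\<lambda>s s'. same_graph s s' \<and> s' 6 = s 6 \<and> search_result colouring_fm (mods (s 2 0) k (core_bound k) (s 7)) s s')"
  proof (rule spec_weaken[OF spec_search_colouring[of k "core_bound k"]], goal_cases)
    case (2 s s')
    have "same_graph s s'" using 2 writes_search_bounds(2)[of _ 3 "core_bound k"]
      by (intro same_graph_frame) (auto, fastforce+)
    moreover have "s' 6 = s 6"
      using frameD[OF 2(3), of 6] writes_search_bounds(2)[of 6 3 "core_bound k"] by auto
    ultimately show ?case using 2 by blast
  qed (simp add: good_def)
  have w: "2 \<notin> writes (copy_loop 6 (var 9))" "2 \<notin> writes (copy_loop 7 (Num 0))"
    "2 \<notin> writes (For 10 2 (collapse ?c))"
    using writes_collapse[of 2 ?c] unfolding copy_loop_def by auto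
  have id_rep: "rep_ok s'" if "same_graph s s'" "\<forall>i<s 2 0. s' 6 i = i" for s s'
  proof -
    have "s' 6 u = u" if "u \<in> vset s'" for u
      using that \<open>\<forall>i<s 2 0. s' 6 i = i\<close> same_graph_eq[OF \<open>same_graph s s'\<close>] unfolding vset_def by simp
    then show ?thesis unfolding rep_ok_def by (auto simp: edge_def)
  qed
  have "spec (good k) (colour ?c (core_bound k))
    (\<lambda>s s4. \<exists>s1. (same_graph s s1 \<and> (\<forall>i<s 2 0. s1 6 i = i)) \<and>
      (\<exists>s2. (same_graph s1 s2 \<and> rep_ok s2 \<and> (stuck ?c s2 \<or> card (core s2) = 0)) \<and>
      (\<exists>s3. (same_graph s2 s3 \<and> s3 6 = s2 6 \<and> (\<forall>i<s2 2 0. s3 7 i = 0)) \<and>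
        same_graph s3 s4 \<and> s4 6 = s3 6 \<and> search_result colouring_fm (mods (s3 2 0) k (core_bound k) (s3 7)) s3 s4)))"
    unfolding colour_def
    by (rule spec_Seq_simple[OF l1 spec_Seq_simple[OF l2 spec_Seq_simple[OF l3 l4 w(2)] w(3)] w(1)])
      (use good_cong id_rep in blast)+
  then show ?thesis
  proof (rule spec_weaken)
    fix s s4 assume good: "good k s"
    assume "\<exists>s1. (same_graph s s1 \<and> (\<forall>i<s 2 0. s1 6 i = i)) \<and>
      (\<exists>s2. (same_graph s1 s2 \<and> rep_ok s2 \<and> (stuck ?c s2 \<or> card (core s2) = 0)) \<and>
      (\<exists>s3. (same_graph s2 s3 \<and> s3 6 = s2 6 \<and> (\<forall>i<s2 2 0. s3 7 i = 0)) \<and>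
        same_graph s3 s4 \<and> s4 6 = s3 6 \<and> search_result colouring_fm (mods (s3 2 0) k (core_bound k) (s3 7)) s3 s4))"
    then obtain s1 s2 s3 where g1: "same_graph s s1" and g2: "same_graph s1 s2"
      and rep2: "rep_ok s2" "stuck ?c s2 \<or> card (core s2) = 0"
      and s3: "same_graph s2 s3" "s3 6 = s2 6" "\<forall>i<s2 2 0. s3 7 i = 0"
      and s4: "same_graph s3 s4" "s4 6 = s3 6" "search_result colouring_fm (mods (s3 2 0) k (core_bound k) (s3 7)) s3 s4"
      by blast
    have g: "same_graph s s3" using g1 g2 s3(1) same_graph_trans by blast
    note eq = same_graph_eq[OF g]
    have rep: "rep_ok s3" "stuck ?c s3 \<or> card (core s3) = 0"
      using rep_cong[OF s3(1)] s3(2) rep2 by auto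
    have good3: "cogem_house_free (vset s3) (edge s3)" "s3 3 0 = k" using good eq unfolding good_def by auto
    have sub: "core s3 \<subseteq> vset s3" using rep unfolding core_def rep_ok_def by blast
    have fin: "finite (core s3)" using sub finite_vset by (rule finite_subset)
    have v7: "vset (s3(7 := h)) = vset s3" for h unfolding vset_def by simp
    have found: "\<exists>h\<in>mods (s3 2 0) k (core_bound k) (s3 7). sem colouring_fm (s3(7 := h))"
      if f: "colours k s f" for f
    proof -
      have f3: "\<And>u. u \<in> vset s3 \<Longrightarrow> f u < k" "\<And>u v. edge s3 u v \<Longrightarrow> f u \<noteq> f v"
        using f eq unfolding colours_def by auto
      interpret C: cogem_house_free "core s3" "core_edge s3"
        by (rule cogem_house_free_subset[OF good3(1) sub])
      \<comment> \<open>After a successful fold in every round the core is empty, hence small as well.\<close>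
      have card: "card (core s3) \<le> core_bound k"
        using C.small_or_foldable[of f k] f3 sub rep(2) unfolding stuck_def by auto
      define h where "h = (\<lambda>u. if u \<in> core s3 then f u else s3 7 u)"
      have lt: "u < s3 2 0" if "u \<in> core s3" for u using that sub unfolding vset_def by blast
      have "h \<in> mods (s3 2 0) k (core_bound k) (s3 7)"
      proof (rule modsI)
        have d: "{u. h u \<noteq> s3 7 u} \<subseteq> core s3" unfolding h_def by auto
        then show "{u. h u \<noteq> s3 7 u} \<subseteq> {..<s3 2 0}" using lt by auto
        show "card {u. h u \<noteq> s3 7 u} \<le> core_bound k" using card_mono[OF fin d] card by linarith
        show "h u < k" if "h u \<noteq> s3 7 u" for u
          using that f3(1) sub unfolding h_def by (auto split: if_splits)
      qed
      moreover have "sem colouring_fm (s3(7 := h))"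
      proof -
        have h: "h (s3 6 u) = f (s3 6 u)" "s3 6 u \<in> vset s3" if "u \<in> vset s3" for u
          using that sub unfolding h_def core_def by auto
        have "f (s3 6 u) \<noteq> f (s3 6 v)"
          if "u \<in> vset s3" "v \<in> vset s3" "0 < s3 0 (s3 4 (s3 6 u) + s3 6 v)" for u v
          using f3(2) h(2) that unfolding edge_def by blast
        then show ?thesis unfolding sem_colouring_fm v7 using h f3(1) good3(2) by simp
      qed
      ultimately show ?thesis by blast
    qed
    have result: "colours k s (\<lambda>u. h (s3 6 u))" if "sem colouring_fm (s3(7 := h))" for h
    proof -
      have h: "\<And>u. u \<in> vset s3 \<Longrightarrow> h (s3 6 u) < k"
        "\<And>u v. u \<in> vset s3 \<Longrightarrow> v \<in> vset s3 \<Longrightarrow> 0 < s3 0 (s3 4 (s3 6 u) + s3 6 v) \<Longrightarrow> h (s3 6 u) \<noteq> h (s3 6 v)"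
        using that good3(2) unfolding sem_colouring_fm v7 by auto
      have "h (s3 6 u) \<noteq> h (s3 6 v)" if e: "edge s3 u v" for u v
      proof -
        have "edge s3 (s3 6 u) (s3 6 v)" using rep(1) e unfolding rep_ok_def by blast
        then show ?thesis using h(2)[of u v] e unfolding edge_def by blast
      qed
      then show ?thesis using h(1) eq unfolding colours_def by auto
    qed
    show "colour_result k s s4"
      using s4(2,3) found result unfolding colour_result_def search_result_def by auto
  qed auto
qed

section \<open>Induced subgraphs and criticality\<close>

text \<open>Arcs of a pair digraph are pairs, so an injective map on vertices that preserves and reflects
adjacency determines the map on arcs.\<close>

lemma digraph_iso_induced:
  fixes H :: "'h pair_pre_digraph" and G :: "'g pair_pre_digraph"
  assumes wf: "parcs H \<subseteq> pverts H \<times> pverts H" and inj: "inj_on \<phi> (pverts H)"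
    and adj: "\<And>u v. u \<in> pverts H \<Longrightarrow> v \<in> pverts H \<Longrightarrow> (\<phi> u, \<phi> v) \<in> parcs G \<longleftrightarrow> (u, v) \<in> parcs H"
  shows "digraph_iso (with_proj H) (with_proj G \<restriction> \<phi> ` pverts H)"
proof -
  let ?f = "\<lparr>iso_verts = \<phi>, iso_arcs = map_prod \<phi> \<phi>, iso_head = snd, iso_tail = fst\<rparr>"
  have wfH: "wf_digraph (with_proj H)" by unfold_locales (use wf in auto)
  have injH: "inj_on (map_prod \<phi> \<phi>) (parcs H)"
    using map_prod_inj_on[OF inj inj] wf by (rule inj_on_subset)
  have "pre_digraph.digraph_isomorphism (with_proj H) ?f"
    unfolding pre_digraph.digraph_isomorphism_def
    by (simp add: wfH injH inj)
  moreover have "{e \<in> parcs G. fst e \<in> \<phi> ` pverts H \<and> snd e \<in> \<phi> ` pverts H} = map_prod \<phi> \<phi> ` parcs H"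
  proof (intro equalityI subsetI)
    fix e assume "e \<in> {e \<in> parcs G. fst e \<in> \<phi> ` pverts H \<and> snd e \<in> \<phi> ` pverts H}"
    then have e: "e \<in> parcs G" "fst e \<in> \<phi> ` pverts H" "snd e \<in> \<phi> ` pverts H" by blast+
    obtain u where u: "u \<in> pverts H" "fst e = \<phi> u" using e(2) by (rule imageE)
    obtain v where v: "v \<in> pverts H" "snd e = \<phi> v" using e(3) by (rule imageE)
    have "e = (\<phi> u, \<phi> v)" using u(2) v(2) by (metis prod.collapse)
    with e(1) u(1) v(1) have "(u, v) \<in> parcs H" "e = map_prod \<phi> \<phi> (u, v)" using adj[of u v] by simp_all
    then show "e \<in> map_prod \<phi> \<phi> ` parcs H" by blast
  next
    fix e assume "e \<in> map_prod \<phi> \<phi> ` parcs H"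
    then obtain u v where "(u, v) \<in> parcs H" "e = (\<phi> u, \<phi> v)" by auto
    moreover have "u \<in> pverts H" "v \<in> pverts H" using calculation(1) wf by auto
    ultimately show "e \<in> {e \<in> parcs G. fst e \<in> \<phi> ` pverts H \<and> snd e \<in> \<phi> ` pverts H}"
      using adj[of u v] by simp
  qed
  then have "with_proj G \<restriction> \<phi> ` pverts H = app_iso ?f (with_proj H)"
    unfolding induce_subgraph_def app_iso_def by simp
  ultimately show ?thesis unfolding digraph_iso_def by blast
qed

lemma not_induced_free:
  fixes H :: "'h pair_pre_digraph" and G :: "'g pair_pre_digraph"
  assumes "parcs H \<subseteq> pverts H \<times> pverts H" "inj_on \<phi> (pverts H)" "\<phi> ` pverts H \<subseteq> pverts G"
    and "\<And>u v. u \<in> pverts H \<Longrightarrow> v \<in> pverts H \<Longrightarrow> (\<phi> u, \<phi> v) \<in> parcs G \<longleftrightarrow> (u, v) \<in> parcs H"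
  shows "\<not> induced_free (with_proj H) (with_proj G)"
  unfolding induced_free_def using digraph_iso_induced[OF assms(1,2,4)] assms(3) by auto

lemma below_4: "{..<4} = {0, 1, 2, 3 :: nat}" and below_5: "{..<5} = {0, 1, 2, 3, 4 :: nat}"
  by auto

lemma pverts_house: "pverts house = {0, 1, 2, 3, 4}"
  unfolding house_def complement_def path_graph_def below_5 by simp

lemma parcs_house:
  "(u, v) \<in> parcs house \<longleftrightarrow> u \<in> {0, 1, 2, 3, 4} \<and> v \<in> {0, 1, 2, 3, 4} \<and> u \<noteq> v \<and> v \<noteq> Suc u \<and> u \<noteq> Suc v"
  unfolding house_def complement_def path_graph_def below_5[symmetric] by auto

lemma pverts_co_gem: "pverts co_gem = {Inl 0, Inl 1, Inl 2, Inl 3, Inr 0}"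
  unfolding co_gem_def disjoint_union_def path_graph_def below_4 Plus_def by auto

lemma parcs_co_gem:
  "(u, v) \<in> parcs co_gem \<longleftrightarrow> (\<exists>i j. u = Inl i \<and> v = Inl j \<and> i < 4 \<and> j < 4 \<and> (j = Suc i \<or> i = Suc j))"
  unfolding co_gem_def disjoint_union_def path_graph_def by (auto simp: image_iff)

text \<open>The vertices of the co-gem are numbered along the path, with the isolated vertex in the second
summand. The house is the complement of a path; if \<open>a b c d\<close> is the induced path of the house and \<open>e\<close> the
fifth vertex, then this path is \<open>e b d a c\<close>.\<close>

lemma input_graph_cogem_house_free:
  assumes G: "input_graph G" and co_gem: "induced_free (with_proj co_gem) (with_proj G)"
    and house: "induced_free (with_proj house) (with_proj G)"
  shows "cogem_house_free (pverts G) (\<lambda>u v. (u, v) \<in> parcs G)"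
proof -
  interpret pair_graph G using G unfolding input_graph_def by blast
  have sym: "(v, u) \<in> parcs G" if "(u, v) \<in> parcs G" for u v
    using that pair_sym_arcs unfolding symmetric_def by (auto dest: symD)
  have irr: "(u, u) \<notin> parcs G" for u using pair_no_loops by fastforce
  have vert: "u \<in> pverts G" "v \<in> pverts G" if "(u, v) \<in> parcs G" for u v
    using that in_arcsD1 in_arcsD2 by blast+
  show ?thesis
  proof
    show "finite (pverts G)" by (rule pair_finite_verts)
  next
    fix a b c d e
    assume P: "(a, b) \<in> parcs G" "(b, c) \<in> parcs G" "(c, d) \<in> parcs G" "(a, c) \<notin> parcs G"
      "(a, d) \<notin> parcs G" "(b, d) \<notin> parcs G" and e: "e \<in> pverts G" "(e, a) \<notin> parcs G" "(e, b) \<notin> parcs G"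
      "(e, c) \<notin> parcs G" "(e, d) \<notin> parcs G"
    have P': "(b, a) \<in> parcs G" "(c, b) \<in> parcs G" "(d, c) \<in> parcs G" "(c, a) \<notin> parcs G"
      "(d, a) \<notin> parcs G" "(d, b) \<notin> parcs G" "(a, e) \<notin> parcs G" "(b, e) \<notin> parcs G"
      "(c, e) \<notin> parcs G" "(d, e) \<notin> parcs G" using P e sym by blast+
    have dist: "distinct [a, b, c, d, e]" using P P' e irr by auto
    let ?\<phi> = "case_sum (\<lambda>i. if i = 0 then a else if i = 1 then b else if i = 2 then c else d) (\<lambda>_ :: nat. e)"
    have "\<not> induced_free (with_proj co_gem) (with_proj G)"
    proof (rule not_induced_free[of co_gem ?\<phi>])
      show "parcs co_gem \<subseteq> pverts co_gem \<times> pverts co_gem"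
      proof
        fix p assume "p \<in> parcs co_gem"
        then obtain i j where "p = (Inl i, Inl j)" "i \<in> {..<4}" "j \<in> {..<4}"
          using parcs_co_gem[of "fst p" "snd p"] by (metis lessThan_iff prod.collapse)
        then show "p \<in> pverts co_gem \<times> pverts co_gem" unfolding pverts_co_gem below_4 by auto
      qed
      show "inj_on ?\<phi> (pverts co_gem)" unfolding pverts_co_gem using dist by (auto simp: inj_on_def)
      show "?\<phi> ` pverts co_gem \<subseteq> pverts G" unfolding pverts_co_gem using P e vert by auto
      show "(?\<phi> u, ?\<phi> v) \<in> parcs G \<longleftrightarrow> (u, v) \<in> parcs co_gem"
        if "u \<in> pverts co_gem" "v \<in> pverts co_gem" for u v
        using that unfolding pverts_co_gem parcs_co_gem by (elim insertE emptyE) (simp_all add: P P' e irr)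
    qed
    then show False using co_gem by blast
  next
    fix a b c d e
    assume P: "(a, b) \<in> parcs G" "(b, c) \<in> parcs G" "(c, d) \<in> parcs G" "(a, c) \<notin> parcs G"
      "(a, d) \<notin> parcs G" "(b, d) \<notin> parcs G" and e: "(e, a) \<in> parcs G" "(e, b) \<notin> parcs G"
      "(e, c) \<in> parcs G" "(e, d) \<in> parcs G"
    have P': "(b, a) \<in> parcs G" "(c, b) \<in> parcs G" "(d, c) \<in> parcs G" "(c, a) \<notin> parcs G"
      "(d, a) \<notin> parcs G" "(d, b) \<notin> parcs G" "(a, e) \<in> parcs G" "(b, e) \<notin> parcs G"
      "(c, e) \<in> parcs G" "(d, e) \<in> parcs G" using P e sym by blast+
    have dist: "distinct [a, b, c, d, e]" using P P' e irr by auto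
    let ?\<phi> = "\<lambda>i :: nat. if i = 0 then e else if i = 1 then b else if i = 2 then d else if i = 3 then a else c"
    have "\<not> induced_free (with_proj house) (with_proj G)"
    proof (rule not_induced_free[of house ?\<phi>])
      show "parcs house \<subseteq> pverts house \<times> pverts house"
        unfolding pverts_house using parcs_house by (metis mem_Sigma_iff subrelI)
      show "inj_on ?\<phi> (pverts house)" unfolding pverts_house using dist by (auto simp: inj_on_def)
      show "?\<phi> ` pverts house \<subseteq> pverts G" unfolding pverts_house using P e vert by auto
      show "(?\<phi> u, ?\<phi> v) \<in> parcs G \<longleftrightarrow> (u, v) \<in> parcs house"
        if "u \<in> pverts house" "v \<in> pverts house" for u v
        using that unfolding pverts_house parcs_house by (elim insertE emptyE) (simp_all add: P P' e irr)
    qed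
    then show False using house by blast
  qed (use vert sym irr in blast)+
qed

definition colourable_on :: "(nat \<Rightarrow> nat \<Rightarrow> bool) \<Rightarrow> nat \<Rightarrow> nat set \<Rightarrow> bool" where
  "colourable_on E k S \<longleftrightarrow> (\<exists>f. (\<forall>u\<in>S. f u < k) \<and> (\<forall>u\<in>S. \<forall>v\<in>S. E u v \<longrightarrow> f u \<noteq> f v))"

lemma colourable_on_subset: "colourable_on E k S \<Longrightarrow> S' \<subseteq> S \<Longrightarrow> colourable_on E k S'"
  unfolding colourable_on_def by blast

lemma proper_coloring_induced:
  "proper_coloring (with_proj G \<restriction> S) k f \<longleftrightarrow>
     (\<forall>u\<in>S. f u < k) \<and> (\<forall>u\<in>S. \<forall>v\<in>S. (u, v) \<in> parcs G \<longrightarrow> f u \<noteq> f v)"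
  unfolding proper_coloring_def by (auto simp: arcs_ends_conv)

lemma colorable_induced:
  "colorable (with_proj G \<restriction> S) k \<longleftrightarrow> colourable_on (\<lambda>u v. (u, v) \<in> parcs G) k S"
  unfolding colorable_def proper_coloring_induced colourable_on_def ..

lemma chromatic_number_le_iff:
  fixes G :: "nat pair_pre_digraph"
  assumes "finite S" and irr: "\<And>u. (u, u) \<notin> parcs G"
  shows "chromatic_number (with_proj G \<restriction> S) \<le> k \<longleftrightarrow> colourable_on (\<lambda>u v. (u, v) \<in> parcs G) k S"
proof -
  let ?col = "\<lambda>k. colorable (with_proj G \<restriction> S) k"
  obtain m where m: "S \<subseteq> {..<m}" using assms(1) finite_nat_iff_bounded by blast
  have "colourable_on (\<lambda>u v. (u, v) \<in> parcs G) m S"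
    unfolding colourable_on_def by (rule exI[of _ "\<lambda>u. u"]) (use m irr in auto)
  then have "?col m" unfolding colorable_induced .
  then have least: "?col (chromatic_number (with_proj G \<restriction> S))"
    unfolding chromatic_number_def by (rule LeastI)
  have mono: "colourable_on (\<lambda>u v. (u, v) \<in> parcs G) j S \<Longrightarrow> j \<le> k \<Longrightarrow> colourable_on (\<lambda>u v. (u, v) \<in> parcs G) k S" for j
    unfolding colourable_on_def by (meson less_le_trans)
  show ?thesis
    using least mono unfolding colorable_induced[symmetric] chromatic_number_def by (meson Least_le)
qed

text \<open>A colouring of \<open>S\<close> without \<open>v\<close> extends to \<open>S\<close> with one new colour for \<open>v\<close>, so uncolourability together with
colourability of all vertex-deleted subgraphs determines the chromatic number.\<close>

lemma vertex_critical_induced: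
  fixes G :: "nat pair_pre_digraph"
  assumes fin: "finite S" and irr: "\<And>u. (u, u) \<notin> parcs G"
  shows "vertex_critical (k + 1) (with_proj G \<restriction> S) \<longleftrightarrow>
    \<not> colourable_on (\<lambda>u v. (u, v) \<in> parcs G) k S \<and>
    (\<forall>v\<in>S. colourable_on (\<lambda>u v. (u, v) \<in> parcs G) k (S - {v}))"
proof -
  let ?E = "\<lambda>u v. (u, v) \<in> parcs G"
  have del: "pre_digraph.del_vert (with_proj G \<restriction> S) v = with_proj G \<restriction> (S - {v})" for v
    unfolding pre_digraph.del_vert_def induce_subgraph_def by auto
  have up: "colourable_on ?E (k + 1) S" if v: "v \<in> S" "colourable_on ?E k (S - {v})" for v
  proof -
    obtain f where f: "\<forall>u\<in>S - {v}. f u < k" "\<forall>u\<in>S - {v}. \<forall>w\<in>S - {v}. ?E u w \<longrightarrow> f u \<noteq> f w"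
      using v(2) unfolding colourable_on_def by blast
    show ?thesis unfolding colourable_on_def
      by (rule exI[of _ "f(v := k)"]) (use f irr in force)
  qed
  have empty: "colourable_on ?E k {}" unfolding colourable_on_def by simp
  have "chromatic_number (with_proj G \<restriction> S) = k + 1 \<longleftrightarrow> \<not> colourable_on ?E k S \<and> colourable_on ?E (k + 1) S"
    using chromatic_number_le_iff[OF fin irr, where k = k] chromatic_number_le_iff[OF fin irr, where k = "k + 1"] by linarith
  moreover have "chromatic_number (with_proj G \<restriction> (S - {v})) < k + 1 \<longleftrightarrow> colourable_on ?E k (S - {v})" for v
    using chromatic_number_le_iff[of "S - {v}" G k] fin irr by auto
  ultimately show ?thesis
    unfolding vertex_critical_def del using up empty by (metis ex_in_conv induce_subgraph_verts)
qed

section \<open>The certifying algorithm and the verifier\<close>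

definition agree :: "nat set \<Rightarrow> state \<Rightarrow> state \<Rightarrow> bool" where
  "agree A s s' \<longleftrightarrow> (\<forall>a\<in>A. s' a = s a)"

lemma agreeD: "agree A s s' \<Longrightarrow> a \<in> A \<Longrightarrow> s' a = s a"
  unfolding agree_def by blast

lemma agree_frame: "frame W s s' \<Longrightarrow> W \<inter> A = {} \<Longrightarrow> agree A s s'"
  unfolding frame_def agree_def by blast

lemma agree_trans: "agree A s s' \<Longrightarrow> agree B s' s'' \<Longrightarrow> C \<subseteq> A \<inter> B \<Longrightarrow> agree C s s''"
  unfolding agree_def by (metis IntE subsetD)

text \<open>Adjacency in the whole input graph, of which the selected vertices induce a subgraph.\<close>

definition input_edge :: "state \<Rightarrow> nat \<Rightarrow> nat \<Rightarrow> bool" where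
  "input_edge s u v \<longleftrightarrow> u < s 2 0 \<and> v < s 2 0 \<and> 0 < s 0 (s 4 u + v)"

definition valid :: "nat \<Rightarrow> state \<Rightarrow> bool" where
  "valid k s \<longleftrightarrow> s 3 0 = k \<and> cogem_house_free {..<s 2 0} (input_edge s)"

abbreviation col :: "nat \<Rightarrow> state \<Rightarrow> nat set \<Rightarrow> bool" where
  "col k s \<equiv> colourable_on (input_edge s) k"

lemma agree_graph:
  assumes "agree A s s'" "{0, 2, 3, 4} \<subseteq> A"
  shows "input_edge s' = input_edge s" "valid k s' = valid k s" "s' 2 = s 2"
proof -
  have eq: "s' 0 = s 0" "s' 2 = s 2" "s' 3 = s 3" "s' 4 = s 4"
    using agreeD[OF assms(1)] assms(2) by auto
  show f: "input_edge s' = input_edge s" unfolding input_edge_def eq ..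
  show "s' 2 = s 2" by (rule eq)
  show "valid k s' = valid k s" unfolding valid_def f eq ..
qed

abbreviation colour_set :: "nat \<Rightarrow> com" where
  "colour_set k \<equiv> colour (2 * k) (core_bound k)"

lemma writes_colour: "a \<in> writes (colour c m) \<Longrightarrow> a \<in> {6, 7, 9, 10, 16, 17} \<or> 30 \<le> a"
  using writes_collapse[of a c] writes_search_bounds(2)[of a 3 m]
  unfolding colour_def copy_loop_def by auto

lemma spec_colour_set:
  "spec (valid k) (colour_set k)
    (\<lambda>s s'. agree {0, 1, 2, 3, 4, 5, 8, 11, 15} s s' \<and> s' 30 0 = of_bool (col k s (vset s)) \<and>
      (col k s (vset s) \<longrightarrow> (\<forall>u\<in>vset s. s' 7 (s' 6 u) < k) \<and>
        (\<forall>u\<in>vset s. \<forall>v\<in>vset s. input_edge s u v \<longrightarrow> s' 7 (s' 6 u) \<noteq> s' 7 (s' 6 v))))"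
proof (rule spec_weaken[OF spec_colour[of k]])
  have E: "edge s = (\<lambda>u v. u \<in> vset s \<and> v \<in> vset s \<and> input_edge s u v)" for s
    unfolding edge_def input_edge_def vset_def by auto
  have colours: "colours k s f \<longleftrightarrow> (\<forall>u\<in>vset s. f u < k) \<and> (\<forall>u\<in>vset s. \<forall>v\<in>vset s. input_edge s u v \<longrightarrow> f u \<noteq> f v)" for s f
    unfolding colours_def E by blast
  show "good k s" if "valid k s" for s
  proof -
    have "vset s \<subseteq> {..<s 2 0}" unfolding vset_def by auto
    then show ?thesis
      using that cogem_house_free_subset[of "{..<s 2 0}" "input_edge s" "vset s"] unfolding valid_def good_def E by blast
  qed
  fix s s' assume r: "colour_result k s s'" and fr: "frame (writes (colour_set k)) s s'"
  have "agree {0, 1, 2, 3, 4, 5, 8, 11, 15} s s'"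
    by (rule agree_frame[OF fr]) (use writes_colour[of _ "2 * k" "core_bound k"] in fastforce)
  moreover have "s' 30 0 = of_bool (col k s (vset s)) \<and> (col k s (vset s) \<longrightarrow> colours k s (\<lambda>u. s' 7 (s' 6 u)))"
    using r unfolding colour_result_def colourable_on_def colours[symmetric] by auto
  ultimately show "agree {0, 1, 2, 3, 4, 5, 8, 11, 15} s s' \<and> s' 30 0 = of_bool (col k s (vset s)) \<and>
      (col k s (vset s) \<longrightarrow> (\<forall>u\<in>vset s. s' 7 (s' 6 u) < k) \<and>
        (\<forall>u\<in>vset s. \<forall>v\<in>vset s. input_edge s u v \<longrightarrow> s' 7 (s' 6 u) \<noteq> s' 7 (s' 6 v)))"
    unfolding colours by blast
qed

definition drop_vertex :: "nat \<Rightarrow> com" where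
  "drop_vertex k = Seq (Write 5 (var 11) (Num 0)) (colour_set k)"

lemma writes_drop_vertex: "a \<in> writes (drop_vertex k) \<Longrightarrow> a \<in> {5, 6, 7, 9, 10, 16, 17} \<or> 30 \<le> a"
  using writes_colour[of a "2 * k" "core_bound k"] unfolding drop_vertex_def by auto

lemma spec_drop_vertex:
  "spec (valid k) (drop_vertex k)
    (\<lambda>s s'. agree {0, 1, 2, 3, 4, 8, 11, 15} s s' \<and> s' 5 = (s 5)(s 11 0 := 0) \<and>
      s' 30 0 = of_bool (col k s (vset s - {s 11 0})))"
  unfolding drop_vertex_def
proof (rule spec_Seq[OF _ spec_colour_set])
  show "spec (valid k) (Write 5 (var 11) (Num 0)) (\<lambda>s s'. s' = s(5 := (s 5)(s 11 0 := 0)))"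
    by (rule spec_weaken[OF spec_Write]) auto
  show "2 \<notin> writes (Write 5 (var 11) (Num 0))" by simp
  fix s s' assume v: "valid k s" and s': "s' = s(5 := (s 5)(s 11 0 := 0))"
  have ag: "agree {0, 1, 2, 3, 4, 8, 11, 15} s s'" unfolding s' agree_def by simp
  note g = agree_graph[OF ag]
  show v': "valid k s'" using g(2) v by simp
  fix s'' assume r: "agree {0, 1, 2, 3, 4, 5, 8, 11, 15} s' s'' \<and> s'' 30 0 = of_bool (col k s' (vset s')) \<and>
      (col k s' (vset s') \<longrightarrow> (\<forall>u\<in>vset s'. s'' 7 (s'' 6 u) < k) \<and>
        (\<forall>u\<in>vset s'. \<forall>v\<in>vset s'. input_edge s' u v \<longrightarrow> s'' 7 (s'' 6 u) \<noteq> s'' 7 (s'' 6 v)))"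
  have "vset s' = vset s - {s 11 0}" unfolding vset_def s' by auto
  moreover have "agree {0, 1, 2, 3, 4, 8, 11, 15} s s''"
    by (rule agree_trans[OF ag conjunct1[OF r]]) simp
  moreover have "s'' 5 = (s 5)(s 11 0 := 0)" using agreeD[OF conjunct1[OF r], of 5] s' by simp
  ultimately show "agree {0, 1, 2, 3, 4, 8, 11, 15} s s'' \<and> s'' 5 = (s 5)(s 11 0 := 0) \<and>
      s'' 30 0 = of_bool (col k s (vset s - {s 11 0}))" using r g by simp
qed

definition critical_set :: "nat \<Rightarrow> state \<Rightarrow> nat set \<Rightarrow> bool" where
  "critical_set k s S \<longleftrightarrow> \<not> col k s S \<and> (\<forall>v\<in>S. col k s (S - {v}))"

text \<open>A vertex is dropped for good if the rest remains uncolourable. When it is kept, then the rest without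
it is colourable, and this remains true when further vertices are dropped.\<close>

definition minimise :: "nat \<Rightarrow> com" where
  "minimise k = For 11 2 (Seq (drop_vertex k)
     (Cond (Less (var 30) (Num 1)) Skip (Write 5 (var 11) (Num 1))))"

lemma spec_restore:
  "spec (\<lambda>s. True) (Cond (Less (var 30) (Num 1)) Skip (Write 5 (var 11) (Num 1)))
    (\<lambda>s s'. agree (- {5}) s s' \<and> s' 5 = (if s 30 0 = 0 then s 5 else (s 5)(s 11 0 := 1)))"
  by (rule spec_Cond; rule spec_weaken, rule spec_Skip spec_Write) (auto simp: agree_def)

lemma spec_minimise:
  "spec (\<lambda>s. valid k s \<and> (\<forall>i<s 2 0. s 5 i = 1) \<and> \<not> col k s (vset s)) (minimise k)
    (\<lambda>s s'. agree {0, 1, 2, 3, 4} s s' \<and> (\<forall>i<s 2 0. s' 5 i \<le> 1) \<and> critical_set k s (vset s'))"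
proof -
  let ?c = "Seq (drop_vertex k) (Cond (Less (var 30) (Num 1)) Skip (Write 5 (var 11) (Num 1)))"
  have body: "spec (valid k) ?c
    (\<lambda>s s'. agree {0, 1, 2, 3, 4, 11} s s' \<and>
      s' 5 = (s 5)(s 11 0 := of_bool (col k s (vset s - {s 11 0}))))"
  proof (rule spec_Seq[OF spec_drop_vertex spec_restore])
    show "2 \<notin> writes (drop_vertex k)" using writes_drop_vertex[of 2 k] by auto
    fix s s' s''
    assume 1: "agree {0, 1, 2, 3, 4, 8, 11, 15} s s' \<and> s' 5 = (s 5)(s 11 0 := 0) \<and>
      s' 30 0 = of_bool (col k s (vset s - {s 11 0}))"
      and 2: "agree (- {5}) s' s'' \<and> s'' 5 = (if s' 30 0 = 0 then s' 5 else (s' 5)(s' 11 0 := 1))"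
    have "agree {0, 1, 2, 3, 4, 11} s s''"
      by (rule agree_trans[OF conjunct1[OF 1] conjunct1[OF 2]]) simp
    moreover have "s' 11 = s 11" using agreeD[OF conjunct1[OF 1], of 11] by simp
    ultimately show "agree {0, 1, 2, 3, 4, 11} s s'' \<and>
      s'' 5 = (s 5)(s 11 0 := of_bool (col k s (vset s - {s 11 0})))"
      using 1 2 by simp
  qed simp
  have w: "a \<in> {5, 6, 7, 9, 10, 16, 17} \<or> 30 \<le> a" if "a \<in> writes ?c" for a
    using that writes_drop_vertex[of a k] by auto
  let ?I = "\<lambda>s j s'. agree {0, 1, 2, 3, 4} s s' \<and> (\<forall>i<j. s' 5 i \<le> 1) \<and> (\<forall>i. j \<le> i \<and> i < s 2 0 \<longrightarrow> s' 5 i = 1) \<and>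
      \<not> col k s (vset s') \<and> (\<forall>v\<in>vset s'. v < j \<longrightarrow> col k s (vset s' - {v}))"
  have v11: "vset (set_var s 11 j) = vset s" for s j unfolding vset_def by simp
  show ?thesis unfolding minimise_def
  proof (rule spec_For[OF body, where q = "[:0, 1:]" and I = ?I], goal_cases)
    case (7 s)
    then show ?case unfolding v11 by (simp add: agree_def)
  next
    case (8 s j s')
    then show ?case using agree_graph(2)[of _ s s' k] by auto
  next
    case (9 s j s' s'')
    have I: "agree {0, 1, 2, 3, 4} s s'" "\<forall>i<j. s' 5 i \<le> 1" "\<forall>i. j \<le> i \<and> i < s 2 0 \<longrightarrow> s' 5 i = 1"
      "\<not> col k s (vset s')" "\<forall>v\<in>vset s'. v < j \<longrightarrow> col k s (vset s' - {v})"
      using 9(2) by blast+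
    have Q: "agree {0, 1, 2, 3, 4, 11} s' s''" "s'' 5 = (s' 5)(j := of_bool (col k s' (vset s' - {j})))"
      using 9(4,6) by auto
    have ag: "agree {0, 1, 2, 3, 4} s s''" by (rule agree_trans[OF I(1) Q(1)]) simp
    note g1 = agree_graph[OF I(1)] and g2 = agree_graph[OF ag]
    have j: "s' 5 j = 1" "j < s 2 0" using I(3) 9(3) by auto
    have vs: "vset s'' = (if col k s (vset s' - {j}) then vset s' else vset s' - {j})"
      using j g1 g2 Q(2) unfolding vset_def by (auto split: if_splits)
    have "\<not> col k s (vset s'')" using vs I(4) by (auto split: if_splits)
    moreover have "col k s (vset s'' - {v})" if v: "v \<in> vset s''" "v < Suc j" for v
    proof (cases "v = j")
      case True
      then show ?thesis using v vs by (auto split: if_splits)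
    next
      case False
      then have "v \<in> vset s'" "v < j" using v vs by (auto split: if_splits)
      then have "col k s (vset s' - {v})" using I(5) by blast
      then show ?thesis by (rule colourable_on_subset) (use vs in \<open>auto split: if_splits\<close>)
    qed
    moreover have "\<forall>i<Suc j. s'' 5 i \<le> 1" using I(2) Q(2) by (auto simp: less_Suc_eq)
    moreover have "\<forall>i. Suc j \<le> i \<and> i < s 2 0 \<longrightarrow> s'' 5 i = 1" using I(3) Q(2) by auto
    moreover have "agree {0, 1, 2, 3, 4} s (set_var s'' 11 (Suc j))" using ag unfolding agree_def by simp
    ultimately show ?case unfolding v11 by simp
  next
    case (10 s s')
    then have "\<forall>v\<in>vset s'. v < s 2 0" using agree_graph(3)[of _ s s'] unfolding vset_def by auto
    then show ?case using 10(2) unfolding critical_set_def by blast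
  qed (use w in fastforce)+
qed

definition prepare :: "nat \<Rightarrow> com" where
  "prepare k = Seq (assign 3 (Num k)) (Seq (assign 8 (Num 1))
     (For 9 2 (Seq (Write 4 (var 9) (var 8)) (assign 8 (Plus (var 8) (var 2))))))"

definition is_prepared :: "nat \<Rightarrow> state \<Rightarrow> state \<Rightarrow> bool" where
  "is_prepared k s r \<longleftrightarrow> agree {0, 1, 2, 5, 15} s r \<and> r 3 0 = k \<and>
     (\<forall>i<s 2 0. r 4 i = 1 + i * s 2 0) \<and> r 8 0 = 1 + s 2 0 * s 2 0"

lemma spec_prepare:
  "spec (\<lambda>s. True) (prepare k)
    (\<lambda>s s'. is_prepared k s s')"
proof -
  let ?c = "Seq (Write 4 (var 9) (var 8)) (assign 8 (Plus (var 8) (var 2)))"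
  have body: "spec (\<lambda>s. True) ?c
    (\<lambda>s s'. s' 4 = (s 4)(s 9 0 := s 8 0) \<and> s' 8 0 = s 8 0 + s 2 0)"
    by (rule spec_Seq[OF spec_Write spec_Write]) auto
  have loop: "spec (\<lambda>s. s 8 0 = 1) (For 9 2 ?c)
    (\<lambda>s s'. (\<forall>i<s 2 0. s' 4 i = 1 + i * s 2 0) \<and> s' 8 0 = 1 + s 2 0 * s 2 0)"
  proof (rule spec_For[OF body, where q = "[:0, 1:]" and
        I = "\<lambda>s j s'. (\<forall>i<j. s' 4 i = 1 + i * s 2 0) \<and> s' 8 0 = 1 + j * s 2 0"], goal_cases)
    case (9 s j s' s'')
    have "s' 2 = s 2" using frameD[OF 9(5), of 2] by simp
    then show ?case using 9 by (auto simp: less_Suc_eq)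
  qed auto
  have a8: "spec (\<lambda>s. True) (assign 8 (Num 1)) (\<lambda>s s'. s' = set_var s 8 1)"
    by (rule spec_weaken[OF spec_Write]) auto
  have a3: "spec (\<lambda>s. True) (assign 3 (Num k)) (\<lambda>s s'. s' = set_var s 3 k)"
    by (rule spec_weaken[OF spec_Write]) auto
  have rest: "spec (\<lambda>s. True) (Seq (assign 8 (Num 1)) (For 9 2 ?c))
    (\<lambda>s s'. agree {0, 1, 2, 3, 5, 15} s s' \<and> (\<forall>i<s 2 0. s' 4 i = 1 + i * s 2 0) \<and> s' 8 0 = 1 + s 2 0 * s 2 0)"
  proof (rule spec_weaken[OF spec_Seq_simple[OF a8 loop]])
    fix s s'' assume "\<exists>s'. s' = set_var s 8 1 \<and>
      (\<forall>i<s' 2 0. s'' 4 i = 1 + i * s' 2 0) \<and> s'' 8 0 = 1 + s' 2 0 * s' 2 0"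
      and fr: "frame (writes (Seq (assign 8 (Num 1)) (For 9 2 ?c))) s s''"
    moreover have "agree {0, 1, 2, 3, 5, 15} s s''" by (rule agree_frame[OF fr]) auto
    ultimately show "agree {0, 1, 2, 3, 5, 15} s s'' \<and> (\<forall>i<s 2 0. s'' 4 i = 1 + i * s 2 0) \<and> s'' 8 0 = 1 + s 2 0 * s 2 0"
      by simp
  qed auto
  show ?thesis unfolding prepare_def
  proof (rule spec_Seq[OF a3 rest])
    fix s s' s'' assume s': "s' = set_var s 3 k"
      and r: "agree {0, 1, 2, 3, 5, 15} s' s'' \<and> (\<forall>i<s' 2 0. s'' 4 i = 1 + i * s' 2 0) \<and> s'' 8 0 = 1 + s' 2 0 * s' 2 0"
    have "s'' 3 = s' 3" using agreeD[OF conjunct1[OF r], of 3] by simp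
    moreover have "agree {0, 1, 2, 5, 15} s s''"
      by (rule agree_trans[OF _ conjunct1[OF r], of "{0, 1, 2, 5, 15}"]) (simp_all add: agree_def s')
    ultimately show "is_prepared k s s''"
      using r s' unfolding is_prepared_def by simp
  qed simp_all
qed

text \<open>Adjacency in terms of the input word alone, that is, before the row offsets are computed.\<close>

definition adj :: "state \<Rightarrow> nat \<Rightarrow> nat \<Rightarrow> bool" where
  "adj s u v \<longleftrightarrow> u < s 2 0 \<and> v < s 2 0 \<and> 0 < s 0 (1 + u * s 2 0 + v)"

definition input_ok :: "state \<Rightarrow> bool" where
  "input_ok s \<longleftrightarrow> cogem_house_free {..<s 2 0} (adj s)"

lemma prepared:
  assumes "is_prepared k s s'"
  shows "s' 2 = s 2" "input_edge s' = adj s" "input_ok s \<Longrightarrow> valid k s'"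
proof -
  have eq: "s' 0 = s 0" "s' 2 = s 2" using assms unfolding is_prepared_def agree_def by auto
  show "s' 2 = s 2" by (rule eq)
  show input_edge: "input_edge s' = adj s"
    unfolding input_edge_def adj_def eq using assms unfolding is_prepared_def by (intro ext) auto
  show "valid k s'" if "input_ok s"
    using that assms unfolding valid_def input_ok_def input_edge eq is_prepared_def by simp
qed

definition write_output :: "nat \<Rightarrow> aexp \<Rightarrow> com" where
  "write_output t e = Seq (Write 0 (Num 0) (Num t))
     (Seq (For 9 2 (Write 0 (Plus (Num 1) (var 9)) e)) (assign 1 (Plus (var 2) (Num 1))))"

lemma spec_write_output:
  assumes e: "\<And>s s'. (\<And>a. a \<in> {2, 5, 6, 7} \<Longrightarrow> s' a = s a) \<Longrightarrow> s' 9 0 = s 9 0 \<Longrightarrow> aval e s' = aval e s"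
  shows "spec (\<lambda>s. True) (write_output t e)
    (\<lambda>s s'. output_word s' = t # map (\<lambda>i. aval e (set_var s 9 i)) [0..<s 2 0])"
proof -
  have w: "spec (\<lambda>s. True) (Write 0 (Num 0) (Num t)) (\<lambda>s s'. s' = set_var s 0 t)"
    by (rule spec_weaken[OF spec_Write]) auto
  have l: "spec (\<lambda>s. True) (assign 1 (Plus (var 2) (Num 1))) (\<lambda>s s'. s' = set_var s 1 (s 2 0 + 1))"
    by (rule spec_weaken[OF spec_Write]) auto
  have loop: "spec (\<lambda>s. True) (For 9 2 (Write 0 (Plus (Num 1) (var 9)) e))
    (\<lambda>s s'. s' 2 = s 2 \<and> s' 0 0 = s 0 0 \<and> (\<forall>i<s 2 0. s' 0 (Suc i) = aval e (set_var s 9 i)))"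
  proof (rule spec_For[OF spec_Write, where q = "[:0, 1:]" and
        I = "\<lambda>s j s'. s' 0 0 = s 0 0 \<and> (\<forall>i<j. s' 0 (Suc i) = aval e (set_var s 9 i))"], goal_cases)
    case (9 s j s' s'')
    have "aval e s' = aval e (set_var s 9 j)"
      by (rule e) (use 9(4) frameD[OF 9(5)] in auto)
    then show ?case using 9(2,4,6) by (auto simp: less_Suc_eq)
  next
    case (10 s s')
    then show ?case using frameD[OF 10(3), of 2] by simp
  qed auto
  have e0: "aval e (set_var (set_var s 0 t) 9 i) = aval e (set_var s 9 i)" for s i
    by (rule e) auto
  show ?thesis unfolding write_output_def
  proof (rule spec_weaken[OF spec_Seq_simple[OF w spec_Seq_simple[OF loop l]]])
    fix s r
    assume "\<exists>s'. s' = set_var s 0 t \<and> (\<exists>s''. (s'' 2 = s' 2 \<and> s'' 0 0 = s' 0 0 \<and>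
      (\<forall>i<s' 2 0. s'' 0 (Suc i) = aval e (set_var s' 9 i))) \<and> r = set_var s'' 1 (s'' 2 0 + 1))"
    then obtain s'' where s'': "s'' 2 = s 2" "s'' 0 0 = t"
      "\<forall>i<s 2 0. s'' 0 (Suc i) = aval e (set_var s 9 i)" and r: "r = set_var s'' 1 (s'' 2 0 + 1)"
      using e0 by auto
    show "output_word r = t # map (\<lambda>i. aval e (set_var s 9 i)) [0..<s 2 0]"
    proof (rule nth_equalityI)
      show "length (output_word r) = length (t # map (\<lambda>i. aval e (set_var s 9 i)) [0..<s 2 0])"
        unfolding output_word_def r s''(1) by simp
      fix i assume "i < length (output_word r)"
      then have "i < Suc (s 2 0)" unfolding output_word_def r s''(1) by simp
      then show "output_word r ! i = (t # map (\<lambda>i. aval e (set_var s 9 i)) [0..<s 2 0]) ! i"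
        unfolding output_word_def r using s'' by (cases i) (simp_all del: upt_Suc)
    qed
  qed auto
qed

definition solve :: "nat \<Rightarrow> com" where
  "solve k = Seq (prepare k) (Seq (For 9 2 (Write 5 (var 9) (Num 1))) (Seq (colour_set k)
     (Cond (Less (var 30) (Num 1)) (Seq (minimise k) (write_output 1 (Read 5 (var 9))))
        (write_output 0 (Read 7 (Rep 9))))))"

lemma writes_prepare: "writes (prepare k) = {3, 4, 8, 9}"
  unfolding prepare_def by auto

lemma spec_fill:
  "spec (\<lambda>s. True) (For 9 2 (Write 5 (var 9) (Num 1)))
    (\<lambda>s s'. agree {0, 1, 2, 3, 4} s s' \<and> (\<forall>i<s 2 0. s' 5 i = 1))"
proof (rule spec_For[OF spec_Write, where q = "[:0, 1:]" and I = "\<lambda>s j s'. \<forall>i<j. s' 5 i = 1"], goal_cases)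
  case (9 s j s' s'')
  then show ?case by (auto simp: less_Suc_eq)
next
  case (10 s s')
  have "agree {0, 1, 2, 3, 4} s s'" by (rule agree_frame[OF 10(3)]) auto
  then show ?case using 10 by blast
qed auto

definition solved :: "nat \<Rightarrow> state \<Rightarrow> state \<Rightarrow> bool" where
  "solved k s s' \<longleftrightarrow>
     (\<exists>f. (\<forall>u<s 2 0. f u < k) \<and> (\<forall>u v. adj s u v \<longrightarrow> f u \<noteq> f v) \<and> output_word s' = 0 # map f [0..<s 2 0]) \<or>
     (\<exists>S\<subseteq>{..<s 2 0}. \<not> colourable_on (adj s) k S \<and> (\<forall>v\<in>S. colourable_on (adj s) k (S - {v})) \<and>
        output_word s' = 1 # map (\<lambda>v. of_bool (v \<in> S)) [0..<s 2 0])"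

lemma spec_solve: "spec input_ok (solve k) (solved k)"
proof -
  let ?crit = "Seq (minimise k) (write_output 1 (Read 5 (var 9)))"
  have out: "spec (\<lambda>s. True) (write_output 1 (Read 5 (var 9)))
    (\<lambda>s s'. output_word s' = 1 # map (\<lambda>i. s 5 i) [0..<s 2 0])"
    by (rule spec_weaken[OF spec_write_output]) auto
  have crit: "spec (\<lambda>s. valid k s \<and> (\<forall>i<s 2 0. s 5 i = 1) \<and> \<not> col k s (vset s)) ?crit
    (\<lambda>s s''. \<exists>S\<subseteq>{..<s 2 0}. critical_set k s S \<and> output_word s'' = 1 # map (\<lambda>v. of_bool (v \<in> S)) [0..<s 2 0])"
  proof (rule spec_Seq[OF spec_minimise out])
    show "2 \<notin> writes (minimise k)" unfolding minimise_def using writes_drop_vertex[of 2 k] by auto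
    fix s s' s''
    assume 1: "agree {0, 1, 2, 3, 4} s s' \<and> (\<forall>i<s 2 0. s' 5 i \<le> 1) \<and> critical_set k s (vset s')"
      and 2: "output_word s'' = 1 # map (\<lambda>i. s' 5 i) [0..<s' 2 0]"
    have eq: "s' 2 = s 2" using agree_graph(3)[OF conjunct1[OF 1]] by simp
    have "s' 5 i = of_bool (i \<in> vset s')" if "i < s 2 0" for i
    proof -
      have "s' 5 i \<le> 1" using 1 that by blast
      then show ?thesis using that unfolding vset_def eq by (cases "s' 5 i") auto
    qed
    then have "output_word s'' = 1 # map (\<lambda>v. of_bool (v \<in> vset s')) [0..<s 2 0]"
      using 2 unfolding eq by simp
    moreover have "vset s' \<subseteq> {..<s 2 0}" unfolding vset_def eq by auto
    ultimately show "\<exists>S\<subseteq>{..<s 2 0}. critical_set k s S \<and> output_word s'' = 1 # map (\<lambda>v. of_bool (v \<in> S)) [0..<s 2 0]"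
      using 1 by blast
  qed simp
  let ?Q = "\<lambda>s s''.
     (\<exists>f. (\<forall>u\<in>vset s. f u < k) \<and> (\<forall>u\<in>vset s. \<forall>v\<in>vset s. input_edge s u v \<longrightarrow> f u \<noteq> f v) \<and> output_word s'' = 0 # map f [0..<s 2 0]) \<or>
     (\<exists>S\<subseteq>{..<s 2 0}. critical_set k s S \<and> output_word s'' = 1 # map (\<lambda>v. of_bool (v \<in> S)) [0..<s 2 0])"
  let ?P = "\<lambda>s. valid k s \<and> (\<forall>i<s 2 0. s 5 i = 1)"
  have good_out: "spec (\<lambda>s. True) (write_output 0 (Read 7 (Rep 9)))
    (\<lambda>s s'. output_word s' = 0 # map (\<lambda>i. s 7 (s 6 i)) [0..<s 2 0])"
    by (rule spec_weaken[OF spec_write_output]) auto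
  let ?R = "\<lambda>s s''. if s 30 0 = 0 then \<exists>S\<subseteq>{..<s 2 0}. critical_set k s S \<and> output_word s'' = 1 # map (\<lambda>v. of_bool (v \<in> S)) [0..<s 2 0]
       else output_word s'' = 0 # map (\<lambda>i. s 7 (s 6 i)) [0..<s 2 0]"
  have branch: "spec (\<lambda>s. s 30 0 = 0 \<longrightarrow> ?P s \<and> \<not> col k s (vset s))
     (Cond (Less (var 30) (Num 1)) ?crit (write_output 0 (Read 7 (Rep 9)))) ?R"
  proof (rule spec_Cond)
    show "spec (\<lambda>s. (s 30 0 = 0 \<longrightarrow> ?P s \<and> \<not> col k s (vset s)) \<and> bval (Less (var 30) (Num 1)) s) ?crit ?R"
      by (rule spec_weaken[OF crit]) simp_all
    show "spec (\<lambda>s. (s 30 0 = 0 \<longrightarrow> ?P s \<and> \<not> col k s (vset s)) \<and> \<not> bval (Less (var 30) (Num 1)) s)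
      (write_output 0 (Read 7 (Rep 9))) ?R"
      by (rule spec_weaken[OF good_out]) simp_all
  qed
  have c0: "spec ?P (colour_set k)
    (\<lambda>s s'. agree {0, 1, 2, 3, 4, 5, 8, 11, 15} s s' \<and> s' 30 0 = of_bool (col k s (vset s)) \<and>
      (col k s (vset s) \<longrightarrow> (\<forall>u\<in>vset s. s' 7 (s' 6 u) < k) \<and>
        (\<forall>u\<in>vset s. \<forall>v\<in>vset s. input_edge s u v \<longrightarrow> s' 7 (s' 6 u) \<noteq> s' 7 (s' 6 v))))"
    by (rule spec_weaken[OF spec_colour_set]) blast+
  have c_branch: "spec ?P (Seq (colour_set k) (Cond (Less (var 30) (Num 1)) ?crit (write_output 0 (Read 7 (Rep 9))))) ?Q"
  proof (rule spec_Seq[OF c0 branch])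
    show "2 \<notin> writes (colour_set k)" using writes_colour[of 2 "2 * k" "core_bound k"] by auto
    fix s s' assume P: "?P s"
    assume 1: "agree {0, 1, 2, 3, 4, 5, 8, 11, 15} s s' \<and> s' 30 0 = of_bool (col k s (vset s)) \<and>
      (col k s (vset s) \<longrightarrow> (\<forall>u\<in>vset s. s' 7 (s' 6 u) < k) \<and>
        (\<forall>u\<in>vset s. \<forall>v\<in>vset s. input_edge s u v \<longrightarrow> s' 7 (s' 6 u) \<noteq> s' 7 (s' 6 v)))"
    have g: "input_edge s' = input_edge s" "valid k s' = valid k s" "s' 2 = s 2"
      using agree_graph[OF conjunct1[OF 1]] by simp_all
    have s5: "s' 5 = s 5" using agreeD[OF conjunct1[OF 1], of 5] by simp
    have vs: "vset s' = vset s" using g(3) s5 unfolding vset_def by simp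
    show "s' 30 0 = 0 \<longrightarrow> ?P s' \<and> \<not> col k s' (vset s')"
      using 1 P unfolding g vs s5 by simp
    fix s'' assume R: "?R s' s''"
    show "?Q s s''"
    proof (cases "col k s (vset s)")
      case True
      then have "output_word s'' = 0 # map (\<lambda>i. s' 7 (s' 6 i)) [0..<s 2 0]" using R 1 g(3) by simp
      with 1 True have "(\<forall>u\<in>vset s. s' 7 (s' 6 u) < k) \<and>
        (\<forall>u\<in>vset s. \<forall>v\<in>vset s. input_edge s u v \<longrightarrow> s' 7 (s' 6 u) \<noteq> s' 7 (s' 6 v)) \<and>
        output_word s'' = 0 # map (\<lambda>i. s' 7 (s' 6 i)) [0..<s 2 0]" by simp
      then show ?thesis by (intro disjI1 exI[of _ "\<lambda>i. s' 7 (s' 6 i)"])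
    next
      case False
      then have "\<exists>S\<subseteq>{..<s 2 0}. critical_set k s' S \<and> output_word s'' = 1 # map (\<lambda>v. of_bool (v \<in> S)) [0..<s 2 0]"
        using R 1 g(3) by simp
      then show ?thesis unfolding critical_set_def g by (rule disjI2)
    qed
  qed
  have f0: "spec (valid k) (For 9 2 (Write 5 (var 9) (Num 1)))
    (\<lambda>s s'. agree {0, 1, 2, 3, 4} s s' \<and> (\<forall>i<s 2 0. s' 5 i = 1))"
    by (rule spec_weaken[OF spec_fill]) blast+
  have f_branch: "spec (valid k) (Seq (For 9 2 (Write 5 (var 9) (Num 1))) (Seq (colour_set k) (Cond (Less (var 30) (Num 1)) ?crit (write_output 0 (Read 7 (Rep 9))))))
    (\<lambda>s s''. \<exists>s'. agree {0, 1, 2, 3, 4} s s' \<and> (\<forall>i<s 2 0. s' 5 i = 1) \<and> ?Q s' s'')"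
  proof (rule spec_Seq[OF f0 c_branch])
    fix s s' assume v: "valid k s" and 1: "agree {0, 1, 2, 3, 4} s s' \<and> (\<forall>i<s 2 0. s' 5 i = 1)"
    have "input_edge s' = input_edge s" "valid k s' = valid k s" "s' 2 = s 2"
      using agree_graph[OF conjunct1[OF 1]] by simp_all
    then show "?P s'" using v 1 by simp
    fix s'' assume "?Q s' s''"
    with 1 show "\<exists>s'. agree {0, 1, 2, 3, 4} s s' \<and> (\<forall>i<s 2 0. s' 5 i = 1) \<and> ?Q s' s''"
      by (intro exI[of _ s'] conjI) simp_all
  qed simp
  have p0: "spec input_ok (prepare k)
    (\<lambda>s s'. is_prepared k s s')"
    by (rule spec_weaken[OF spec_prepare]) blast+
  show ?thesis unfolding solve_def
  proof (rule spec_Seq[OF p0 f_branch])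
    show "2 \<notin> writes (prepare k)" unfolding writes_prepare by simp
    fix s s' assume ok: "input_ok s"
      and 1: "is_prepared k s s'"
    note p = prepared[OF 1]
    show "valid k s'" by (rule p(3)[OF ok])
    fix s3 assume "\<exists>s2. agree {0, 1, 2, 3, 4} s' s2 \<and> (\<forall>i<s' 2 0. s2 5 i = 1) \<and> ?Q s2 s3"
    then obtain s2 where 2: "agree {0, 1, 2, 3, 4} s' s2" "\<forall>i<s' 2 0. s2 5 i = 1" and Q: "?Q s2 s3"
      by (elim exE conjE)
    have g: "input_edge s2 = input_edge s'" "s2 2 = s' 2" using agree_graph[OF 2(1)] by simp_all
    have fl: "input_edge s2 = adj s" and n: "s2 2 0 = s 2 0" using g p by auto
    have vs: "vset s2 = {..<s 2 0}" using 2(2) unfolding vset_def n using p(1) by auto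
    from Q show "solved k s s3"
    proof
      assume "\<exists>f. (\<forall>u\<in>vset s2. f u < k) \<and> (\<forall>u\<in>vset s2. \<forall>v\<in>vset s2. input_edge s2 u v \<longrightarrow> f u \<noteq> f v) \<and>
        output_word s3 = 0 # map f [0..<s2 2 0]"
      then obtain f where f: "\<forall>u\<in>vset s2. f u < k"
        "\<forall>u\<in>vset s2. \<forall>v\<in>vset s2. input_edge s2 u v \<longrightarrow> f u \<noteq> f v" "output_word s3 = 0 # map f [0..<s2 2 0]"
        by (elim exE conjE)
      have "\<forall>u<s 2 0. f u < k" "\<forall>u v. adj s u v \<longrightarrow> f u \<noteq> f v"
        using f(1,2) unfolding vs fl by (simp_all add: adj_def)
      then show ?thesis unfolding solved_def using f(3) n by (intro disjI1 exI[of _ f]) simp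
    next
      assume "\<exists>S\<subseteq>{..<s2 2 0}. critical_set k s2 S \<and> output_word s3 = 1 # map (\<lambda>v. of_bool (v \<in> S)) [0..<s2 2 0]"
      then show ?thesis unfolding solved_def critical_set_def fl n by (intro disjI2) simp
    qed
  qed
qed

abbreviation Entry :: "aexp \<Rightarrow> aexp" where
  "Entry e \<equiv> Read 0 (Plus (var 8) (Plus (Num 1) e))"

definition entry :: "state \<Rightarrow> nat \<Rightarrow> nat" where
  "entry s u = s 0 (s 8 0 + (1 + u))"

definition proper_fm :: fm where
  "proper_fm =
     Cj (All 16 (At (Less (Entry (var 16)) (var 3))))
        (All 16 (All 17 (Im (Adjacent (var 16) (var 17)) (Nt (Equal (Entry (var 16)) (Entry (var 17)))))))"

definition bits_fm :: fm where
  "bits_fm = All 16 (At (Less (Entry (var 16)) (Num 2)))"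

lemma sem_proper_fm:
  "sem proper_fm s \<longleftrightarrow> (\<forall>u<s 2 0. entry s u < s 3 0) \<and> (\<forall>u v. input_edge s u v \<longrightarrow> entry s u \<noteq> entry s v)"
proof -
  have "sem proper_fm s \<longleftrightarrow> (\<forall>u<s 2 0. entry s u < s 3 0) \<and>
      (\<forall>u<s 2 0. \<forall>v<s 2 0. 0 < s 0 (s 4 u + v) \<longrightarrow> entry s u \<noteq> entry s v)"
    unfolding proper_fm_def entry_def by simp
  then show ?thesis unfolding input_edge_def by blast
qed

lemma sem_bits_fm: "sem bits_fm s \<longleftrightarrow> (\<forall>u<s 2 0. entry s u \<le> 1)"
proof -
  have "sem bits_fm s \<longleftrightarrow> (\<forall>u<s 2 0. entry s u < 2)"
    unfolding bits_fm_def entry_def by simp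
  also have "\<dots> \<longleftrightarrow> (\<forall>u<s 2 0. entry s u \<le> 1)"
    by (simp add: less_Suc_eq_le[symmetric] numeral_2_eq_2)
  finally show ?thesis .
qed

lemma certificate_fm_ok:
  "clean proper_fm" "bnd proper_fm = {16, 17}" "fv proper_fm = {0, 2, 3, 4, 8}" "size proper_fm < 70"
  "clean bits_fm" "bnd bits_fm = {16}" "fv bits_fm = {0, 2, 8}" "size bits_fm < 70"
  unfolding proper_fm_def bits_fm_def Im_def Equal_def by auto

lemma spec_test_proper:
  "spec (\<lambda>s. True) (test proper_fm 30) (\<lambda>s s'. s' 30 0 = of_bool (sem proper_fm s))"
  by (rule spec_weaken[OF spec_test[of proper_fm 30]]) (use certificate_fm_ok in auto)

lemma spec_test_bits:
  "spec (\<lambda>s. True) (test bits_fm 30) (\<lambda>s s'. s' 30 0 = of_bool (sem bits_fm s))"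
  by (rule spec_weaken[OF spec_test[of bits_fm 30]]) (use certificate_fm_ok in auto)

lemma writes_test_fm:
  "a \<in> writes (test proper_fm 30) \<Longrightarrow> a = 16 \<or> a = 17 \<or> 30 \<le> a"
  "a \<in> writes (test bits_fm 30) \<Longrightarrow> a = 16 \<or> a = 17 \<or> 30 \<le> a"
  using writes_test[of proper_fm 30] writes_test[of bits_fm 30] certificate_fm_ok by fastforce+

definition load :: com where
  "load = For 9 2 (Write 5 (var 9) (Entry (var 9)))"

lemma spec_load:
  "spec (\<lambda>s. True) load (\<lambda>s s'. agree {0, 1, 2, 3, 4, 8, 15} s s' \<and> (\<forall>i<s 2 0. s' 5 i = entry s i))"
  unfolding load_def
proof (rule spec_For[OF spec_Write, where q = "[:0, 1:]" and I = "\<lambda>s j s'. \<forall>i<j. s' 5 i = entry s i"], goal_cases)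
  case (9 s j s' s'')
  have "s' 0 = s 0" "s' 8 = s 8" using frameD[OF 9(5)] by simp_all
  then show ?case using 9 by (auto simp: less_Suc_eq entry_def)
next
  case (10 s s')
  have "agree {0, 1, 2, 3, 4, 8, 15} s s'" by (rule agree_frame[OF 10(3)]) auto
  then show ?case using 10 by blast
qed auto

text \<open>The vertex is selected again afterwards, so that every round tests the same set.\<close>

definition retest :: "nat \<Rightarrow> com" where
  "retest k = Cond (Less (Num 0) (Read 5 (var 11)))
     (Seq (drop_vertex k) (Seq (Cond (Less (var 30) (Num 1)) (assign 15 (Num 0)) Skip)
       (Write 5 (var 11) (Num 1)))) Skip"

lemma writes_retest: "a \<in> writes (retest k) \<Longrightarrow> a \<in> {5, 6, 7, 9, 10, 15, 16, 17} \<or> 30 \<le> a"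
  using writes_drop_vertex[of a k] unfolding retest_def by auto

lemma spec_retest:
  "spec (\<lambda>s. valid k s \<and> s 5 (s 11 0) \<le> 1) (retest k)
    (\<lambda>s s'. s' 5 = s 5 \<and>
      s' 15 0 = (if 0 < s 5 (s 11 0) \<and> \<not> col k s (vset s - {s 11 0}) then 0 else s 15 0))"
proof -
  have w: "spec (\<lambda>s. True) (Write 5 (var 11) (Num 1)) (\<lambda>s s'. s' = s(5 := (s 5)(s 11 0 := 1)))"
    by (rule spec_weaken[OF spec_Write]) auto
  have r: "spec (\<lambda>s. True) (Cond (Less (var 30) (Num 1)) (assign 15 (Num 0)) Skip)
     (\<lambda>s s'. s' = (if s 30 0 = 0 then set_var s 15 0 else s))"
    by (rule spec_Cond; rule spec_weaken, rule spec_Write spec_Skip) auto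
  have rw: "spec (\<lambda>s. True) (Seq (Cond (Less (var 30) (Num 1)) (assign 15 (Num 0)) Skip) (Write 5 (var 11) (Num 1)))
     (\<lambda>s s'. s' 5 = (s 5)(s 11 0 := 1) \<and> s' 15 0 = (if s 30 0 = 0 then 0 else s 15 0))"
    by (rule spec_weaken[OF spec_Seq_simple[OF r w]]) auto
  have seq: "spec (valid k) (Seq (drop_vertex k) (Seq (Cond (Less (var 30) (Num 1)) (assign 15 (Num 0)) Skip) (Write 5 (var 11) (Num 1))))
     (\<lambda>s s'. s' 5 = (s 5)(s 11 0 := 1) \<and> s' 15 0 = (if \<not> col k s (vset s - {s 11 0}) then 0 else s 15 0))"
  proof (rule spec_Seq[OF spec_drop_vertex rw])
    show "2 \<notin> writes (drop_vertex k)" using writes_drop_vertex[of 2 k] by auto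
    fix s s' s''
    assume 1: "agree {0, 1, 2, 3, 4, 8, 11, 15} s s' \<and> s' 5 = (s 5)(s 11 0 := 0) \<and>
      s' 30 0 = of_bool (col k s (vset s - {s 11 0}))"
      and 2: "s'' 5 = (s' 5)(s' 11 0 := 1) \<and> s'' 15 0 = (if s' 30 0 = 0 then 0 else s' 15 0)"
    have "s' 11 = s 11" "s' 15 = s 15" using agreeD[OF conjunct1[OF 1]] by simp_all
    then show "s'' 5 = (s 5)(s 11 0 := 1) \<and> s'' 15 0 = (if \<not> col k s (vset s - {s 11 0}) then 0 else s 15 0)"
      using 1 2 by simp
  qed simp
  have one: "(f :: nat \<Rightarrow> nat)(i := 1) = f" if "0 < f i" "f i \<le> 1" for f i
    using that by (simp add: fun_upd_idem)
  show ?thesis unfolding retest_def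
  proof (rule spec_Cond, goal_cases)
    case 1
    show ?case by (rule spec_weaken[OF seq]) (use one in auto)
  next
    case 2
    show ?case by (rule spec_weaken[OF spec_Skip]) auto
  qed
qed

definition test_critical :: "nat \<Rightarrow> com" where
  "test_critical k = Seq load (Seq (colour_set k)
     (Seq (assign 15 (Minus (Num 1) (var 30))) (For 11 2 (retest k))))"

lemma spec_test_critical:
  "spec (\<lambda>s. valid k s \<and> (\<forall>u<s 2 0. entry s u \<le> 1)) (test_critical k)
    (\<lambda>s s'. s' 15 0 = of_bool (critical_set k s {u. u < s 2 0 \<and> 0 < entry s u}))"
proof -
  have loop: "spec (\<lambda>s. valid k s \<and> (\<forall>i<s 2 0. s 5 i \<le> 1)) (For 11 2 (retest k))
    (\<lambda>s s'. s' 15 0 = (if \<forall>v\<in>vset s. col k s (vset s - {v}) then s 15 0 else 0))"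
  proof (rule spec_For[OF spec_retest, where q = "[:0, 1:]" and
        I = "\<lambda>s j s'. agree {0, 2, 3, 4} s s' \<and> s' 5 = s 5 \<and>
          s' 15 0 = (if \<forall>v\<in>vset s. v < j \<longrightarrow> col k s (vset s - {v}) then s 15 0 else 0)"], goal_cases)
    case (7 s)
    then show ?case by (simp add: agree_def)
  next
    case (8 s j s')
    then have "agree {0, 2, 3, 4} s s'" by blast
    then show ?case using agree_graph(2)[of _ s s' k] 8 by auto
  next
    case (9 s j s' s'')
    have I: "agree {0, 2, 3, 4} s s'" "s' 5 = s 5"
      "s' 15 0 = (if \<forall>v\<in>vset s. v < j \<longrightarrow> col k s (vset s - {v}) then s 15 0 else 0)" using 9(2) by blast+
    have g: "input_edge s' = input_edge s" "s' 2 = s 2" using agree_graph[OF I(1)] by simp_all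
    have vs: "vset s' = vset s" unfolding vset_def g(2) I(2) ..
    have ag': "agree {0, 2, 3, 4} s' s''"
      by (rule agree_frame[OF 9(7)]) (use writes_retest[of _ k] in fastforce)
    have "agree {0, 2, 3, 4} s s''" by (rule agree_trans[OF I(1) ag']) simp
    then have "agree {0, 2, 3, 4} s (set_var s'' 11 (Suc j))" unfolding agree_def by simp
    moreover have "s'' 5 = s 5" using 9(6) I(2) by simp
    moreover have "s'' 15 0 = (if j \<in> vset s \<and> \<not> col k s (vset s - {j}) then 0 else s' 15 0)"
      using 9(3,4,6) I(2) unfolding vs g(1) by (simp add: vset_def)
    then have "s'' 15 0 = (if \<forall>v\<in>vset s. v < Suc j \<longrightarrow> col k s (vset s - {v}) then s 15 0 else 0)"
      unfolding I(3) by (auto simp: less_Suc_eq)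
    ultimately show ?case by simp
  next
    case (10 s s')
    have "(\<forall>v\<in>vset s. v < s 2 0 \<longrightarrow> col k s (vset s - {v})) \<longleftrightarrow> (\<forall>v\<in>vset s. col k s (vset s - {v}))"
      unfolding vset_def by blast
    then show ?case using 10(2) by simp
  qed (use writes_retest[of _ k] in fastforce)+
  let ?P = "\<lambda>s. valid k s \<and> (\<forall>i<s 2 0. s 5 i \<le> 1)"
  have a: "spec ?P (assign 15 (Minus (Num 1) (var 30))) (\<lambda>s s'. s' = set_var s 15 (1 - s 30 0))"
    by (rule spec_weaken[OF spec_Write]) auto
  have al: "spec ?P (Seq (assign 15 (Minus (Num 1) (var 30))) (For 11 2 (retest k)))
    (\<lambda>s s'. s' 15 0 = (if \<forall>v\<in>vset s. col k s (vset s - {v}) then 1 - s 30 0 else 0))"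
  proof (rule spec_Seq[OF a loop])
    fix s s' assume P: "?P s" and s': "s' = set_var s 15 (1 - s 30 0)"
    have ag: "agree {0, 2, 3, 4} s s'" unfolding s' agree_def by simp
    have g: "input_edge s' = input_edge s" "valid k s' = valid k s" using agree_graph[OF ag] by simp_all
    have vs: "vset s' = vset s" unfolding vset_def s' by simp
    show "?P s'" using P g(2) by (simp add: s')
    fix s'' assume "s'' 15 0 = (if \<forall>v\<in>vset s'. col k s' (vset s' - {v}) then s' 15 0 else 0)"
    then show "s'' 15 0 = (if \<forall>v\<in>vset s. col k s (vset s - {v}) then 1 - s 30 0 else 0)"
      unfolding vs g(1) by (simp add: s')
  qed simp
  have c0: "spec ?P (colour_set k)
    (\<lambda>s s'. agree {0, 1, 2, 3, 4, 5, 8, 11, 15} s s' \<and> s' 30 0 = of_bool (col k s (vset s)))"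
    by (rule spec_weaken[OF spec_colour_set]) simp_all
  have cal: "spec ?P (Seq (colour_set k) (Seq (assign 15 (Minus (Num 1) (var 30))) (For 11 2 (retest k))))
    (\<lambda>s s'. s' 15 0 = of_bool (critical_set k s (vset s)))"
  proof (rule spec_Seq[OF c0 al])
    show "2 \<notin> writes (colour_set k)" using writes_colour[of 2 "2 * k" "core_bound k"] by auto
    fix s s' assume P: "?P s" and 1: "agree {0, 1, 2, 3, 4, 5, 8, 11, 15} s s' \<and> s' 30 0 = of_bool (col k s (vset s))"
    have g: "input_edge s' = input_edge s" "valid k s' = valid k s" "s' 2 = s 2"
      using agree_graph[OF conjunct1[OF 1]] by simp_all
    have s5: "s' 5 = s 5" using agreeD[OF conjunct1[OF 1], of 5] by simp
    have vs: "vset s' = vset s" unfolding vset_def g(3) s5 ..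
    show "?P s'" using P unfolding g s5 by simp
    fix s'' assume "s'' 15 0 = (if \<forall>v\<in>vset s'. col k s' (vset s' - {v}) then 1 - s' 30 0 else 0)"
    then show "s'' 15 0 = of_bool (critical_set k s (vset s))"
      using 1 unfolding vs g(1) critical_set_def by simp
  qed
  show ?thesis unfolding test_critical_def
  proof (rule spec_Seq[OF _ cal])
    show "spec (\<lambda>s. valid k s \<and> (\<forall>u<s 2 0. entry s u \<le> 1)) load
      (\<lambda>s s'. agree {0, 1, 2, 3, 4, 8, 15} s s' \<and> (\<forall>i<s 2 0. s' 5 i = entry s i))"
      by (rule spec_weaken[OF spec_load]) simp_all
    show "2 \<notin> writes load" unfolding load_def by simp
    fix s s' assume P: "valid k s \<and> (\<forall>u<s 2 0. entry s u \<le> 1)"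
      and 1: "agree {0, 1, 2, 3, 4, 8, 15} s s' \<and> (\<forall>i<s 2 0. s' 5 i = entry s i)"
    have g: "input_edge s' = input_edge s" "valid k s' = valid k s" "s' 2 = s 2"
      using agree_graph[OF conjunct1[OF 1]] by simp_all
    show "?P s'" using P 1 unfolding g by simp
    have vs: "vset s' = {u. u < s 2 0 \<and> 0 < entry s u}" unfolding vset_def g(3) using 1 by auto
    fix s'' assume "s'' 15 0 = of_bool (critical_set k s' (vset s'))"
    then show "s'' 15 0 = of_bool (critical_set k s {u. u < s 2 0 \<and> 0 < entry s u})"
      unfolding vs critical_set_def g(1) .
  qed
qed

abbreviation right_length :: bexp where
  "right_length \<equiv> Conj (Neg (Less (var 1) (Plus (var 8) (Plus (var 2) (Num 1)))))
     (Neg (Less (Plus (var 8) (Plus (var 2) (Num 1))) (var 1)))"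

definition check_certificate :: "nat \<Rightarrow> com" where
  "check_certificate k =
     Cond (Less (Read 0 (var 8)) (Num 1)) (Seq (test proper_fm 30) (assign 15 (var 30)))
       (Cond (Less (Read 0 (var 8)) (Num 2))
         (Seq (test bits_fm 30) (Cond (Less (var 30) (Num 1)) Skip (test_critical k))) Skip)"

definition verify :: "nat \<Rightarrow> com" where
  "verify k = Seq (prepare k) (Seq (assign 15 (Num 0)) (Seq (Cond right_length (check_certificate k) Skip)
     (Seq (Write 0 (Num 0) (var 15)) (assign 1 (Num 1)))))"

definition accepts :: "nat \<Rightarrow> state \<Rightarrow> bool" where
  "accepts k s \<longleftrightarrow>
     s 0 (s 8 0) = 0 \<and> (\<forall>u<s 2 0. entry s u < k) \<and> (\<forall>u v. input_edge s u v \<longrightarrow> entry s u \<noteq> entry s v) \<or>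
     s 0 (s 8 0) = 1 \<and> (\<forall>u<s 2 0. entry s u \<le> 1) \<and> critical_set k s {u. u < s 2 0 \<and> 0 < entry s u}"

lemma spec_check_certificate:
  "spec (\<lambda>s. valid k s \<and> s 15 0 = 0) (check_certificate k) (\<lambda>s s'. s' 15 0 = of_bool (accepts k s))"
proof -
  let ?P = "\<lambda>s. valid k s \<and> s 15 0 = 0"
  have a: "spec (\<lambda>s. True) (assign 15 (var 30)) (\<lambda>s s'. s' = set_var s 15 (s 30 0))"
    by (rule spec_weaken[OF spec_Write]) auto
  have p: "spec (\<lambda>s. True) (Seq (test proper_fm 30) (assign 15 (var 30))) (\<lambda>s s'. s' 15 0 = of_bool (sem proper_fm s))"
    by (rule spec_Seq[OF spec_test_proper a]) (use writes_test_fm(1)[of 2] in auto)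
  have c: "spec (\<lambda>s. s 30 0 \<noteq> 0 \<longrightarrow> valid k s \<and> (\<forall>u<s 2 0. entry s u \<le> 1)) (Cond (Less (var 30) (Num 1)) Skip (test_critical k))
    (\<lambda>s s'. s' 15 0 = (if s 30 0 = 0 then s 15 0 else of_bool (critical_set k s {u. u < s 2 0 \<and> 0 < entry s u})))"
  proof (rule spec_Cond, goal_cases)
    case 1
    show ?case by (rule spec_weaken[OF spec_Skip]) auto
  next
    case 2
    show ?case by (rule spec_weaken[OF spec_test_critical]) auto
  qed
  have b: "spec ?P (Seq (test bits_fm 30) (Cond (Less (var 30) (Num 1)) Skip (test_critical k)))
    (\<lambda>s s'. s' 15 0 = of_bool ((\<forall>u<s 2 0. entry s u \<le> 1) \<and> critical_set k s {u. u < s 2 0 \<and> 0 < entry s u}))"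
  proof (rule spec_Seq[OF _ c])
    show "spec ?P (test bits_fm 30) (\<lambda>s s'. s' 30 0 = of_bool (sem bits_fm s))"
      by (rule spec_weaken[OF spec_test_bits]) simp_all
    show "2 \<notin> writes (test bits_fm 30)" using writes_test_fm(2)[of 2] by auto
    fix s s' assume P: "?P s" and 1: "s' 30 0 = of_bool (sem bits_fm s)" and fr: "frame (writes (test bits_fm 30)) s s'"
    have ag: "agree {0, 2, 3, 4, 8, 15} s s'"
      by (rule agree_frame[OF fr]) (use writes_test_fm(2) in fastforce)
    have g: "input_edge s' = input_edge s" "valid k s' = valid k s" "s' 2 = s 2"
      using agree_graph[OF ag] by simp_all
    have en: "entry s' = entry s" using agreeD[OF ag, of 0] agreeD[OF ag, of 8] by (intro ext) (simp add: entry_def)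
    have s15: "s' 15 0 = 0" using agreeD[OF ag, of 15] P by simp
    show "s' 30 0 \<noteq> 0 \<longrightarrow> valid k s' \<and> (\<forall>u<s' 2 0. entry s' u \<le> 1)"
      using P 1 unfolding g en sem_bits_fm by simp
    fix s'' assume "s'' 15 0 = (if s' 30 0 = 0 then s' 15 0 else of_bool (critical_set k s' {u. u < s' 2 0 \<and> 0 < entry s' u}))"
    then show "s'' 15 0 = of_bool ((\<forall>u<s 2 0. entry s u \<le> 1) \<and> critical_set k s {u. u < s 2 0 \<and> 0 < entry s u})"
      using 1 s15 unfolding g en sem_bits_fm critical_set_def by simp
  qed
  show ?thesis unfolding check_certificate_def
  proof (rule spec_Cond, goal_cases)
    case 1
    show ?case
      by (rule spec_weaken[OF p]) (simp_all add: accepts_def sem_proper_fm valid_def)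
  next
    case 2
    show ?case
    proof (rule spec_Cond, goal_cases)
      case 1
      show ?case by (rule spec_weaken[OF b]) (auto simp: accepts_def)
    next
      case 2
      show ?case by (rule spec_weaken[OF spec_Skip]) (auto simp: accepts_def)
    qed
  qed
qed

text \<open>The state \<open>r\<close> is the one after the preparation, to which the acceptance condition refers.\<close>

lemma spec_verify:
  "spec input_ok (verify k)
    (\<lambda>s s'. \<exists>r. is_prepared k s r \<and>
      output_word s' = [of_bool (s 1 0 = 1 + s 2 0 * s 2 0 + (s 2 0 + 1) \<and> accepts k r)])"
proof -
  let ?c = "Cond right_length (check_certificate k) Skip"
  let ?out = "Seq (Write 0 (Num 0) (var 15)) (assign 1 (Num 1))"
  let ?P = "\<lambda>s. valid k s \<and> s 15 0 = 0"
  have w: "spec (\<lambda>s. True) (Write 0 (Num 0) (var 15)) (\<lambda>s s'. s' = set_var s 0 (s 15 0))"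
    by (rule spec_weaken[OF spec_Write]) auto
  have o: "spec (\<lambda>s. True) (assign 1 (Num 1)) (\<lambda>s s'. s' = set_var s 1 1)"
    by (rule spec_weaken[OF spec_Write]) auto
  have out: "spec (\<lambda>s. True) ?out (\<lambda>s s'. output_word s' = [s 15 0])"
    by (rule spec_weaken[OF spec_Seq_simple[OF w o]]) (auto simp: output_word_def)
  have check: "spec ?P ?c (\<lambda>s s'. s' 15 0 = of_bool (s 1 0 = s 8 0 + (s 2 0 + 1) \<and> accepts k s))"
  proof (rule spec_Cond, goal_cases)
    case 1
    show ?case by (rule spec_weaken[OF spec_check_certificate]) auto
  next
    case 2
    show ?case by (rule spec_weaken[OF spec_Skip]) auto
  qed
  have w_crit: "2 \<notin> writes (test_critical k)"
    using writes_retest[of 2 k] writes_colour[of 2 "2 * k" "core_bound k"]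
    unfolding test_critical_def load_def by auto
  have w2: "2 \<notin> writes ?c"
    using w_crit writes_test_fm[of 2] unfolding check_certificate_def by auto
  have co: "spec ?P (Seq ?c ?out)
    (\<lambda>s s'. output_word s' = [of_bool (s 1 0 = s 8 0 + (s 2 0 + 1) \<and> accepts k s)])"
    by (rule spec_Seq[OF check out w2]) simp_all
  have a: "spec (valid k) (assign 15 (Num 0)) (\<lambda>s s'. s' = set_var s 15 0)"
    by (rule spec_weaken[OF spec_Write]) auto
  have aco: "spec (valid k) (Seq (assign 15 (Num 0)) (Seq ?c ?out))
    (\<lambda>s s'. output_word s' = [of_bool (s 1 0 = s 8 0 + (s 2 0 + 1) \<and> accepts k s)])"
  proof (rule spec_Seq[OF a co])
    fix s s' assume v: "valid k s" and s': "s' = set_var s 15 0"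
    have ag: "agree {0, 2, 3, 4} s s'" unfolding s' agree_def by simp
    have g: "input_edge s' = input_edge s" "valid k s' = valid k s" "s' 2 = s 2" using agree_graph[OF ag] by simp_all
    show "?P s'" using v g(2) by (simp add: s')
    have en: "entry s' = entry s" unfolding s' by (intro ext) (simp add: entry_def)
    have eq: "s' 1 = s 1" "s' 8 = s 8" "s' 0 = s 0" unfolding s' by simp_all
    have acc: "accepts k s' = accepts k s" unfolding accepts_def critical_set_def g(1,3) en eq ..
    fix s'' assume "output_word s'' = [of_bool (s' 1 0 = s' 8 0 + (s' 2 0 + 1) \<and> accepts k s')]"
    then show "output_word s'' = [of_bool (s 1 0 = s 8 0 + (s 2 0 + 1) \<and> accepts k s)]"
      unfolding acc g(3) eq .
  qed simp
  show ?thesis unfolding verify_def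
  proof (rule spec_Seq[OF _ aco])
    show "spec input_ok (prepare k)
      (\<lambda>s s'. is_prepared k s s')"
      by (rule spec_weaken[OF spec_prepare]) simp_all
    show "2 \<notin> writes (prepare k)" unfolding writes_prepare by simp
    fix s s' assume ok: "input_ok s"
      and 1: "is_prepared k s s'"
    show "valid k s'" by (rule prepared(3)[OF 1 ok])
    have eq: "s' 1 = s 1" "s' 2 = s 2" "s' 8 0 = 1 + s 2 0 * s 2 0" using 1 unfolding is_prepared_def agree_def by simp_all
    fix s'' assume "output_word s'' = [of_bool (s' 1 0 = s' 8 0 + (s' 2 0 + 1) \<and> accepts k s')]"
    then show "\<exists>r. is_prepared k s r \<and>
      output_word s'' = [of_bool (s 1 0 = 1 + s 2 0 * s 2 0 + (s 2 0 + 1) \<and> accepts k r)]"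
      unfolding eq using 1 by (intro exI[of _ s'] conjI) simp_all
  qed
qed

section \<open>Running the programs on encoded graphs\<close>

text \<open>Reading the number of vertices comes first, because all time bounds are stated in terms of array 2.\<close>

definition with_size :: "com \<Rightarrow> com" where
  "with_size c = Seq (assign 2 (Read 0 (Num 0))) c"

definition start_state :: "nat list \<Rightarrow> state" where
  "start_state x = set_var (init_state x) 2 (init_state x 0 0)"

lemma run_with_size:
  assumes "spec P c Q"
  shows "\<exists>p :: nat poly. \<forall>x. P (start_state x) \<longrightarrow>
    (\<exists>t s'. exec (with_size c) (init_state x) t s' \<and> t \<le> poly p (init_state x 0 0) \<and> Q (start_state x) s')"
proof -
  obtain p where p: "\<And>s. P s \<Longrightarrow> \<exists>t s'. exec c s t s' \<and> t \<le> poly p (s 2 0) \<and> Q s s'"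
    using assms unfolding spec_def by blast
  have "\<exists>t s'. exec (with_size c) (init_state x) t s' \<and> t \<le> poly (1 + p) (init_state x 0 0) \<and> Q (start_state x) s'"
    if x: "P (start_state x)" for x
  proof -
    obtain t s' where s': "exec c (start_state x) t s'" "t \<le> poly p (start_state x 2 0)" "Q (start_state x) s'"
      using p[OF x] by blast
    have "exec (assign 2 (Read 0 (Num 0))) (init_state x) 1
      ((init_state x)(2 := (init_state x 2)(aval (Num 0) (init_state x) := aval (Read 0 (Num 0)) (init_state x))))"
      by (rule exec_Write)
    then have "exec (assign 2 (Read 0 (Num 0))) (init_state x) 1 (start_state x)"
      unfolding start_state_def by simp
    from exec_Seq[OF this s'(1)] have "exec (with_size c) (init_state x) (1 + t) s'" unfolding with_size_def .
    moreover have "1 + t \<le> poly (1 + p) (init_state x 0 0)" using s'(2) unfolding start_state_def by simp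
    ultimately show ?thesis using s'(3) by blast
  qed
  then show ?thesis by blast
qed

lemma poly_nat_mono: "(a :: nat) \<le> b \<Longrightarrow> poly p a \<le> poly p b"
  by (induction p) (auto intro!: add_mono mult_mono)

text \<open>The entry in row \<open>i\<close> and column \<open>j\<close> of a matrix that is written row by row.\<close>

lemma concat_rows:
  assumes "\<And>i. i < m \<Longrightarrow> length (f i) = n"
  shows "length (concat (map f [0..<m])) = m * n"
    and "i < m \<Longrightarrow> j < n \<Longrightarrow> concat (map f [0..<m]) ! (i * n + j) = f i ! j"
proof -
  have len: "length (concat (map f [0..<m])) = m * n" if "\<And>i. i < m \<Longrightarrow> length (f i) = n" for m
    using that by (induction m) auto
  show "length (concat (map f [0..<m])) = m * n" using len assms .
  show "concat (map f [0..<m]) ! (i * n + j) = f i ! j" if "i < m" "j < n"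
    using assms that
  proof (induction m)
    case (Suc m)
    have l: "length (concat (map f [0..<m])) = m * n" by (rule len) (use Suc.prems(1) in simp)
    show ?case
    proof (cases "i = m")
      case True
      then show ?thesis using l by (simp add: nth_append)
    next
      case False
      then have im: "i < m" using Suc.prems(2) by simp
      then have "Suc i * n \<le> m * n" by (intro mult_le_mono1) simp
      then have "i * n + j < m * n" using Suc.prems(3) by simp
      then show ?thesis using l Suc.IH im Suc.prems(1,3) by (simp add: nth_append)
    qed
  qed simp
qed

lemma encode_graph:
  assumes "pverts G = {..<n}"
  shows "length (encode_graph G) = 1 + n * n" "encode_graph G ! 0 = n"
    and "i < n \<Longrightarrow> j < n \<Longrightarrow> encode_graph G ! (1 + i * n + j) = of_bool ((i, j) \<in> parcs G)"
proof -
  have eq: "encode_graph G = n # concat (map (\<lambda>i. map (\<lambda>j. of_bool ((i, j) \<in> parcs G)) [0..<n]) [0..<n])"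
    unfolding encode_graph_def Let_def assms by simp
  show "length (encode_graph G) = 1 + n * n"
    unfolding eq using concat_rows(1)[of n "\<lambda>i. map (\<lambda>j. of_bool ((i, j) \<in> parcs G)) [0..<n]" n] by simp
  show "encode_graph G ! 0 = n" unfolding eq by simp
  show "encode_graph G ! (1 + i * n + j) = of_bool ((i, j) \<in> parcs G)" if "i < n" "j < n"
    unfolding eq
    using concat_rows(2)[of n "\<lambda>i. map (\<lambda>j. of_bool ((i, j) \<in> parcs G)) [0..<n]" n i j] that by simp
qed

lemma start_state_encode:
  assumes G: "pair_graph G" "pverts G = {..<n}" and x: "x = encode_graph G @ w"
  shows "init_state x 0 0 = n" "start_state x 2 0 = n" "start_state x 1 0 = 1 + n * n + length w"
    and "adj (start_state x) = (\<lambda>u v. (u, v) \<in> parcs G)"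
    and "i < length w \<Longrightarrow> start_state x 0 (1 + n * n + i) = w ! i"
    and "n \<le> length x"
proof -
  note enc = encode_graph[OF G(2)]
  have len: "length x = 1 + n * n + length w" unfolding x by (simp add: enc(1))
  show n: "init_state x 0 0 = n" unfolding init_state_def using len enc by (simp add: x nth_append)
  show n2: "start_state x 2 0 = n" unfolding start_state_def n by simp
  show "start_state x 1 0 = 1 + n * n + length w" unfolding start_state_def init_state_def by (simp add: len)
  show "n \<le> length x" unfolding len using le_square[of n] by linarith
  have s0: "start_state x 0 i = (if i < length x then x ! i else 0)" for i
    unfolding start_state_def init_state_def by simp
  show "start_state x 0 (1 + n * n + i) = w ! i" if "i < length w"
    unfolding s0 len using that enc(1) by (simp add: x nth_append)
  interpret pair_graph G by (rule G(1))
  show "adj (start_state x) = (\<lambda>u v. (u, v) \<in> parcs G)"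
  proof (intro ext)
    fix u v
    show "adj (start_state x) u v = ((u, v) \<in> parcs G)"
    proof (cases "u < n \<and> v < n")
      case True
      then have "Suc u * n \<le> n * n" by (intro mult_le_mono1) simp
      then have "1 + u * n + v < 1 + n * n" using True by simp
      then have "start_state x 0 (1 + u * n + v) = of_bool ((u, v) \<in> parcs G)"
        unfolding s0 len using enc(1) enc(3)[of u v] True by (simp add: x nth_append)
      then show ?thesis unfolding adj_def n2 using True by simp
    next
      case False
      then show ?thesis unfolding adj_def n2 using in_arcsD1[of u v] in_arcsD2[of u v] G(2) by auto
    qed
  qed
qed

lemma colorable_whole:
  assumes G: "pair_graph G" "pverts G = {..<n}"
  shows "proper_coloring (with_proj G) k f \<longleftrightarrow> (\<forall>u<n. f u < k) \<and> (\<forall>u v. (u, v) \<in> parcs G \<longrightarrow> f u \<noteq> f v)"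
    and "colorable (with_proj G) k \<longleftrightarrow> colourable_on (\<lambda>u v. (u, v) \<in> parcs G) k {..<n}"
proof -
  interpret pair_graph G by (rule G(1))
  show p: "proper_coloring (with_proj G) k f \<longleftrightarrow> (\<forall>u<n. f u < k) \<and> (\<forall>u v. (u, v) \<in> parcs G \<longrightarrow> f u \<noteq> f v)" for f
    unfolding proper_coloring_def by (simp add: G(2) image_subset_iff Ball_def)
  have "u < n \<and> v < n" if "(u, v) \<in> parcs G" for u v using in_arcsD1[OF that] in_arcsD2[OF that] G(2) by simp
  then show "colorable (with_proj G) k \<longleftrightarrow> colourable_on (\<lambda>u v. (u, v) \<in> parcs G) k {..<n}"
    unfolding colorable_def p colourable_on_def by auto
qed

lemma valid_critical:
  assumes G: "pair_graph G" "pverts G = {..<n}"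
  shows "valid_certificate k G (Critical_Subgraph S) \<longleftrightarrow> S \<subseteq> {..<n} \<and>
    \<not> colourable_on (\<lambda>u v. (u, v) \<in> parcs G) k S \<and>
    (\<forall>v\<in>S. colourable_on (\<lambda>u v. (u, v) \<in> parcs G) k (S - {v}))"
proof -
  interpret pair_graph G by (rule G(1))
  have irr: "(u, u) \<notin> parcs G" for u using pair_no_loops by fastforce
  show ?thesis
    using vertex_critical_induced[of S G k] irr finite_subset[of S "{..<n}"] G(2) by auto
qed

text \<open>The entries of a claimed vertex set have to be zeros and ones, because characteristic vectors are; a
word of the right length is then recovered from its tag and its entries.\<close>

lemma accepts_iff:
  assumes G: "pair_graph G" "pverts G = {..<n}" and x: "x = encode_graph G @ w"
    and r: "is_prepared k (start_state x) r"
  shows "start_state x 1 0 = 1 + start_state x 2 0 * start_state x 2 0 + (start_state x 2 0 + 1) \<and> accepts k r \<longleftrightarrow>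
    (\<exists>c. valid_certificate k G c \<and> w = encode_certificate G c)"
proof -
  note st = start_state_encode[OF G x]
  note pr = prepared[OF r]
  let ?E = "\<lambda>u v. (u, v) \<in> parcs G"
  have n: "card (pverts G) = n" using G(2) by simp
  have input_edge: "input_edge r = ?E" using pr(2) st(4) by simp
  have r2: "r 2 0 = n" and r8: "r 8 0 = 1 + n * n" and r0: "r 0 = start_state x 0"
    using pr(1) st(2) r by (auto simp: is_prepared_def agree_def)
  have len: "start_state x 1 0 = 1 + start_state x 2 0 * start_state x 2 0 + (start_state x 2 0 + 1) \<longleftrightarrow> length w = Suc n"
    unfolding st(2,3) by simp
  have acc: "accepts k r \<longleftrightarrow>
      w ! 0 = 0 \<and> proper_coloring (with_proj G) k (\<lambda>u. w ! Suc u) \<or>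
      w ! 0 = 1 \<and> (\<forall>u<n. w ! Suc u \<le> 1) \<and> valid_certificate k G (Critical_Subgraph {u. u < n \<and> 0 < w ! Suc u})"
    if lw: "length w = Suc n"
  proof -
    have tag: "r 0 (r 8 0) = w ! 0" using st(5)[of 0] lw unfolding r8 r0 by simp
    have en: "entry r u = w ! Suc u" if "u < n" for u
      using st(5)[of "Suc u"] lw that unfolding entry_def r8 r0 by simp
    have set: "{u. u < n \<and> 0 < entry r u} = {u. u < n \<and> 0 < w ! Suc u}" using en by auto
    interpret pair_graph G by (rule G(1))
    have lt: "u < n" "v < n" if "?E u v" for u v using in_arcsD1[OF that] in_arcsD2[OF that] G(2) by simp_all
    have "(\<forall>u v. ?E u v \<longrightarrow> entry r u \<noteq> entry r v) \<longleftrightarrow> (\<forall>u v. ?E u v \<longrightarrow> w ! Suc u \<noteq> w ! Suc v)"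
      using en lt by metis
    moreover have "(\<forall>u<n. entry r u < k) \<longleftrightarrow> (\<forall>u<n. w ! Suc u < k)" "(\<forall>u<n. entry r u \<le> 1) \<longleftrightarrow> (\<forall>u<n. w ! Suc u \<le> 1)"
      using en by simp_all
    moreover have "critical_set k r {u. u < n \<and> 0 < w ! Suc u} \<longleftrightarrow>
        valid_certificate k G (Critical_Subgraph {u. u < n \<and> 0 < w ! Suc u})"
      unfolding critical_set_def input_edge valid_critical[OF G] by auto
    ultimately show ?thesis
      unfolding accepts_def input_edge r2 tag set colorable_whole(1)[OF G] by simp
  qed
  show ?thesis unfolding len
  proof
    assume L: "length w = Suc n \<and> accepts k r"
    from iffD1[OF acc[OF conjunct1[OF L]] conjunct2[OF L]] consider
        "w ! 0 = 0" "proper_coloring (with_proj G) k (\<lambda>u. w ! Suc u)"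
      | "w ! 0 = 1" "\<forall>u<n. w ! Suc u \<le> 1" "valid_certificate k G (Critical_Subgraph {u. u < n \<and> 0 < w ! Suc u})"
      by (elim disjE conjE)
    then show "\<exists>c. valid_certificate k G c \<and> w = encode_certificate G c"
    proof cases
      case 1
      have "w = encode_certificate G (Coloring (\<lambda>u. w ! Suc u))"
        unfolding encode_certificate.simps n
        by (rule nth_equalityI) (use L 1 in \<open>auto simp: nth_Cons' simp del: upt_Suc\<close>)
      then show ?thesis using 1 by (intro exI[of _ "Coloring (\<lambda>u. w ! Suc u)"]) simp
    next
      case 2
      have bit: "w ! Suc u = of_bool (0 < w ! Suc u)" if "u < n" for u
        using 2(2) that by (cases "w ! Suc u") auto
      have "w = encode_certificate G (Critical_Subgraph {u. u < n \<and> 0 < w ! Suc u})"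
        unfolding encode_certificate.simps n
      proof (rule nth_equalityI)
        fix i assume "i < length w"
        then show "w ! i = (1 # map (\<lambda>v. of_bool (v \<in> {u. u < n \<and> 0 < w ! Suc u})) [0..<n]) ! i"
          using L 2(1) bit by (cases i) simp_all
      qed (use L in simp)
      then show ?thesis using 2(3) by blast
    qed
  next
    assume "\<exists>c. valid_certificate k G c \<and> w = encode_certificate G c"
    then obtain c where c: "valid_certificate k G c" "w = encode_certificate G c" by blast
    show "length w = Suc n \<and> accepts k r"
    proof (cases c)
      case (Coloring f)
      have w: "w = 0 # map f [0..<n]" using c(2) Coloring n by simp
      have nth: "w ! Suc u = f u" if "u < n" for u unfolding w using that by simp
      have lw: "length w = Suc n" unfolding w by simp
      interpret pair_graph G by (rule G(1))
      have lt: "u < n" "v < n" if "?E u v" for u v using in_arcsD1[OF that] in_arcsD2[OF that] G(2) by simp_all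
      have "proper_coloring (with_proj G) k f" using c(1) Coloring by simp
      then have "proper_coloring (with_proj G) k (\<lambda>u. w ! Suc u)"
        unfolding colorable_whole(1)[OF G] using nth lt by metis
      moreover have "w ! 0 = 0" unfolding w by simp
      ultimately show ?thesis using acc[OF lw] lw by simp
    next
      case (Critical_Subgraph S)
      have w: "w = 1 # map (\<lambda>v. of_bool (v \<in> S)) [0..<n]" using c(2) Critical_Subgraph n by simp
      have nth: "w ! Suc u = of_bool (u \<in> S)" if "u < n" for u unfolding w using that by simp
      have lw: "length w = Suc n" unfolding w by simp
      have v: "valid_certificate k G (Critical_Subgraph S)" using c(1) Critical_Subgraph by simp
      then have "S \<subseteq> {..<n}" unfolding valid_critical[OF G] by blast
      then have "{u. u < n \<and> 0 < w ! Suc u} = S" using nth by auto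
      moreover have "\<forall>u<n. w ! Suc u \<le> 1" using nth by simp
      moreover have "w ! 0 = 1" unfolding w by simp
      ultimately show ?thesis using acc[OF lw] lw v by simp
    qed
  qed
qed

theorem corollary3:
  fixes k :: nat
  assumes "k \<ge> 1"
  shows "\<exists>A V. poly_time_certifying_coloring k
           {G. input_graph G \<and> induced_free co_gem G \<and> induced_free house G} A V"
proof -
  let ?\<G> = "{G. input_graph G \<and> induced_free (with_proj co_gem) (with_proj G) \<and> induced_free (with_proj house) (with_proj G)}"
  obtain p where p: "\<And>x. input_ok (start_state x) \<Longrightarrow> \<exists>t s'. exec (with_size (solve k)) (init_state x) t s' \<and>
      t \<le> poly p (init_state x 0 0) \<and> solved k (start_state x) s'"
    using run_with_size[OF spec_solve[of k]] by blast
  let ?V = "\<lambda>s s'. \<exists>r. is_prepared k s r \<and>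
      output_word s' = [of_bool (s 1 0 = 1 + s 2 0 * s 2 0 + (s 2 0 + 1) \<and> accepts k r)]"
  obtain q where q: "\<And>x. input_ok (start_state x) \<Longrightarrow> \<exists>t s'. exec (with_size (verify k)) (init_state x) t s' \<and>
      t \<le> poly q (init_state x 0 0) \<and> ?V (start_state x) s'"
    using run_with_size[OF spec_verify[of k]] by blast
  have graph: "\<exists>n. pair_graph G \<and> pverts G = {..<n}" if "G \<in> ?\<G>" for G
    using that unfolding input_graph_def by blast
  have ok: "input_ok (start_state (encode_graph G @ w))" if G: "G \<in> ?\<G>" for G w
  proof -
    obtain n where n: "pair_graph G" "pverts G = {..<n}" using graph[OF G] by blast
    have "cogem_house_free (pverts G) (\<lambda>u v. (u, v) \<in> parcs G)"
      by (rule input_graph_cogem_house_free) (use G in simp_all)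
    then show ?thesis
      unfolding input_ok_def start_state_encode(2,4)[OF n refl] n(2) .
  qed
  have size: "init_state (encode_graph G @ w) 0 0 \<le> length (encode_graph G @ w)" if G: "G \<in> ?\<G>" for G w
  proof -
    obtain n where n: "pair_graph G" "pverts G = {..<n}" using graph[OF G] by blast
    show ?thesis using start_state_encode(1,6)[OF n refl, of w] by simp
  qed
  have time: "poly_time_on X (with_size c)"
    if run: "\<And>x. input_ok (start_state x) \<Longrightarrow> \<exists>t s'. exec (with_size c) (init_state x) t s' \<and>
      t \<le> poly p (init_state x 0 0) \<and> Q (start_state x) s'"
      and X: "\<And>x. x \<in> X \<Longrightarrow> \<exists>G w. G \<in> ?\<G> \<and> x = encode_graph G @ w" for p c Q X
    unfolding poly_time_on_def
  proof (rule exI[of _ p], rule ballI)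
    fix x assume "x \<in> X"
    then obtain G w where G: "G \<in> ?\<G>" "x = encode_graph G @ w" using X by blast
    obtain t s' where t: "exec (with_size c) (init_state x) t s'" "t \<le> poly p (init_state x 0 0)"
      using run ok[OF G(1)] G(2) by blast
    have "poly p (init_state x 0 0) \<le> poly p (length x)"
      unfolding G(2) by (rule poly_nat_mono[OF size[OF G(1)]])
    then show "\<exists>t s. exec (with_size c) (init_state x) t s \<and> t \<le> poly p (length x)"
      using t order_trans by blast
  qed
  have A_time: "poly_time_on (encode_graph ` ?\<G>) (with_size (solve k))"
  proof (rule time[OF p])
    fix x assume "x \<in> encode_graph ` ?\<G>"
    then obtain G where "G \<in> ?\<G>" "x = encode_graph G" by (rule imageE)
    then show "\<exists>G w. G \<in> ?\<G> \<and> x = encode_graph G @ w" by (intro exI[of _ G] exI[of _ "[]"]) simp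
  qed
  have V_time: "poly_time_on {encode_graph G @ w | G w. G \<in> ?\<G>} (with_size (verify k))"
    by (rule time[OF q]) auto
  have A: "(colorable (with_proj G) k \<longrightarrow>
        (\<exists>f. valid_certificate k G (Coloring f) \<and>
          returns (with_size (solve k)) (encode_graph G) (encode_certificate G (Coloring f)))) \<and>
      (\<not> colorable (with_proj G) k \<longrightarrow>
        (\<exists>S. valid_certificate k G (Critical_Subgraph S) \<and>
          returns (with_size (solve k)) (encode_graph G) (encode_certificate G (Critical_Subgraph S))))"
    if G: "G \<in> ?\<G>" for G
  proof -
    obtain n where n: "pair_graph G" "pverts G = {..<n}" using graph[OF G] by blast
    let ?x = "encode_graph G"
    have x: "?x = encode_graph G @ []" by simp
    note st = start_state_encode[OF n x]
    have card: "card (pverts G) = n" using n(2) by simp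
    obtain t s' where run: "exec (with_size (solve k)) (init_state ?x) t s'" and sol: "solved k (start_state ?x) s'"
      using p[of ?x] ok[OF G, of "[]"] by auto
    have ret: "returns (with_size (solve k)) ?x (output_word s')" unfolding returns_def using run by blast
    from sol consider
        f where "\<forall>u<n. f u < k" "\<forall>u v. (u, v) \<in> parcs G \<longrightarrow> f u \<noteq> f v" "output_word s' = 0 # map f [0..<n]"
      | S where "S \<subseteq> {..<n}" "\<not> colourable_on (\<lambda>u v. (u, v) \<in> parcs G) k S"
          "\<forall>v\<in>S. colourable_on (\<lambda>u v. (u, v) \<in> parcs G) k (S - {v})"
          "output_word s' = 1 # map (\<lambda>v. of_bool (v \<in> S)) [0..<n]"
      unfolding solved_def st(2,4) by blast
    then show ?thesis
    proof cases
      case 1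
      then have f: "proper_coloring (with_proj G) k f" unfolding colorable_whole(1)[OF n] by blast
      then have "colorable (with_proj G) k" unfolding colorable_def by blast
      moreover have "encode_certificate G (Coloring f) = output_word s'" using 1(3) card by simp
      ultimately show ?thesis using f ret by (metis valid_certificate.simps(1))
    next
      case 2
      then have "\<not> colorable (with_proj G) k"
        unfolding colorable_whole(2)[OF n] using colourable_on_subset by blast
      moreover have "valid_certificate k G (Critical_Subgraph S)"
        unfolding valid_critical[OF n] using 2(1-3) by blast
      moreover have "encode_certificate G (Critical_Subgraph S) = output_word s'" using 2(4) card by simp
      ultimately show ?thesis using ret by metis
    qed
  qed
  have V: "returns (with_size (verify k)) (encode_graph G @ w) [1] \<longleftrightarrow>
      (\<exists>c. valid_certificate k G c \<and> w = encode_certificate G c)" if G: "G \<in> ?\<G>" for G w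
  proof -
    obtain n where n: "pair_graph G" "pverts G = {..<n}" using graph[OF G] by blast
    let ?x = "encode_graph G @ w"
    obtain t s' r where run: "exec (with_size (verify k)) (init_state ?x) t s'"
      and r: "is_prepared k (start_state ?x) r"
      and out: "output_word s' = [of_bool (start_state ?x 1 0 = 1 + start_state ?x 2 0 * start_state ?x 2 0 +
        (start_state ?x 2 0 + 1) \<and> accepts k r)]"
      using q[OF ok[OF G]] by blast
    have "returns (with_size (verify k)) ?x [1] \<longleftrightarrow> output_word s' = [1]"
      unfolding returns_def using run exec_deterministic[OF run] by blast
    also have "\<dots> \<longleftrightarrow> (\<exists>c. valid_certificate k G c \<and> w = encode_certificate G c)"
      unfolding out accepts_iff[OF n refl r] by simp
    finally show ?thesis .
  qed
  have "poly_time_certifying_coloring k ?\<G> (with_size (solve k)) (with_size (verify k))"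
    unfolding poly_time_certifying_coloring_def
  proof (intro conjI ballI allI)
    fix G assume G: "G \<in> ?\<G>"
    note A[OF G]
    then show "colorable (with_proj G) k \<longrightarrow>
        (\<exists>f. valid_certificate k G (Coloring f) \<and>
          returns (with_size (solve k)) (encode_graph G) (encode_certificate G (Coloring f)))"
      "\<not> colorable (with_proj G) k \<longrightarrow>
        (\<exists>S. valid_certificate k G (Critical_Subgraph S) \<and>
          returns (with_size (solve k)) (encode_graph G) (encode_certificate G (Critical_Subgraph S)))"
      by (rule conjunct1, rule conjunct2)
    show "returns (with_size (verify k)) (encode_graph G @ w) [1] \<longleftrightarrow>
        (\<exists>c. valid_certificate k G c \<and> w = encode_certificate G c)" for w
      by (rule V[OF G])
  qed (rule A_time V_time)+
  then show ?thesis by (intro exI)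
qed

end
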